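(* Suppose that $k\in\mathbb{C}$ with $\Im(k)\ge 0$ and $\Re(k)>0$. Let $\phi\in L^2(\mathbb{R})+L^\infty(\mathbb{R})$ and define $u(\boldsymbol{x})$, for $\boldsymbol{x}=(x_1,x_2)\in\mathbb{R}^2_+:=(0,\infty)\times\mathbb{R}$, by $$u(\boldsymbol{x}):=\int_{\mathbb{R}}\mathcal{H}(k;x_1,x_2-t)\,\phi(t)\,\mathrm{d}t .$$ Then the integral is well-defined as a Lebesgue integral for $\boldsymbol{x}\in\mathbb{R}^2_+$, $u\in C^\infty(\mathbb{R}^2_+)$, and $\Delta u+k^2u=0$ in $\mathbb{R}^2_+$. Moreover, if $\phi$ is continuous on an open interval $I\subset\mathbb{R}$, then $u\in C(\mathbb{R}^2_+\cup\gamma)$ where $\gamma:=\{(0,t):t\in I\}$, and $u(0,t)=\phi(t)$ for $t\in I$ (that is, $u$ extended to $\gamma$ by these values is continuous on $\mathbb{R}^2_+\cup\gamma$). Finally, if $\phi\in L^2(\mathbb{R})$ and $\Im(k)>0$, then $u\in L^2(\mathbb{R}^2_+)$ and there exists a constant $C_\infty>0$ independent of $\phi$ such that $$\|u\|_{L^2(\mathbb{R}^2_+)}\le C_\infty\|\phi\|_{L^2(\mathbb{R})},$$ whereas if $\phi\in L^2(\mathbb{R})$ and $\Im(k)=0$ then, for any $L>0$, $u\in L^2(\omega_L)$ where $\omega_L:=\{\boldsymbol{x}\in\mathbb{R}^2_+: x_1<L\}$, and there exists a constant $C_L>0$ independent of $\phi$ such that $$\|u\|_{L^2(\omega_L)}\le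 C_L\|\phi\|_{L^2(\mathbb{R})}.$$
   Context: The kernel is $\mathcal{H}(k;x_1,x_2):=\dfrac{\mathrm{i}kx_1}{2}\dfrac{H^{(1)}_1(k|\boldsymbol{x}|)}{|\boldsymbol{x}|}$ for $\boldsymbol{x}=(x_1,x_2)$ with $x_1>0$, where $H^{(1)}_1$ is the Hankel function of the first kind of order 1. *)

theory Defs
  imports "HOL-Analysis.Analysis"
begin

section \<open>Bessel and Hankel functions of integer order\<close>

definition bessel_J :: "nat \<Rightarrow> complex \<Rightarrow> complex" where
  "bessel_J n z =
     (\<Sum>p. (-1) ^ p / (fact p * fact (n + p)) * (z / 2) ^ (n + 2 * p))"

text \<open>
  The Neumann (or Weber) function as in Colton and Kress, "Inverse Acoustic and
  Electromagnetic Scattering Theory". It agrees with DLMF 10.8.1, where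
  \<open>\<psi>(p + 1) = harm p - \<gamma>\<close>.
  The branch cut is that of the principal logarithm, along the negative real axis.
\<close>

definition bessel_Y :: "nat \<Rightarrow> complex \<Rightarrow> complex" where
  "bessel_Y n z =
     2 / of_real pi * (Ln (z / 2) + euler_mascheroni) * bessel_J n z
     - 1 / of_real pi * (\<Sum>p<n. fact (n - 1 - p) / fact p * (2 / z) powi (int n - 2 * int p))
     - 1 / of_real pi * (\<Sum>p. (-1) ^ p / (fact p * fact (n + p)) * (z / 2) ^ (n + 2 * p)
                                * (harm (n + p) + harm p))"

definition hankel1 :: "nat \<Rightarrow> complex \<Rightarrow> complex" where
  "hankel1 n z = bessel_J n z + \<i> * bessel_Y n z"


section \<open>The kernel and the double-layer type potential\<close>

definition kernel_H :: "complex \<Rightarrow> real \<Rightarrow> real \<Rightarrow> complex" where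
  "kernel_H k x1 x2 =
     \<i> * k * of_real x1 / 2 * (hankel1 1 (k * of_real (norm (x1, x2))) / of_real (norm (x1, x2)))"

definition half_plane :: "(real \<times> real) set" where
  "half_plane = {0<..} \<times> UNIV"

definition strip :: "real \<Rightarrow> (real \<times> real) set" where
  "strip L = {x \<in> half_plane. fst x < L}"

definition potential_integrand ::
    "complex \<Rightarrow> (real \<Rightarrow> complex) \<Rightarrow> real \<times> real \<Rightarrow> real \<Rightarrow> complex" where
  "potential_integrand k \<phi> x t = kernel_H k (fst x) (snd x - t) * \<phi> t"

text \<open>Only the values on the half plane are meaningful.\<close>

definition potential :: "complex \<Rightarrow> (real \<Rightarrow> complex) \<Rightarrow> real \<times> real \<Rightarrow> complex" where
  "potential k \<phi> x = (LINT t|lebesgue. potential_integrand k \<phi> x t)"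


section \<open>Lebesgue spaces\<close>

text \<open>
  The spaces consist of functions, not of equivalence classes. For a complete measure,
  \<open>L2_plus_Linf\<close> is closed under changes on null sets, so its members are exactly the
  representatives of the classes in \<open>L\<^sup>2 + L\<^sup>\<infinity>\<close>.
\<close>

definition L2_space :: "'a measure \<Rightarrow> ('a \<Rightarrow> complex) set" where
  "L2_space M = {f \<in> borel_measurable M. integrable M (\<lambda>x. (cmod (f x))\<^sup>2)}"

definition L2_norm :: "'a measure \<Rightarrow> ('a \<Rightarrow> complex) \<Rightarrow> real" where
  "L2_norm M f = sqrt (LINT x|M. (cmod (f x))\<^sup>2)"

definition Linf_space :: "'a measure \<Rightarrow> ('a \<Rightarrow> complex) set" where
  "Linf_space M = {f \<in> borel_measurable M. \<exists>B. AE x in M. cmod (f x) \<le> B}"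

definition L2_plus_Linf :: "'a measure \<Rightarrow> ('a \<Rightarrow> complex) set" where
  "L2_plus_Linf M = {\<lambda>x. f x + g x | f g. f \<in> L2_space M \<and> g \<in> Linf_space M}"


section \<open>Smoothness and the Laplacian\<close>

text \<open>
  To be used on open sets \<open>S\<close> only, where the (total) real derivatives of \<open>f\<close> at points of
  \<open>S\<close> depend only on the restriction of \<open>f\<close> to \<open>S\<close>. Continuity of each derivative in the range
  up to order \<open>n\<close> follows from the base case at order \<open>n\<close> and differentiability below it.
\<close>

primrec C_k_on ::
    "nat \<Rightarrow> ('a::real_normed_vector \<Rightarrow> 'b::real_normed_vector) \<Rightarrow> 'a set \<Rightarrow> bool" where
  "C_k_on 0 f S \<longleftrightarrow> continuous_on S f"
| "C_k_on (Suc n) f S \<longleftrightarrow>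
     (\<forall>x\<in>S. f differentiable (at x)) \<and>
     (\<forall>v. C_k_on n (\<lambda>x. frechet_derivative f (at x) v) S)"

definition C_infinity_on ::
    "('a::real_normed_vector \<Rightarrow> 'b::real_normed_vector) \<Rightarrow> 'a set \<Rightarrow> bool" where
  "C_infinity_on f S \<longleftrightarrow> (\<forall>n. C_k_on n f S)"

definition laplacian ::
    "('a::euclidean_space \<Rightarrow> 'b::real_normed_vector) \<Rightarrow> 'a \<Rightarrow> 'b" where
  "laplacian f x =
     (\<Sum>b\<in>Basis. frechet_derivative (\<lambda>y. frechet_derivative f (at y) b) (at x) b)"

end

(* The Hankel function enters only through the identity
     kernel_H k x1 x2 = x1 / (pi r^2) * macK (-i k r),   r = |(x1, x2)|,
   where macK w = w K_1(w) is given by a convergent Gaussian integral. That integral yields the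
   decay |macK w| <= C exp(-Re w) (1 + sqrt |w|) and the limit 1 at 0, so the kernel is the
   Poisson kernel of the half plane times a factor that tends to 1 at the origin and decays at
   infinity.

   The integral and the power series of the Bessel functions solve the same second order equation.
   On the positive real axis their difference vanishes at 0 and is negligible at infinity against
   the growing solution, so it is 0 by the maximum principle; the identity theorem extends this
   to complex arguments.

   Cauchy's inequality for the profile as a function of r^2 bounds all derivatives of the kernel by
   multiples of (1 + x2^2)^(-3/4), locally uniformly in x1. This weight lies in L1 and in L2, so one
   may differentiate under the integral. The boundary values follow from the unit mass of the Poisson
   kernel, and the L2 estimates from Young's inequality on each line x1 = const. *)

theory Submission
  imports Defs "HOL-Complex_Analysis.Complex_Analysis" "HOL-Probability.Distributions" "HOL-Real_Asymp.Real_Asymp"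
begin

section \<open>An integral representation of the Macdonald function\<close>

text \<open>The series of the Hankel function say nothing directly about infinity, where growing
  terms cancel, and for real \<open>k\<close> the argument \<open>w = -i k r\<close> runs along the
  negative imaginary axis, where \<open>exp (- w)\<close> does not decay. The integral for
  \<open>w K_1(w)\<close> is therefore taken in a form whose Gaussian weight does not depend on
  \<open>w\<close>, on a half plane tilted so as to contain both the positive reals and the negative
  imaginary axis.

  Identifying series and integral takes information at both ends of the real axis: with
  \<open>q = w^2 / 4\<close> the equation is \<open>q y'' = y\<close>, whose solutions are all
  bounded near 0, so the value at 0 leaves a multiple of the growing solution undetermined. At
  infinity a crude bound on the series suffices, since it only has to be small relative to that
  solution.

  Working in \<open>r^2\<close> instead of \<open>r\<close> leaves polynomials in the coordinates
  and derivatives of one holomorphic profile, so that a class of kernels closed under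
  differentiation can be written down.\<close>

lemma has_derivative_integral_dominated:
  fixes f :: "'a::real_normed_vector \<Rightarrow> 'b \<Rightarrow> 'c::{banach,second_countable_topology}"
  assumes U: "open U" "convex U" "x0 \<in> U"
    and der: "\<And>x t. x \<in> U \<Longrightarrow> ((\<lambda>x. f x t) has_derivative f' x t) (at x)"
    and int: "\<And>x. x \<in> U \<Longrightarrow> integrable M (f x)"
    and meas: "\<And>h. (\<lambda>t. f' x0 t h) \<in> borel_measurable M"
    and bound: "\<And>x t h. x \<in> U \<Longrightarrow> norm (f' x t h) \<le> B t * norm h"
    and B: "integrable M B" and Bnn: "\<And>t. 0 \<le> B t"
  shows "((\<lambda>x. \<integral>t. f x t \<partial>M) has_derivative (\<lambda>h. \<integral>t. f' x0 t h \<partial>M)) (at x0)"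
proof -
  have int': "integrable M (\<lambda>t. f' x0 t h)" for h
  proof (rule Bochner_Integration.integrable_bound)
    show "integrable M (\<lambda>t. B t * norm h)"
      using B by simp
    show "AE t in M. norm (f' x0 t h) \<le> norm (B t * norm h)"
      using bound[OF U(3)] by (auto intro: order_trans[OF _ abs_ge_self])
  qed (fact meas)
  have lin: "bounded_linear (f' x0 t)" for t
    using der[OF U(3)] by (rule has_derivative_bounded_linear)
  have blin: "bounded_linear (\<lambda>h. \<integral>t. f' x0 t h \<partial>M)"
  proof (rule bounded_linear_intro[where K = "\<integral>t. B t \<partial>M"])
    fix h h' :: 'a and r :: real
    show "(\<integral>t. f' x0 t (h + h') \<partial>M) = (\<integral>t. f' x0 t h \<partial>M) + (\<integral>t. f' x0 t h' \<partial>M)"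
      by (simp add: linear_add[OF bounded_linear.linear[OF lin]] Bochner_Integration.integral_add int')
    show "(\<integral>t. f' x0 t (r *\<^sub>R h) \<partial>M) = r *\<^sub>R (\<integral>t. f' x0 t h \<partial>M)"
      by (simp add: linear_scale[OF bounded_linear.linear[OF lin]])
    have "norm (\<integral>t. f' x0 t h \<partial>M) \<le> (\<integral>t. B t * norm h \<partial>M)"
      by (rule order_trans[OF integral_norm_bound integral_mono]) (use int' B bound U in auto)
    then show "norm (\<integral>t. f' x0 t h \<partial>M) \<le> norm h * (\<integral>t. B t \<partial>M)"
      by (simp add: mult.commute)
  qed
  \<comment> \<open>The mean value inequality on the convex set \<open>U\<close> gives the
    increments the same majorant as the derivative, so the difference quotients are dominated by
    \<open>2 * B t\<close>.\<close>
  have lip: "norm (f x t - f x0 t) \<le> B t * norm (x - x0)" if "x \<in> U" for x t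
  proof (rule differentiable_bound[where f = "\<lambda>x. f x t" and f' = "\<lambda>x. f' x t", OF U(2)])
    show "((\<lambda>x. f x t) has_derivative f' y t) (at y within U)" if "y \<in> U" for y
      using der[OF that] by (rule has_derivative_at_withinI)
    show "onorm (f' y t) \<le> B t" if "y \<in> U" for y
      using bound[OF that] Bnn by (intro onorm_bound)
  qed (use that U in auto)
  let ?q = "\<lambda>x t. norm (f x t - f x0 t - f' x0 t (x - x0)) / norm (x - x0)"
  let ?Q = "\<lambda>x. norm ((\<integral>t. f x t \<partial>M) - (\<integral>t. f x0 t \<partial>M) - (\<integral>t. f' x0 t (x - x0) \<partial>M)) / norm (x - x0)"
  \<comment> \<open>Dominated convergence is a statement about sequences, so the limit is tested
    along sequences in \<open>U\<close> that avoid \<open>x0\<close>.\<close>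
  have "(?Q \<longlongrightarrow> 0) (at x0 within U)"
    unfolding tendsto_at_iff_sequentially comp_def
  proof (intro allI impI)
    fix X :: "nat \<Rightarrow> 'a"
    assume X: "\<forall>i. X i \<in> U - {x0}" and lim: "X \<longlonglongrightarrow> x0"
    have qmeas: "?q (X i) \<in> borel_measurable M" for i
    proof -
      have "(\<lambda>t. f (X i) t - f x0 t - f' x0 t (X i - x0)) \<in> borel_measurable M"
        using X U by (intro borel_measurable_diff borel_measurable_integrable int int') auto
      then show ?thesis
        by measurable
    qed
    have qbd: "norm (?q (X i) t) \<le> 2 * B t" for i t
    proof -
      have "norm (f (X i) t - f x0 t - f' x0 t (X i - x0)) \<le> 2 * B t * norm (X i - x0)"
        using norm_triangle_ineq4[of "f (X i) t - f x0 t" "f' x0 t (X i - x0)"]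
          lip[of "X i" t] bound[OF U(3), of t "X i - x0"] X by auto
      then show ?thesis
        using X by (simp add: divide_le_eq)
    qed
    have "(\<lambda>i. \<integral>t. ?q (X i) t \<partial>M) \<longlonglongrightarrow> (\<integral>t. 0 \<partial>M)"
    proof (rule integral_dominated_convergence[where w = "\<lambda>t. 2 * B t"])
      show "AE t in M. (\<lambda>i. ?q (X i) t) \<longlonglongrightarrow> 0"
      proof (rule AE_I2)
        fix t
        have "((\<lambda>y. ?q y t) \<longlongrightarrow> 0) (at x0)"
          using der[OF U(3), of t] unfolding has_derivative_iff_norm by simp
        then have "((\<lambda>y. ?q y t) \<longlongrightarrow> 0) (at x0 within U)"
          by (rule tendsto_within_subset) simp
        then show "(\<lambda>i. ?q (X i) t) \<longlonglongrightarrow> 0"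
          unfolding tendsto_at_iff_sequentially comp_def using X lim by blast
      qed
      show "AE t in M. norm (?q (X i) t) \<le> 2 * B t" for i
        using qbd by (rule AE_I2)
    qed (use qmeas B in simp_all)
    then have lim0: "(\<lambda>i. \<integral>t. ?q (X i) t \<partial>M) \<longlonglongrightarrow> 0"
      by simp
    show "(\<lambda>i. ?Q (X i)) \<longlonglongrightarrow> 0"
    proof (rule Lim_null_comparison[OF _ lim0], rule always_eventually, rule allI)
      fix i
      have iX: "integrable M (f (X i))" and i0: "integrable M (f x0)"
        using int X U by auto
      have "(\<integral>t. f (X i) t \<partial>M) - (\<integral>t. f x0 t \<partial>M) - (\<integral>t. f' x0 t (X i - x0) \<partial>M)
        = (\<integral>t. f (X i) t - f x0 t - f' x0 t (X i - x0) \<partial>M)"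
        by (simp add: Bochner_Integration.integral_diff iX i0 int')
      then have "norm ((\<integral>t. f (X i) t \<partial>M) - (\<integral>t. f x0 t \<partial>M) - (\<integral>t. f' x0 t (X i - x0) \<partial>M))
         \<le> (\<integral>t. norm (f (X i) t - f x0 t - f' x0 t (X i - x0)) \<partial>M)"
        by simp
      then show "norm (?Q (X i)) \<le> (\<integral>t. ?q (X i) t \<partial>M)"
        by (simp add: divide_right_mono)
    qed
  qed
  then have "((\<lambda>x. \<integral>t. f x t \<partial>M) has_derivative (\<lambda>h. \<integral>t. f' x0 t h \<partial>M)) (at x0 within U)"
    unfolding has_derivative_iff_norm using blin by simp
  then show ?thesis
    unfolding at_within_open[OF U(3,1)] .
qed

section \<open>Absolute moments of the Gaussian weight\<close>

lemma gaussian_abs_moment_integrable: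
  "integrable lborel (\<lambda>s::real. exp (- s\<^sup>2) * \<bar>s\<bar> ^ n)"
proof (cases "even n")
  case True
  then obtain k where n: "n = 2 * k" by blast
  have "has_bochner_integral lborel (\<lambda>s::real. exp (- s\<^sup>2) * s ^ (2 * k))
      (2 *\<^sub>R (sqrt pi / 2 * (fact (2 * k) / (2 ^ (2 * k) * fact k))))"
    using gaussian_moment_even_pos[of k] by (intro has_bochner_integral_even_function) auto
  then show ?thesis
    by (auto simp: n power_even_abs dest: integrable.intros)
next
  case False
  then obtain k where n: "n = 2 * k + 1" using oddE by blast
  have "has_bochner_integral lborel (\<lambda>s::real. indicator {0..} s *\<^sub>R (exp (- s\<^sup>2) * \<bar>s\<bar> ^ (2 * k + 1))) (fact k / 2)"
    using gaussian_moment_odd_pos[of k]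
    by (rule has_bochner_integral_cong[THEN iffD1, rotated 3]) (auto split: split_indicator)
  from has_bochner_integral_even_function[OF this] show ?thesis
    by (auto simp: n dest: integrable.intros)
qed

text \<open>This number is the limit of \<open>w K_1(w)\<close> at 0: there
  \<open>csqrt (s^2 + 2 w)\<close> degenerates to \<open>\<bar>s\<bar>\<close>, and the weight
  \<open>s^2\<close> turns it into the third moment.\<close>

lemma gaussian_abs_moment_3:
  "(\<integral>s. exp (- s\<^sup>2) * \<bar>s\<bar> ^ 3 \<partial>(lborel :: real measure)) = 1"
proof -
  have "has_bochner_integral lborel (\<lambda>s::real. indicator {0..} s *\<^sub>R (exp (- s\<^sup>2) * \<bar>s\<bar> ^ (2 * 1 + 1))) (fact 1 / 2)"
    using gaussian_moment_odd_pos[of 1]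
    by (rule has_bochner_integral_cong[THEN iffD1, rotated 3]) (auto split: split_indicator)
  from has_bochner_integral_even_function[OF this]
  have "has_bochner_integral lborel (\<lambda>s::real. exp (- s\<^sup>2) * \<bar>s\<bar> ^ 3) 1"
    by (simp add: numeral_eq_Suc)
  then show ?thesis
    by (rule has_bochner_integral_integral_eq)
qed

text \<open>
  A half plane that avoids the cut \<open>(-\<infinity>, 0]\<close>, is invariant under adding
  nonnegative reals, and contains \<open>- \<i> k r\<close> for all admissible wave numbers \<open>k\<close>, real ones included.
\<close>

definition wedge :: "complex set" where
  "wedge = {w. Im w < Re w}"

lemma open_wedge: "open wedge"
  unfolding wedge_def by (intro open_Collect_less continuous_intros)

lemma convex_wedge: "convex wedge"
proof -
  have "wedge = {w. inner (Complex (-1) 1) w < 0}"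
    by (auto simp: wedge_def inner_complex_def)
  then show ?thesis
    using convex_halfspace_lt by metis
qed

lemma wedge_not_nonpos: "w \<in> wedge \<Longrightarrow> w \<notin> \<real>\<^sub>\<le>\<^sub>0"
  by (auto simp: wedge_def complex_nonpos_Reals_iff)

lemma wedge_nonzero: "w \<in> wedge \<Longrightarrow> w \<noteq> 0"
  by (auto simp: wedge_def)

lemma wedge_shift: "w \<in> wedge \<Longrightarrow> of_real (s\<^sup>2) + 2 * w \<in> wedge"
proof -
  assume "w \<in> wedge"
  then have "2 * Im w < 2 * Re w"
    by (simp add: wedge_def)
  also have "\<dots> \<le> s\<^sup>2 + 2 * Re w"
    by simp
  finally show ?thesis by (simp add: wedge_def)
qed

text \<open>\<open>Re w - Im w\<close> measures the distance to the edge of the wedge, is linear and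
  does not decrease under shifts by \<open>s^2\<close>. The bound is free of \<open>s\<close>, which
  keeps \<open>s^2 + 2 w\<close> uniformly away from the singularity of its negative powers.\<close>

lemma wedge_shift_norm: "norm (complex_of_real (s\<^sup>2) + 2 * w) \<ge> Re w - Im w"
proof -
  let ?z = "complex_of_real (s\<^sup>2) + 2 * w"
  have "2 * (Re w - Im w) \<le> Re ?z - Im ?z"
    by simp
  also have "\<dots> \<le> 2 * norm ?z"
    using abs_Re_le_cmod[of ?z] abs_Im_le_cmod[of ?z] by linarith
  finally show ?thesis by simp
qed

lemma wedge_shift_sqrt_norm:
  "sqrt (norm (complex_of_real (s\<^sup>2) + 2 * w)) \<le> \<bar>s\<bar> + sqrt (2 * norm w)"
proof -
  have "norm (complex_of_real (s\<^sup>2) + 2 * w) \<le> s\<^sup>2 + 2 * norm w"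
    by (rule order_trans[OF norm_triangle_ineq]) (simp add: norm_power norm_mult)
  then have "sqrt (norm (complex_of_real (s\<^sup>2) + 2 * w)) \<le> sqrt (s\<^sup>2 + 2 * norm w)"
    by simp
  also have "\<dots> \<le> sqrt (s\<^sup>2) + sqrt (2 * norm w)"
    by (rule sqrt_add_le_add_sqrt) auto
  finally show ?thesis by simp
qed

text \<open>One condition that covers the square root and the powers \<open>z^(-1/2)\<close> and
  \<open>z^(-3/2)\<close>, which come up in its derivatives. The cut-off \<open>c\<close> is there
  for the latter two, which blow up at 0.\<close>

definition sqrt_growth :: "(complex \<Rightarrow> complex) \<Rightarrow> bool" where
  "sqrt_growth F \<longleftrightarrow> continuous_on wedge F \<and>
     (\<forall>c>0. \<exists>K\<ge>0. \<forall>z\<in>wedge. c \<le> norm z \<longrightarrow> norm (F z) \<le> K * sqrt (norm z))"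

text \<open>With \<open>t = 1 + s^2 / w\<close> one has \<open>dt = 2 s ds / w\<close> and
  \<open>sqrt (t^2 - 1) = s sqrt (s^2 + 2 w) / w\<close>; this yields the factor \<open>s^2\<close>,
  and integrating over the whole line instead of \<open>s > 0\<close> absorbs the 2. All dependence
  on \<open>w\<close> sits inside \<open>F\<close>.\<close>

definition gauss_transform :: "(complex \<Rightarrow> complex) \<Rightarrow> complex \<Rightarrow> complex" where
  "gauss_transform F w = (\<integral>s. of_real (exp (- s\<^sup>2) * s\<^sup>2) * F (of_real (s\<^sup>2) + 2 * w) \<partial>lborel)"

lemma gauss_transform_measurable:
  assumes "sqrt_growth F" "w \<in> wedge"
  shows "(\<lambda>s. of_real (exp (- s\<^sup>2) * s\<^sup>2) * F (of_real (s\<^sup>2) + 2 * w)) \<in> borel_measurable lborel"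
proof -
  have "continuous_on UNIV (\<lambda>s. F (of_real (s\<^sup>2) + 2 * w))"
    by (rule continuous_on_compose2[of wedge F])
      (use assms wedge_shift in \<open>auto simp: sqrt_growth_def intro!: continuous_intros\<close>)
  then show ?thesis
    by (intro borel_measurable_continuous_onI[THEN measurable_compose[OF measurable_ident_sets, rotated]]
       continuous_intros) auto
qed

lemma gauss_transform_bound_integrable:
  "integrable lborel (\<lambda>s::real. (exp (- s\<^sup>2) * s\<^sup>2) * (K * (\<bar>s\<bar> + R)))"
proof -
  have "integrable lborel (\<lambda>s::real. K * (exp (- s\<^sup>2) * \<bar>s\<bar> ^ 3) + K * R * (exp (- s\<^sup>2) * \<bar>s\<bar> ^ 2))"
    by (intro Bochner_Integration.integrable_add integrable_mult_right gaussian_abs_moment_integrable)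
  then show ?thesis
    by (rule Bochner_Integration.integrable_cong[THEN iffD1, rotated -1])
      (auto simp: algebra_simps power3_eq_cube power2_eq_square abs_mult_self_eq)
qed

text \<open>The constant is uniform over the half plane \<open>Re w - Im w \<ge> c\<close>, since
  all shifted arguments have norm at least \<open>c\<close>. Differentiation under the integral
  relies on this uniformity.\<close>

lemma gauss_transform_bound:
  assumes "sqrt_growth F" "c > 0"
  obtains K where "K \<ge> 0" "\<And>w s. Re w - Im w \<ge> c \<Longrightarrow>
     norm (of_real (exp (- s\<^sup>2) * s\<^sup>2) * F (of_real (s\<^sup>2) + 2 * w))
       \<le> (exp (- s\<^sup>2) * s\<^sup>2) * (K * (\<bar>s\<bar> + sqrt (2 * norm w)))"
proof -
  obtain K where K: "K \<ge> 0" "\<And>z. z \<in> wedge \<Longrightarrow> c \<le> norm z \<Longrightarrow> norm (F z) \<le> K * sqrt (norm z)"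
    using assms unfolding sqrt_growth_def by blast
  show thesis
  proof
    fix w :: complex and s :: real
    assume w: "Re w - Im w \<ge> c"
    let ?z = "of_real (s\<^sup>2) + 2 * w"
    have "?z \<in> wedge"
      using w assms(2) by (intro wedge_shift) (auto simp: wedge_def)
    then have "norm (F ?z) \<le> K * sqrt (norm ?z)"
      using K(2)[of ?z] w wedge_shift_norm[of w s] by linarith
    also have "\<dots> \<le> K * (\<bar>s\<bar> + sqrt (2 * norm w))"
      using K(1) wedge_shift_sqrt_norm by (rule mult_left_mono[rotated])
    finally show "norm (of_real (exp (- s\<^sup>2) * s\<^sup>2) * F ?z)
       \<le> (exp (- s\<^sup>2) * s\<^sup>2) * (K * (\<bar>s\<bar> + sqrt (2 * norm w)))"
      unfolding norm_mult norm_of_real by (intro mult_mono) auto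
  qed (fact K)
qed

lemma gauss_transform_integrable:
  assumes "sqrt_growth F" "w \<in> wedge"
  shows "integrable lborel (\<lambda>s. of_real (exp (- s\<^sup>2) * s\<^sup>2) * F (of_real (s\<^sup>2) + 2 * w))"
proof -
  obtain K where K: "K \<ge> 0" "\<And>w' s. Re w' - Im w' \<ge> Re w - Im w \<Longrightarrow>
     norm (of_real (exp (- s\<^sup>2) * s\<^sup>2) * F (of_real (s\<^sup>2) + 2 * w'))
       \<le> (exp (- s\<^sup>2) * s\<^sup>2) * (K * (\<bar>s\<bar> + sqrt (2 * norm w')))"
    using gauss_transform_bound[OF assms(1), of "Re w - Im w"] assms(2) by (auto simp: wedge_def)
  show ?thesis
    by (rule Bochner_Integration.integrable_bound[OF gauss_transform_bound_integrable gauss_transform_measurable[OF assms]])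
      (use K(2)[of w] in \<open>auto intro: order_trans[OF _ abs_ge_self]\<close>)
qed

lemma gauss_transform_deriv:
  assumes F: "sqrt_growth F" "sqrt_growth F'"
    and der: "\<And>z. z \<in> wedge \<Longrightarrow> (F has_field_derivative F' z) (at z)"
    and w0: "w0 \<in> wedge"
  shows "(gauss_transform F has_field_derivative 2 * gauss_transform F' w0) (at w0)"
proof -
  \<comment> \<open>Half of the margin of \<open>w0\<close> leaves a neighbourhood inside the wedge
    on which the margin still exceeds \<open>c\<close>.\<close>
  define c where "c = (Re w0 - Im w0) / 2"
  have c: "c > 0" "c < Re w0 - Im w0"
    using w0 by (auto simp: c_def wedge_def)
  let ?U = "{w. c < Re w - Im w} \<inter> ball w0 1"
  obtain K where K: "K \<ge> 0" "\<And>w s. Re w - Im w \<ge> c \<Longrightarrow>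
     norm (of_real (exp (- s\<^sup>2) * s\<^sup>2) * F' (of_real (s\<^sup>2) + 2 * w))
       \<le> (exp (- s\<^sup>2) * s\<^sup>2) * (K * (\<bar>s\<bar> + sqrt (2 * norm w)))"
    using gauss_transform_bound[OF F(2) c(1)] by blast
  \<comment> \<open>The factor 2 is the inner derivative of \<open>2 * w\<close>;
    \<open>norm w0 + 1\<close> bounds \<open>norm w\<close> on the ball of radius 1.\<close>
  let ?B = "\<lambda>s. (exp (- s\<^sup>2) * s\<^sup>2) * (2 * K * (\<bar>s\<bar> + sqrt (2 * (norm w0 + 1))))"
  have UD: "w \<in> wedge" if "w \<in> ?U" for w
    using that c by (auto simp: wedge_def)
  have "((\<lambda>w. \<integral>s. of_real (exp (- s\<^sup>2) * s\<^sup>2) * F (of_real (s\<^sup>2) + 2 * w) \<partial>lborel) has_derivative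
     (\<lambda>h. \<integral>s. 2 * (of_real (exp (- s\<^sup>2) * s\<^sup>2) * F' (of_real (s\<^sup>2) + 2 * w0)) * h \<partial>lborel)) (at w0)"
  proof (rule has_derivative_integral_dominated[where U = ?U and B = ?B
        and f' = "\<lambda>w s h. 2 * (of_real (exp (- s\<^sup>2) * s\<^sup>2) * F' (of_real (s\<^sup>2) + 2 * w)) * h"])
    show "open ?U"
      by (intro open_Int open_Collect_less continuous_intros open_ball)
    have "{w. c < Re w - Im w} = {w. inner (Complex 1 (-1)) w > c}"
      by (auto simp: inner_complex_def)
    then show "convex ?U"
      by (auto intro!: convex_Int convex_halfspace_gt)
    show "w0 \<in> ?U" using c by auto
    show "((\<lambda>w. of_real (exp (- s\<^sup>2) * s\<^sup>2) * F (of_real (s\<^sup>2) + 2 * w)) has_derivative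
         (\<lambda>h. 2 * (of_real (exp (- s\<^sup>2) * s\<^sup>2) * F' (of_real (s\<^sup>2) + 2 * w)) * h)) (at w)"
      if "w \<in> ?U" for w s
    proof -
      have "((\<lambda>w. of_real (s\<^sup>2) + 2 * w) has_field_derivative 2) (at w)"
        by (auto intro!: derivative_eq_intros)
      from DERIV_chain2[OF der[OF wedge_shift[OF UD[OF that], of s]] this]
      have "((\<lambda>w. of_real (exp (- s\<^sup>2) * s\<^sup>2) * F (of_real (s\<^sup>2) + 2 * w)) has_field_derivative
          2 * (of_real (exp (- s\<^sup>2) * s\<^sup>2) * F' (of_real (s\<^sup>2) + 2 * w))) (at w)"
        by (rule DERIV_cmult[THEN DERIV_cong]) (simp only: mult_ac)
      then show ?thesis
        unfolding has_field_derivative_def .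
    qed
    show "integrable lborel (\<lambda>s. of_real (exp (- s\<^sup>2) * s\<^sup>2) * F (of_real (s\<^sup>2) + 2 * w))"
      if "w \<in> ?U" for w
      by (rule gauss_transform_integrable[OF F(1) UD[OF that]])
    show "(\<lambda>s. 2 * (of_real (exp (- s\<^sup>2) * s\<^sup>2) * F' (of_real (s\<^sup>2) + 2 * w0)) * h) \<in> borel_measurable lborel" for h
      using gauss_transform_measurable[OF F(2) w0] by measurable
    show "norm (2 * (of_real (exp (- s\<^sup>2) * s\<^sup>2) * F' (of_real (s\<^sup>2) + 2 * w)) * h) \<le> ?B s * norm h"
      if "w \<in> ?U" for w s h
    proof -
      have "norm w \<le> norm w0 + 1"
        using that norm_triangle_sub[of w w0] by (auto simp: dist_norm norm_minus_commute)
      then have "(exp (- s\<^sup>2) * s\<^sup>2) * (K * (\<bar>s\<bar> + sqrt (2 * norm w))) \<le>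
         (exp (- s\<^sup>2) * s\<^sup>2) * (K * (\<bar>s\<bar> + sqrt (2 * (norm w0 + 1))))"
        using K(1) by (intro mult_left_mono add_left_mono real_sqrt_le_mono) auto
      with K(2)[of w s] that
      have "norm (of_real (exp (- s\<^sup>2) * s\<^sup>2) * F' (of_real (s\<^sup>2) + 2 * w)) \<le>
         (exp (- s\<^sup>2) * s\<^sup>2) * (K * (\<bar>s\<bar> + sqrt (2 * (norm w0 + 1))))"
        by (intro order_trans[OF K(2)]) auto
      then have "norm (of_real (exp (- s\<^sup>2) * s\<^sup>2) * F' (of_real (s\<^sup>2) + 2 * w)) * (2 * norm h) \<le>
         (exp (- s\<^sup>2) * s\<^sup>2) * (K * (\<bar>s\<bar> + sqrt (2 * (norm w0 + 1)))) * (2 * norm h)"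
        by (intro mult_right_mono) auto
      then show ?thesis
        unfolding norm_mult norm_numeral by (simp only: mult_ac)
    qed
    show "integrable lborel ?B"
      by (rule gauss_transform_bound_integrable)
    show "0 \<le> ?B s" for s
      using K(1) by auto
  qed
  then show ?thesis
    unfolding has_field_derivative_def gauss_transform_def[abs_def]
      integral_mult_left_zero integral_mult_right_zero .
qed

section \<open>The square root and its negative powers as integrands\<close>

lemma sqrt_growth_csqrt: "sqrt_growth csqrt"
  unfolding sqrt_growth_def
proof (intro conjI allI impI)
  show "continuous_on wedge csqrt"
    using wedge_not_nonpos by (auto intro!: continuous_at_imp_continuous_on continuous_at_csqrt)
  show "\<exists>K\<ge>0. \<forall>z\<in>wedge. c \<le> cmod z \<longrightarrow> cmod (csqrt z) \<le> K * sqrt (cmod z)" for c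
    by (rule exI[of _ 1]) simp
qed

lemma sqrt_growth_inverse_csqrt: "sqrt_growth (\<lambda>z. 1 / csqrt z)"
  unfolding sqrt_growth_def
proof (intro conjI allI impI)
  show "continuous_on wedge (\<lambda>z. 1 / csqrt z)"
    using sqrt_growth_csqrt wedge_nonzero by (auto simp: sqrt_growth_def intro!: continuous_intros)
  show "\<exists>K\<ge>0. \<forall>z\<in>wedge. c \<le> cmod z \<longrightarrow> cmod (1 / csqrt z) \<le> K * sqrt (cmod z)" if "c > 0" for c
  proof (intro exI[of _ "1 / c"] conjI ballI impI)
    fix z :: complex assume z: "c \<le> cmod z"
    then have "sqrt (cmod z) * sqrt (cmod z) \<ge> c" "sqrt (cmod z) > 0"
      using that by auto
    then show "cmod (1 / csqrt z) \<le> 1 / c * sqrt (cmod z)"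
      using that by (simp add: norm_divide divide_simps mult.commute)
  qed (use that in auto)
qed

lemma sqrt_growth_inverse_csqrt3: "sqrt_growth (\<lambda>z. 1 / (z * csqrt z))"
  unfolding sqrt_growth_def
proof (intro conjI allI impI)
  show "continuous_on wedge (\<lambda>z. 1 / (z * csqrt z))"
    using sqrt_growth_csqrt wedge_nonzero by (auto simp: sqrt_growth_def intro!: continuous_intros)
  show "\<exists>K\<ge>0. \<forall>z\<in>wedge. c \<le> cmod z \<longrightarrow> cmod (1 / (z * csqrt z)) \<le> K * sqrt (cmod z)" if "c > 0" for c
  proof (intro exI[of _ "1 / c\<^sup>2"] conjI ballI impI)
    fix z :: complex assume z: "c \<le> cmod z"
    have "c * c \<le> cmod z * cmod z"
      using z that by (intro mult_mono) auto
    also have "cmod z * cmod z = cmod z * (sqrt (cmod z) * sqrt (cmod z))"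
      by simp
    finally have *: "c * c \<le> cmod z * (sqrt (cmod z) * sqrt (cmod z))" .
    have "0 < cmod z * sqrt (cmod z)"
      using z that by (intro mult_pos_pos) auto
    then have "1 / (cmod z * sqrt (cmod z)) \<le> sqrt (cmod z) / (c * c)"
      using * that by (simp add: frac_le_eq divide_le_eq le_divide_eq mult_ac del: real_sqrt_mult_self)
    then show "cmod (1 / (z * csqrt z)) \<le> 1 / c\<^sup>2 * sqrt (cmod z)"
      by (simp add: norm_divide norm_mult power2_eq_square)
  qed auto
qed

text \<open>
  Substituting \<open>t = 1 + s\<^sup>2 / w\<close> in \<open>w K\<^sub>1(w) = w\<^sup>2 \<integral>\<^sub>1\<^sup>\<infinity> exp (- w t) (t\<^sup>2 - 1)\<^sup>1\<^sup>/\<^sup>2 dt\<close>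
  gives \<open>exp (- w)\<close> times \<open>mac0 w\<close>; \<open>mac1\<close> and \<open>- mac2\<close> are its first two derivatives.
\<close>

abbreviation "mac0 \<equiv> gauss_transform csqrt"
abbreviation "mac1 \<equiv> gauss_transform (\<lambda>z. 1 / csqrt z)"
abbreviation "mac2 \<equiv> gauss_transform (\<lambda>z. 1 / (z * csqrt z))"

lemma gauss_transform_cmult: "gauss_transform (\<lambda>z. c * F z) w = c * gauss_transform F w"
proof -
  have "gauss_transform (\<lambda>z. c * F z) w
     = (\<integral>s. c * (of_real (exp (- s\<^sup>2) * s\<^sup>2) * F (of_real (s\<^sup>2) + 2 * w)) \<partial>lborel)"
    unfolding gauss_transform_def by (simp only: mult_ac)
  then show ?thesis
    unfolding gauss_transform_def by simp
qed

lemma sqrt_growth_cmult: "sqrt_growth F \<Longrightarrow> sqrt_growth (\<lambda>z. c * F z)"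
  unfolding sqrt_growth_def
proof (elim conjE, intro conjI allI impI)
  fix d :: real
  assume "\<forall>c>0. \<exists>K\<ge>0. \<forall>z\<in>wedge. c \<le> cmod z \<longrightarrow> cmod (F z) \<le> K * sqrt (cmod z)" "d > 0"
  then obtain K where K: "K \<ge> 0" "\<forall>z\<in>wedge. d \<le> cmod z \<longrightarrow> cmod (F z) \<le> K * sqrt (cmod z)"
    by blast
  then show "\<exists>K\<ge>0. \<forall>z\<in>wedge. d \<le> cmod z \<longrightarrow> cmod (c * F z) \<le> K * sqrt (cmod z)"
    by (intro exI[of _ "norm c * K"]) (auto simp: norm_mult mult.assoc intro!: mult_left_mono)
qed (auto intro!: continuous_intros)

lemma mac0_deriv:
  assumes "w \<in> wedge" shows "(mac0 has_field_derivative mac1 w) (at w)"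
proof -
  have "(mac0 has_field_derivative 2 * gauss_transform (\<lambda>z. (1/2) * (1 / csqrt z)) w) (at w)"
  proof (rule gauss_transform_deriv[OF sqrt_growth_csqrt _ _ assms])
    show "(csqrt has_field_derivative (1/2) * (1 / csqrt z)) (at z)" if "z \<in> wedge" for z
      using has_field_derivative_csqrt[OF wedge_not_nonpos[OF that]] by (simp add: field_simps)
  qed (intro sqrt_growth_cmult sqrt_growth_inverse_csqrt)
  then show ?thesis
    unfolding gauss_transform_cmult by simp
qed

lemma mac1_deriv:
  assumes "w \<in> wedge" shows "(mac1 has_field_derivative - mac2 w) (at w)"
proof -
  have "(mac1 has_field_derivative 2 * gauss_transform (\<lambda>z. (-1/2) * (1 / (z * csqrt z))) w) (at w)"
  proof (rule gauss_transform_deriv[OF sqrt_growth_inverse_csqrt _ _ assms])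
    fix z assume z: "z \<in> wedge"
    have "((\<lambda>z. 1 / csqrt z) has_field_derivative - (1 / (2 * csqrt z)) / (csqrt z)\<^sup>2) (at z)"
      using wedge_nonzero[OF z] wedge_not_nonpos[OF z]
      by (auto intro!: derivative_eq_intros simp: power2_eq_square)
    then show "((\<lambda>z. 1 / csqrt z) has_field_derivative (-1/2) * (1 / (z * csqrt z))) (at z)"
      by (simp add: mult_ac)
  qed (intro sqrt_growth_cmult sqrt_growth_inverse_csqrt3)
  then show ?thesis
    unfolding gauss_transform_cmult by simp
qed

text \<open>With \<open>C = csqrt (s^2 + 2 w)\<close> the derivative is
  \<open>exp (- s^2) * s^2\<close> times \<open>(3 - 2 s^2) / C - s^2 / C^3\<close>. Eliminating
  \<open>s^2 = C^2 - 2 w\<close> leaves only \<open>C\<close>, \<open>1 / C\<close> and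
  \<open>1 / C^3\<close>, the integrands of \<open>mac0\<close>, \<open>mac1\<close> and
  \<open>mac2\<close>. As the primitive vanishes at both infinities, integration gives a linear
  relation between these three.\<close>

lemma has_vector_derivative_macdonald_primitive:
  assumes w: "w \<in> wedge"
  shows "((\<lambda>s. of_real (exp (- s\<^sup>2) * s ^ 3) * (1 / csqrt (of_real (s\<^sup>2) + 2 * w))) has_vector_derivative
     (-2) * (of_real (exp (- s\<^sup>2) * s\<^sup>2) * csqrt (of_real (s\<^sup>2) + 2 * w))
     + 2 * (2 * w + 1) * (of_real (exp (- s\<^sup>2) * s\<^sup>2) * (1 / csqrt (of_real (s\<^sup>2) + 2 * w)))
     + 2 * w * (of_real (exp (- s\<^sup>2) * s\<^sup>2) * (1 / ((of_real (s\<^sup>2) + 2 * w) * csqrt (of_real (s\<^sup>2) + 2 * w))))) (at s)"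
proof -
  let ?z = "complex_of_real s"
  define C where "C = csqrt (?z\<^sup>2 + 2 * w)"
  have S: "?z\<^sup>2 + 2 * w \<in> wedge"
    using wedge_shift[OF w, of s] by simp
  then have Cnz: "C \<noteq> 0" and C2: "?z\<^sup>2 = C\<^sup>2 - 2 * w"
    using wedge_nonzero by (auto simp: C_def)
  have z3: "?z ^ 3 = ?z\<^sup>2 * ?z"
    by (simp add: power3_eq_cube power2_eq_square)
  have "((\<lambda>z. exp (- z\<^sup>2) * z ^ 3 * (1 / csqrt (z\<^sup>2 + 2 * w))) has_field_derivative
      (exp (- ?z\<^sup>2) * (- (2 * ?z)) * ?z ^ 3 + exp (- ?z\<^sup>2) * (3 * ?z\<^sup>2)) * (1 / C)
      + exp (- ?z\<^sup>2) * ?z ^ 3 * (- (2 * ?z / (2 * C)) / C\<^sup>2)) (at ?z)"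
    using wedge_not_nonpos[OF S] Cnz unfolding C_def
    by (auto intro!: derivative_eq_intros simp: power2_eq_square field_simps)
  also have "(exp (- ?z\<^sup>2) * (- (2 * ?z)) * ?z ^ 3 + exp (- ?z\<^sup>2) * (3 * ?z\<^sup>2)) * (1 / C)
      + exp (- ?z\<^sup>2) * ?z ^ 3 * (- (2 * ?z / (2 * C)) / C\<^sup>2)
    = exp (- ?z\<^sup>2) * ?z\<^sup>2 * ((3 - 2 * ?z\<^sup>2) / C - ?z\<^sup>2 / C ^ 3)"
    unfolding z3 using Cnz by (simp add: divide_simps) (simp add: algebra_simps power2_eq_square power3_eq_cube)
  also have "(3 - 2 * ?z\<^sup>2) / C - ?z\<^sup>2 / C ^ 3 = -2 * C + 2 * (2 * w + 1) / C + 2 * w / (C\<^sup>2 * C)"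
    unfolding C2 using Cnz by (simp add: divide_simps) (simp add: algebra_simps power2_eq_square power3_eq_cube)
  finally have "((\<lambda>s. exp (- (of_real s)\<^sup>2) * (of_real s) ^ 3 * (1 / csqrt ((of_real s)\<^sup>2 + 2 * w))) has_vector_derivative
     exp (- ?z\<^sup>2) * ?z\<^sup>2 * (-2 * C + 2 * (2 * w + 1) / C + 2 * w / (C\<^sup>2 * C))) (at s)"
    by (rule has_vector_derivative_real_field)
  moreover have "C\<^sup>2 = ?z\<^sup>2 + 2 * w"
    by (simp add: C_def)
  ultimately show ?thesis
    by (simp add: C_def algebra_simps flip: exp_of_real)
qed

lemma macdonald_primitive_tendsto_0:
  assumes w: "w \<in> wedge" and F: "F = at_top \<or> F = at_bot"
  shows "((\<lambda>s. of_real (exp (- s\<^sup>2) * s ^ 3) * (1 / csqrt (of_real (s\<^sup>2) + 2 * w))) \<longlongrightarrow> 0) F"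
proof -
  define c where "c = Re w - Im w"
  have c: "c > 0" using w by (auto simp: c_def wedge_def)
  have lim: "((\<lambda>s::real. exp (- s\<^sup>2) * \<bar>s\<bar> ^ 3 / sqrt c) \<longlongrightarrow> 0) F"
    using F c by (elim disjE) (simp_all, real_asymp+)
  show ?thesis
  proof (rule Lim_null_comparison[OF _ lim], rule always_eventually, rule allI)
    fix s
    have "sqrt c \<le> sqrt (norm (complex_of_real (s\<^sup>2) + 2 * w))"
      using wedge_shift_norm[of w s] by (simp add: c_def)
    then have "1 / sqrt (norm (complex_of_real (s\<^sup>2) + 2 * w)) \<le> 1 / sqrt c"
      using c by (intro divide_left_mono mult_pos_pos) (auto intro: less_le_trans)
    then have "(exp (- s\<^sup>2) * \<bar>s\<bar> ^ 3) * (1 / sqrt (norm (complex_of_real (s\<^sup>2) + 2 * w)))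
       \<le> (exp (- s\<^sup>2) * \<bar>s\<bar> ^ 3) * (1 / sqrt c)"
      by (intro mult_left_mono) auto
    then show "norm (of_real (exp (- s\<^sup>2) * s ^ 3) * (1 / csqrt (of_real (s\<^sup>2) + 2 * w)))
        \<le> exp (- s\<^sup>2) * \<bar>s\<bar> ^ 3 / sqrt c"
      by (simp add: norm_mult norm_divide power_abs abs_mult norm_power)
  qed
qed

text \<open>The integrand of this combination is an exact derivative.\<close>

lemma gauss_transform_ode:
  assumes w: "w \<in> wedge"
  shows "w * mac2 w + (2 * w + 1) * mac1 w - mac0 w = 0"
proof -
  let ?e = "\<lambda>s. complex_of_real (exp (- s\<^sup>2) * s\<^sup>2)" and ?S = "\<lambda>s. complex_of_real (s\<^sup>2) + 2 * w"
  let ?f = "\<lambda>s. (-2) * (?e s * csqrt (?S s)) + 2 * (2 * w + 1) * (?e s * (1 / csqrt (?S s)))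
      + 2 * w * (?e s * (1 / (?S s * csqrt (?S s))))"
  note int = gauss_transform_integrable[OF sqrt_growth_csqrt w]
    gauss_transform_integrable[OF sqrt_growth_inverse_csqrt w]
    gauss_transform_integrable[OF sqrt_growth_inverse_csqrt3 w]
  have i: "integrable lborel ?f"
    by (intro Bochner_Integration.integrable_add integrable_mult_right int)
  have "(LBINT s=-\<infinity>..\<infinity>. ?f s) = 0 - 0"
  proof (rule interval_integral_FTC_integrable[OF _ has_vector_derivative_macdonald_primitive[OF w]])
    show "isCont ?f s" for s
      using wedge_not_nonpos[OF wedge_shift[OF w, of s]] wedge_nonzero[OF wedge_shift[OF w, of s]]
      by (intro continuous_intros isCont_o2[OF _ continuous_at_csqrt]) auto
    show "set_integrable lborel (einterval (-\<infinity>) \<infinity>) ?f"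
      using i by (simp add: set_integrable_def)
  qed (use macdonald_primitive_tendsto_0[OF w] in \<open>auto simp: ereal_tendsto_simps\<close>)
  then have "(\<integral>s. ?f s \<partial>lborel) = 0"
    by (simp add: interval_lebesgue_integral_def set_lebesgue_integral_def)
  also have "(\<integral>s. ?f s \<partial>lborel) = (-2) * mac0 w + 2 * (2 * w + 1) * mac1 w + 2 * w * mac2 w"
    unfolding gauss_transform_def
    by (subst Bochner_Integration.integral_add, intro Bochner_Integration.integrable_add integrable_mult_right int,
        intro integrable_mult_right int, subst Bochner_Integration.integral_add, intro integrable_mult_right int,
        intro integrable_mult_right int) (simp only: integral_mult_right_zero)
  also have "\<dots> = 2 * (w * mac2 w + (2 * w + 1) * mac1 w - mac0 w)"
    by (simp only: ring_distribs) simp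
  finally have "2 * (w * mac2 w + (2 * w + 1) * mac1 w - mac0 w) = 0"
    by simp
  then show ?thesis
    by (simp only: mult_eq_0_iff) simp
qed

section \<open>The function w K_1(w) and its differential equation\<close>

definition macK :: "complex \<Rightarrow> complex" where
  "macK w = exp (- w) * mac0 w"

text \<open>This is \<open>- w K_0(w)\<close>, the derivative of \<open>w K_1(w)\<close>.\<close>

definition macK' :: "complex \<Rightarrow> complex" where
  "macK' w = exp (- w) * (mac1 w - mac0 w)"

lemma macK_deriv:
  assumes "w \<in> wedge" shows "(macK has_field_derivative macK' w) (at w)"
  unfolding macK_def[abs_def] macK'_def using mac0_deriv[OF assms]
  by (auto intro!: derivative_eq_intros simp: algebra_simps)

text \<open>The modified Bessel equation for \<open>K_1\<close>, rewritten for
  \<open>y = w K_1(w)\<close>, reads \<open>y'' = y' / w + y\<close>. It is checked after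
  multiplication by \<open>w\<close>, where \<open>gauss_transform_ode\<close> eliminates
  \<open>mac2\<close>.\<close>

lemma macK'_deriv:
  assumes "w \<in> wedge" shows "(macK' has_field_derivative macK' w / w + macK w) (at w)"
proof -
  have "(macK' has_field_derivative exp (- w) * (mac0 w - 2 * mac1 w - mac2 w)) (at w)"
    unfolding macK'_def[abs_def] using mac0_deriv[OF assms] mac1_deriv[OF assms]
    by (auto intro!: derivative_eq_intros simp: algebra_simps)
  moreover have "w * (exp (- w) * (mac0 w - 2 * mac1 w - mac2 w)) = w * (macK' w / w + macK w)"
  proof -
    have "w * (macK' w / w + macK w) = macK' w + w * macK w"
      using wedge_nonzero[OF assms] by (simp add: distrib_left)
    moreover have "w * (mac0 w - 2 * mac1 w - mac2 w) = mac1 w - mac0 w + w * mac0 w"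
      using gauss_transform_ode[OF assms] by (simp add: algebra_simps)
    then have "w * (exp (- w) * (mac0 w - 2 * mac1 w - mac2 w)) = macK' w + w * macK w"
      unfolding macK_def macK'_def
      by (simp only: mult.left_commute[of w "exp (- w)"] distrib_left)
    ultimately show ?thesis by simp
  qed
  ultimately show ?thesis
    using wedge_nonzero[OF assms] by simp
qed

lemma macK_holomorphic: "macK holomorphic_on wedge"
  using macK_deriv open_wedge by (auto simp: holomorphic_on_open)

text \<open>
  As a function of the square of its argument, \<open>w K\<^sub>1(w)\<close> satisfies an equation without first order term.
\<close>

lemma macK_csqrt_deriv:
  assumes "\<sigma> \<notin> \<real>\<^sub>\<le>\<^sub>0" "c * csqrt \<sigma> \<in> wedge"
  shows "((\<lambda>\<sigma>. macK (c * csqrt \<sigma>)) has_field_derivative macK' (c * csqrt \<sigma>) * (c / (2 * csqrt \<sigma>))) (at \<sigma>)"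
  by (rule DERIV_chain2[where g = "\<lambda>\<sigma>. c * csqrt \<sigma>", OF macK_deriv[OF assms(2)]])
    (use assms(1) in \<open>auto intro!: derivative_eq_intros\<close>)

lemma macK_csqrt_deriv2:
  assumes "\<sigma> \<notin> \<real>\<^sub>\<le>\<^sub>0" "c * csqrt \<sigma> \<in> wedge"
  shows "((\<lambda>\<sigma>. macK' (c * csqrt \<sigma>) * (c / (2 * csqrt \<sigma>))) has_field_derivative
     c\<^sup>2 / (4 * \<sigma>) * macK (c * csqrt \<sigma>)) (at \<sigma>)"
proof -
  define r where "r = csqrt \<sigma>"
  have nz: "r \<noteq> 0" "c \<noteq> 0"
    using assms wedge_nonzero[OF assms(2)] by (auto simp: r_def)
  have \<sigma>: "\<sigma> = r\<^sup>2"
    by (simp add: r_def)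
  have d: "((\<lambda>\<sigma>. c * csqrt \<sigma>) has_field_derivative c / (2 * r)) (at \<sigma>)"
    using assms(1) by (auto intro!: derivative_eq_intros simp: r_def)
  have "((\<lambda>\<sigma>. c / (2 * csqrt \<sigma>)) has_field_derivative - c / (4 * r ^ 3)) (at \<sigma>)"
    using assms(1) nz by (auto intro!: derivative_eq_intros simp: r_def[symmetric] power3_eq_cube field_simps)
  from DERIV_mult[OF DERIV_chain2[where g = "\<lambda>\<sigma>. c * csqrt \<sigma>", OF macK'_deriv[OF assms(2)] d] this]
  have "((\<lambda>\<sigma>. macK' (c * csqrt \<sigma>) * (c / (2 * csqrt \<sigma>))) has_field_derivative
    (macK' (c * r) / (c * r) + macK (c * r)) * (c / (2 * r)) * (c / (2 * r)) + - c / (4 * r ^ 3) * macK' (c * r)) (at \<sigma>)"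
    by (simp add: r_def)
  also have "(macK' (c * r) / (c * r) + macK (c * r)) * (c / (2 * r)) * (c / (2 * r)) + - c / (4 * r ^ 3) * macK' (c * r)
      = c\<^sup>2 / (4 * r\<^sup>2) * macK (c * r)"
    using nz by (simp add: divide_simps) (simp add: algebra_simps power2_eq_square power3_eq_cube)
  finally show ?thesis
    by (simp add: \<sigma>[symmetric] r_def)
qed

text \<open>Bounding the square root by \<open>\<bar>s\<bar> + sqrt (2 |w|)\<close> leaves the third
  and second Gaussian moments \<open>A\<close> and \<open>B\<close>. The square root itself has no
  singularity to avoid, so one constant serves the whole wedge.\<close>

lemma macK_bound:
  obtains C where "C > 0" "\<And>w. w \<in> wedge \<Longrightarrow> norm (macK w) \<le> C * (exp (- Re w) * (1 + sqrt (norm w)))"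
proof -
  let ?M = "\<lambda>R. \<integral>s. (exp (- s\<^sup>2) * s\<^sup>2) * (1 * (\<bar>s\<bar> + R)) \<partial>(lborel :: real measure)"
  define A where "A = (\<integral>s. exp (- s\<^sup>2) * \<bar>s\<bar> ^ 3 \<partial>(lborel :: real measure))"
  define B where "B = (\<integral>s. exp (- s\<^sup>2) * \<bar>s\<bar> ^ 2 \<partial>(lborel :: real measure))"
  have AB: "A \<ge> 0" "B \<ge> 0"
    by (auto simp: A_def B_def intro!: integral_nonneg_AE)
  have M: "?M R = A + R * B" for R
  proof -
    have i2: "integrable lborel (\<lambda>s::real. exp (- s\<^sup>2) * s\<^sup>2)"
      using gaussian_abs_moment_integrable[of 2] by simp
    have "?M R = (\<integral>s. exp (- s\<^sup>2) * \<bar>s\<bar> ^ 3 + R * (exp (- s\<^sup>2) * \<bar>s\<bar> ^ 2) \<partial>lborel)"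
      by (intro Bochner_Integration.integral_cong) (auto simp: algebra_simps power3_eq_cube power2_eq_square abs_mult_self_eq)
    also have "\<dots> = A + R * B"
      unfolding A_def B_def using gaussian_abs_moment_integrable i2
      by (subst Bochner_Integration.integral_add) auto
    finally show ?thesis .
  qed
  show thesis
  proof
    \<comment> \<open>The 2 majorizes \<open>sqrt 2\<close>, and the summand 1 makes the constant
      strictly positive.\<close>
    show "A + 2 * B + 1 > 0" using AB by simp
    fix w assume w: "w \<in> wedge"
    have "norm (mac0 w) \<le> ?M (sqrt (2 * norm w))"
      unfolding gauss_transform_def
    proof (rule order_trans[OF integral_norm_bound integral_mono])
      show "norm (of_real (exp (- s\<^sup>2) * s\<^sup>2) * csqrt (of_real (s\<^sup>2) + 2 * w))
         \<le> (exp (- s\<^sup>2) * s\<^sup>2) * (1 * (\<bar>s\<bar> + sqrt (2 * norm w)))" for s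
        using wedge_shift_sqrt_norm[of s w] unfolding norm_mult norm_of_real norm_csqrt
        by (intro mult_mono) auto
    qed (use gauss_transform_integrable[OF sqrt_growth_csqrt w] gauss_transform_bound_integrable[of 1] in \<open>auto intro!: integrable_norm\<close>)
    also have "\<dots> \<le> (A + 2 * B + 1) * (1 + sqrt (norm w))"
    proof -
      have "sqrt 2 \<le> 2" by (simp add: real_le_lsqrt)
      then have "sqrt 2 * (sqrt (norm w) * B) \<le> 2 * (sqrt (norm w) * B)"
        using AB by (intro mult_right_mono) auto
      moreover have "0 \<le> A * sqrt (norm w)" "0 \<le> sqrt (norm w)"
        using AB by auto
      moreover have "(A + 2 * B + 1) * (1 + sqrt (norm w))
          = A + A * sqrt (norm w) + 2 * B + 2 * (sqrt (norm w) * B) + 1 + sqrt (norm w)"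
        by (simp add: algebra_simps)
      moreover have "?M (sqrt (2 * norm w)) = A + sqrt 2 * (sqrt (norm w) * B)"
        by (subst M) (simp add: real_sqrt_mult)
      ultimately show ?thesis
        using AB by linarith
    qed
    finally have "exp (- Re w) * norm (mac0 w) \<le> exp (- Re w) * ((A + 2 * B + 1) * (1 + sqrt (norm w)))"
      by (intro mult_left_mono) auto
    then show "norm (macK w) \<le> (A + 2 * B + 1) * (exp (- Re w) * (1 + sqrt (norm w)))"
      by (simp add: macK_def norm_mult mult.left_commute)
  qed
qed

lemma macK_tendsto_1: "(macK \<longlongrightarrow> 1) (at 0 within wedge)"
proof -
  have "(mac0 \<longlongrightarrow> 1) (at 0 within wedge)"
    unfolding tendsto_at_iff_sequentially comp_def
  proof (intro allI impI)
    fix X :: "nat \<Rightarrow> complex"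
    assume X: "\<forall>i. X i \<in> wedge - {0}" and lim: "X \<longlonglongrightarrow> 0"
    from convergent_imp_Bseq[OF convergentI[OF lim]] obtain R where R: "\<And>i. norm (X i) \<le> R"
      by (auto simp: Bseq_def)
    have "(\<lambda>i. mac0 (X i)) \<longlonglongrightarrow> (\<integral>s. complex_of_real (exp (- s\<^sup>2) * \<bar>s\<bar> ^ 3) \<partial>lborel)"
      unfolding gauss_transform_def
    proof (rule integral_dominated_convergence[where w = "\<lambda>s. (exp (- s\<^sup>2) * s\<^sup>2) * (1 * (\<bar>s\<bar> + sqrt (2 * R)))"])
      show "AE s in lborel. (\<lambda>i. complex_of_real (exp (- s\<^sup>2) * s\<^sup>2) * csqrt (of_real (s\<^sup>2) + 2 * X i))
         \<longlonglongrightarrow> complex_of_real (exp (- s\<^sup>2) * \<bar>s\<bar> ^ 3)"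
      proof (rule AE_I2)
        fix s :: real
        have l: "(\<lambda>i. complex_of_real (s\<^sup>2) + 2 * X i) \<longlonglongrightarrow> of_real (s\<^sup>2)"
          using lim by (auto intro!: tendsto_eq_intros)
        show "(\<lambda>i. complex_of_real (exp (- s\<^sup>2) * s\<^sup>2) * csqrt (of_real (s\<^sup>2) + 2 * X i))
         \<longlonglongrightarrow> complex_of_real (exp (- s\<^sup>2) * \<bar>s\<bar> ^ 3)"
        \<comment> \<open>At \<open>s = 0\<close> the arguments tend to the branch point 0, which
          lies on the cut, but there the weight \<open>s^2\<close> makes every term vanish.\<close>
        proof (cases "s = 0")
          case False
          then have "isCont csqrt (of_real (s\<^sup>2))"
            by (intro continuous_at_csqrt) (auto simp: complex_nonpos_Reals_iff)
          from isCont_tendsto_compose[OF this l]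
          have "(\<lambda>i. csqrt (of_real (s\<^sup>2) + 2 * X i)) \<longlonglongrightarrow> of_real \<bar>s\<bar>"
            by (simp add: csqrt_of_real_nonneg del: of_real_power)
          then have "(\<lambda>i. complex_of_real (exp (- s\<^sup>2) * s\<^sup>2) * csqrt (of_real (s\<^sup>2) + 2 * X i))
           \<longlonglongrightarrow> complex_of_real (exp (- s\<^sup>2) * s\<^sup>2) * of_real \<bar>s\<bar>"
            by (rule tendsto_mult_left)
          then show ?thesis
            by (simp add: power3_eq_cube power2_eq_square mult.assoc abs_mult_self_eq flip: of_real_mult)
        qed simp
      qed
      show "AE s in lborel. norm (complex_of_real (exp (- s\<^sup>2) * s\<^sup>2) * csqrt (of_real (s\<^sup>2) + 2 * X i))
          \<le> (exp (- s\<^sup>2) * s\<^sup>2) * (1 * (\<bar>s\<bar> + sqrt (2 * R)))" for i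
      proof (rule AE_I2)
        fix s :: real
        have "sqrt (norm (of_real (s\<^sup>2) + 2 * X i)) \<le> \<bar>s\<bar> + sqrt (2 * R)"
          using wedge_shift_sqrt_norm[of s "X i"] R[of i] real_sqrt_le_mono[of "2 * norm (X i)" "2 * R"] by linarith
        then show "norm (complex_of_real (exp (- s\<^sup>2) * s\<^sup>2) * csqrt (of_real (s\<^sup>2) + 2 * X i))
          \<le> (exp (- s\<^sup>2) * s\<^sup>2) * (1 * (\<bar>s\<bar> + sqrt (2 * R)))"
          unfolding norm_mult norm_of_real norm_csqrt by (intro mult_mono) auto
      qed
      show "(\<lambda>s. complex_of_real (exp (- s\<^sup>2) * s\<^sup>2) * csqrt (of_real (s\<^sup>2) + 2 * X i)) \<in> borel_measurable lborel" for i
        using X by (intro gauss_transform_measurable sqrt_growth_csqrt) auto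
    qed (use gauss_transform_bound_integrable[of 1] in auto)
    then show "(\<lambda>i. mac0 (X i)) \<longlonglongrightarrow> 1"
      by (simp only: integral_complex_of_real gaussian_abs_moment_3 of_real_1)
  qed
  then have "((\<lambda>w. exp (- w) * mac0 w) \<longlongrightarrow> exp (- 0) * 1) (at 0 within wedge)"
    by (intro tendsto_intros)
  then show ?thesis
    by (simp add: macK_def[abs_def])
qed

section \<open>The power series\<close>

definition ser :: "(nat \<Rightarrow> real) \<Rightarrow> real \<Rightarrow> real" where
  "ser c x = (\<Sum>n. c n * x ^ n)"

definition entire :: "(nat \<Rightarrow> real) \<Rightarrow> bool" where
  "entire c \<longleftrightarrow> (\<forall>x. summable (\<lambda>n. c n * x ^ n))"

lemma entireI:
  assumes "\<And>n. \<bar>c n\<bar> \<le> K * a ^ n / fact n"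
  shows "entire c"
  unfolding entire_def
proof
  fix x :: real
  show "summable (\<lambda>n. c n * x ^ n)"
  proof (rule summable_comparison_test')
    show "summable (\<lambda>n. K * ((\<bar>a\<bar> * \<bar>x\<bar>) ^ n /\<^sub>R fact n))"
      by (intro summable_mult summable_exp_generic)
    fix n
    have "\<bar>c n\<bar> \<le> \<bar>K\<bar> * \<bar>a\<bar> ^ n / fact n"
      using order_trans[OF assms[of n] abs_ge_self] by (simp add: abs_mult power_abs)
    then have "\<bar>c n\<bar> * \<bar>x\<bar> ^ n \<le> \<bar>K\<bar> * \<bar>a\<bar> ^ n / fact n * \<bar>x\<bar> ^ n"
      by (intro mult_right_mono) auto
    moreover have "0 \<le> K * a ^ 0 / fact 0"
      using order_trans[OF abs_ge_zero assms[of 0]] .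
    ultimately show "norm (c n * x ^ n) \<le> K * ((\<bar>a\<bar> * \<bar>x\<bar>) ^ n /\<^sub>R fact n)"
      by (simp add: abs_mult power_abs power_mult_distrib divide_inverse mult_ac)
  qed
qed

lemma ser_sums: "entire c \<Longrightarrow> (\<lambda>n. c n * x ^ n) sums ser c x"
  by (simp add: entire_def ser_def summable_sums)

lemma entire_diffs: "entire c \<Longrightarrow> entire (diffs c)"
  unfolding entire_def by (intro allI termdiff_converges_all) auto

lemma ser_deriv: "entire c \<Longrightarrow> (ser c has_real_derivative ser (diffs c) x) (at x)"
  unfolding entire_def ser_def[abs_def] by (intro termdiffs_strong_converges_everywhere) auto

lemma entire_Suc: "entire c \<Longrightarrow> entire (\<lambda>n. c (Suc n))"
  unfolding entire_def using powser_split_head(3)[of c] by blast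

lemma ser_split: "entire c \<Longrightarrow> ser c x = c 0 + x * ser (\<lambda>n. c (Suc n)) x"
  unfolding entire_def ser_def by (subst powser_split_head) (auto simp: mult.commute)

lemma entire_lin:
  assumes "entire c" "entire d"
  shows "entire (\<lambda>n. a * c n + b * d n)" "ser (\<lambda>n. a * c n + b * d n) x = a * ser c x + b * ser d x"
proof -
  have *: "(\<lambda>n. (a * c n + b * d n) * y ^ n) sums (a * ser c y + b * ser d y)" for y
    using sums_add[OF sums_mult[OF ser_sums[OF assms(1)], of a y] sums_mult[OF ser_sums[OF assms(2)], of b y]]
    by (simp add: algebra_simps)
  then show "entire (\<lambda>n. a * c n + b * d n)"
    unfolding entire_def using sums_summable by blast
  show "ser (\<lambda>n. a * c n + b * d n) x = a * ser c x + b * ser d x"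
    using *[of x] unfolding ser_def by (rule sums_unique[symmetric])
qed

text \<open>
  In the variable \<open>q = w\<^sup>2 / 4\<close> the series of \<open>I\<^sub>0(w)\<close> has the coefficients \<open>ic\<close>, that of
  \<open>w I\<^sub>1(w) / 2\<close> the coefficients \<open>vc\<close>, and \<open>rc\<close> collects the non-logarithmic part of \<open>w K\<^sub>1(w)\<close>.
\<close>

definition ic :: "nat \<Rightarrow> real" where "ic n = 1 / (fact n)\<^sup>2"
definition vc :: "nat \<Rightarrow> real" where "vc n = real n / (fact n)\<^sup>2"
definition rc :: "nat \<Rightarrow> real" where "rc n = (1 - 2 * real n * harm n) / (fact n)\<^sup>2"

lemma harm_le_real: "harm n \<le> real n"
proof (induction n)
  case (Suc n)
  have "inverse (real (Suc n)) \<le> 1"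
    by (simp add: field_simps)
  with Suc show ?case
    by (simp add: harm_Suc)
qed (simp add: harm_def)

text \<open>One of the two factorials is given up; the other still beats \<open>4 ^ n\<close>, which
  leaves room for polynomial and harmonic factors in the coefficients.\<close>

lemma square_fact_bound:
  fixes b :: real
  assumes "\<bar>b\<bar> \<le> K * 4 ^ n"
  shows "\<bar>b / (fact n)\<^sup>2\<bar> \<le> K * 4 ^ n / fact n"
proof -
  have "\<bar>b / (fact n)\<^sup>2\<bar> = \<bar>b\<bar> / fact n / fact n"
    by (simp add: power2_eq_square abs_mult)
  also have "\<dots> \<le> \<bar>b\<bar> / fact n / 1"
    by (rule divide_left_mono) auto
  also have "\<dots> \<le> K * 4 ^ n / fact n"
    using assms by (simp add: divide_right_mono)
  finally show ?thesis .
qed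

lemma real_le_4_power: "real n \<le> 2 ^ n" "real n * real n \<le> 4 ^ n"
proof -
  show a: "real n \<le> 2 ^ n"
    by (metis less_imp_le of_nat_less_two_power)
  have "real n * real n \<le> 2 ^ n * 2 ^ n"
    using a by (intro mult_mono) auto
  then show "real n * real n \<le> 4 ^ n"
    by (simp flip: power_mult_distrib)
qed

lemma one_le_4_power: "(1::real) \<le> 4 ^ n"
  by simp

lemma entire_ic: "entire ic" and entire_vc: "entire vc" and entire_rc: "entire rc"
proof -
  show "entire ic"
    by (rule entireI[where K = 1 and a = 4]) (use square_fact_bound[of 1 1] in \<open>auto simp: ic_def\<close>)
  show "entire vc"
  proof (rule entireI[where K = 1 and a = 4])
    fix n
    have "real n \<le> 1 * 4 ^ n"
      by (rule order_trans[OF real_le_4_power(1)]) (simp add: power_mono)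
    then show "\<bar>vc n\<bar> \<le> 1 * 4 ^ n / fact n"
      unfolding vc_def by (intro square_fact_bound) simp
  qed
  show "entire rc"
  proof (rule entireI[where K = 3 and a = 4])
    fix n
    have "0 \<le> real n * harm n" "real n * harm n \<le> real n * real n"
      using harm_le_real[of n] harm_nonneg[of n] by (auto intro!: mult_left_mono mult_nonneg_nonneg)
    then have "\<bar>1 - 2 * real n * harm n\<bar> \<le> 3 * 4 ^ n"
      using real_le_4_power(2)[of n] one_le_4_power[of n] by linarith
    then show "\<bar>rc n\<bar> \<le> 3 * 4 ^ n / fact n"
      unfolding rc_def by (rule square_fact_bound)
  qed
qed

section \<open>Differential equations of the series\<close>

lemma vc_Suc: "vc (Suc n) = ic n / real (Suc n)"
  by (simp add: vc_def ic_def power2_eq_square divide_simps)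

lemma vc_ic: "vc n = real n * ic n"
  by (simp add: vc_def ic_def)

text \<open>In the variable \<open>q\<close> this is the classical
  \<open>(w I_1(w))' = w I_0(w)\<close>: the factor \<open>w / 2\<close> cancels against
  \<open>dq / dw = w / 2\<close>.\<close>

lemma diffs_vc: "diffs vc = ic"
  by (rule ext) (simp add: diffs_def vc_Suc)

lemma diffs_ic: "diffs ic = (\<lambda>n. vc (Suc n))"
  by (rule ext) (simp add: diffs_def vc_def ic_def)

lemma ser_vc_deriv: "(ser vc has_real_derivative ser ic x) (at x)"
  using ser_deriv[OF entire_vc] by (simp add: diffs_vc)

lemma ser_vc_split: "ser vc x = x * ser (\<lambda>n. vc (Suc n)) x"
  using ser_split[OF entire_vc, of x] by (simp add: vc_def)

lemma ser_ic_deriv: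
  assumes "x \<noteq> 0" shows "(ser ic has_real_derivative ser vc x / x) (at x)"
  using ser_deriv[OF entire_ic, of x] assms by (simp add: diffs_ic ser_vc_split)

text \<open>This is what \<open>x y'' = y\<close> demands of
  \<open>y = (ln x + c) * ser vc x + ser rc x\<close> once the logarithmic terms have cancelled,
  which they do because \<open>ser vc\<close> solves the same equation. The terms with
  \<open>ser ic\<close> and \<open>ser vc x / x\<close> come from differentiating the
  logarithm.\<close>

lemma ser_rc_ode: "x * ser (diffs (diffs rc)) x + 2 * ser ic x - ser (\<lambda>n. vc (Suc n)) x = ser rc x"
proof -
  \<comment> \<open>\<open>d\<close> lists the coefficients of \<open>x * y''\<close> for
    \<open>y = ser rc x\<close>; \<open>d 0 = 0\<close>, and the shift by one recovers
    \<open>y''\<close>.\<close>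
  define d where "d = (\<lambda>n. real n * (real (Suc n) * rc (Suc n)))"
  have dS: "(\<lambda>n. d (Suc n)) = diffs (diffs rc)"
    by (rule ext) (simp add: d_def diffs_def)
  have id: "d = (\<lambda>n. 1 * (1 * rc n + (-2) * ic n) + 1 * vc (Suc n))"
  proof
    fix n
    have *: "rc (Suc n) * real (Suc n) = (1 - 2 * (real (Suc n) * harm n + 1)) * (ic n / real (Suc n))"
    proof -
      define N where "N = real (Suc n)"
      have N: "N \<noteq> 0" and f: "fact (Suc n) = N * fact n"
        by (simp_all add: N_def)
      have e: "1 - 2 * N * (harm n + inverse N) = 1 - 2 * (N * harm n + 1)"
        using N by (simp add: algebra_simps)
      then show ?thesis
        unfolding rc_def ic_def harm_Suc f N_def[symmetric] e using N
        by (simp add: power2_eq_square mult_ac)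
    qed
    have "d n = real n * ((1 - 2 * (real (Suc n) * harm n + 1)) * (ic n / real (Suc n)))"
      unfolding d_def *[symmetric] by simp
    also have "\<dots> = ((1 - 2 * real n * harm n) - 2 + 1 / real (Suc n)) * ic n"
      by (simp add: divide_simps) (simp add: algebra_simps)
    also have "\<dots> = rc n - 2 * ic n + vc (Suc n)"
      unfolding vc_Suc rc_def ic_def by (simp add: algebra_simps add_divide_distrib diff_divide_distrib)
    finally show "d n = 1 * (1 * rc n + (-2) * ic n) + 1 * vc (Suc n)"
      by simp
  qed
  have e: "entire d"
    unfolding id by (intro entire_lin entire_rc entire_ic entire_Suc[OF entire_vc])
  have "ser d x = x * ser (diffs (diffs rc)) x"
    using ser_split[OF e, of x] by (simp add: dS) (simp add: d_def)
  moreover have "ser d x = 1 * (1 * ser rc x + (-2) * ser ic x) + 1 * ser (\<lambda>n. vc (Suc n)) x"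
    unfolding id by (subst entire_lin; (intro entire_lin entire_rc entire_ic entire_Suc[OF entire_vc])?)
      (subst entire_lin; (intro entire_rc entire_ic)?; simp)
  ultimately show ?thesis by simp
qed

text \<open>The classical series of \<open>w K_1(w)\<close> at \<open>w = 2 sqrt q\<close>;
  \<open>ln q\<close> is \<open>2 ln (w / 2)\<close>.\<close>

definition macG :: "real \<Rightarrow> real" where
  "macG q = (ln q + 2 * euler_mascheroni) * ser vc q + ser rc q"

definition macG' :: "real \<Rightarrow> real" where
  "macG' q = ser (\<lambda>n. vc (Suc n)) q + (ln q + 2 * euler_mascheroni) * ser ic q + ser (diffs rc) q"

lemma macG_deriv: "q > 0 \<Longrightarrow> (macG has_real_derivative macG' q) (at q)"
proof -
  assume q: "q > 0"
  have "(macG has_real_derivative ser vc q / q + (ln q + 2 * euler_mascheroni) * ser ic q + ser (diffs rc) q) (at q)"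
    unfolding macG_def[abs_def] using q
    by (auto intro!: derivative_eq_intros ser_vc_deriv ser_deriv entire_rc)
  moreover have "ser vc q / q = ser (\<lambda>n. vc (Suc n)) q"
    using q by (simp add: ser_vc_split)
  ultimately show ?thesis
    by (simp add: macG'_def)
qed

lemma macG'_deriv:
  assumes q: "q > 0" shows "(macG' has_real_derivative macG q / q) (at q)"
proof -
  have 1: "((\<lambda>q. ser vc q / q) has_real_derivative (ser ic q * q - ser vc q) / q\<^sup>2) (at q)"
    using q by (auto intro!: derivative_eq_intros ser_vc_deriv simp: power2_eq_square)
  have 2: "((\<lambda>q. (ln q + 2 * euler_mascheroni) * ser ic q) has_real_derivative
      ser ic q / q + (ln q + 2 * euler_mascheroni) * (ser vc q / q)) (at q)"
    using q by (auto intro!: derivative_eq_intros ser_ic_deriv)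
  have "((\<lambda>q. ser vc q / q + (ln q + 2 * euler_mascheroni) * ser ic q + ser (diffs rc) q) has_real_derivative
      (ser ic q * q - ser vc q) / q\<^sup>2 + (ser ic q / q + (ln q + 2 * euler_mascheroni) * (ser vc q / q))
      + ser (diffs (diffs rc)) q) (at q)"
    by (intro DERIV_add 1 2 ser_deriv entire_diffs entire_rc)
  also have "(ser ic q * q - ser vc q) / q\<^sup>2 + (ser ic q / q + (ln q + 2 * euler_mascheroni) * (ser vc q / q))
      + ser (diffs (diffs rc)) q = macG q / q"
    unfolding macG_def ser_rc_ode[symmetric] using q
    by (simp add: ser_vc_split divide_simps) (simp add: algebra_simps power2_eq_square)
  finally show ?thesis
    by (rule has_field_derivative_transform_within_open[where S = "{0<..}"])
      (use q in \<open>auto simp: macG'_def ser_vc_split\<close>)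
qed

section \<open>Growth of the series along the positive axis\<close>

lemma ser_vc_ge: "q > 0 \<Longrightarrow> ser vc q \<ge> q"
proof -
  assume q: "q > 0"
  have "(\<Sum>n<2. vc n * q ^ n) \<le> (\<Sum>n. vc n * q ^ n)"
    using entire_vc q by (intro sum_le_suminf) (auto simp: entire_def vc_def)
  then show ?thesis
    by (simp add: ser_def vc_def numeral_2_eq_2)
qed

text \<open>Multiplication by \<open>n + 1\<close> cancels the division in
  \<open>vc (Suc n) = ic n / (n + 1)\<close>, so the first and second moments of the weights
  \<open>vc n * x ^ n\<close> are expressed by the two basic series. They enter when
  \<open>(real n - X)^2\<close> is expanded.\<close>

lemma nat_mult_vc:
  shows "ser (\<lambda>n. real n * vc n) x = x * ser ic x" "entire (\<lambda>n. real n * vc n)"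
    and "ser (\<lambda>n. real n * (real n * vc n)) x = x * (ser vc x + ser ic x)" "entire (\<lambda>n. real n * (real n * vc n))"
proof -
  have e: "entire (\<lambda>n. a n * vc n)" if "\<And>n. \<bar>a n\<bar> \<le> real n * real n" for a
  \<comment> \<open>The 8 is \<open>4 * 2\<close>, from \<open>n^3 \<le> 4^n * 2^n\<close>.\<close>
  proof (rule entireI[where K = 1 and a = 8])
    fix n
    have "\<bar>a n * vc n\<bar> \<le> (real n * real n) * real n / fact n"
    proof -
      have "\<bar>a n\<bar> * \<bar>vc n\<bar> \<le> (real n * real n) * (real n / fact n)"
      proof (rule mult_mono)
        have "real n / fact n / fact n \<le> real n / fact n / 1"
          by (rule divide_left_mono) auto
        then show "\<bar>vc n\<bar> \<le> real n / fact n"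
          by (simp add: vc_def power2_eq_square)
      qed (use that in auto)
      then show ?thesis by (simp add: abs_mult)
    qed
    also have "(real n * real n) * real n \<le> 4 ^ n * 2 ^ n"
      by (intro mult_mono real_le_4_power) auto
    then have "(real n * real n) * real n / fact n \<le> 1 * 8 ^ n / fact n"
      by (intro divide_right_mono) (simp_all flip: power_mult_distrib)
    finally show "\<bar>a n * vc n\<bar> \<le> 1 * 8 ^ n / fact n" .
  qed
  have sq: "real n \<le> real n * real n" for n
    by (cases n) auto
  show e1: "entire (\<lambda>n. real n * vc n)"
    using sq by (intro e) auto
  show e2: "entire (\<lambda>n. real n * (real n * vc n))"
    using e[of "\<lambda>n. real n * real n"] by (simp add: mult.assoc)
  have s: "real (Suc n) * vc (Suc n) = ic n" for n
    by (simp add: vc_Suc)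
  show "ser (\<lambda>n. real n * vc n) x = x * ser ic x"
    using ser_split[OF e1, of x] by (simp add: s del: of_nat_Suc)
  have "(\<lambda>n. real (Suc n) * ic n) = (\<lambda>n. 1 * vc n + 1 * ic n)"
    by (auto simp: vc_def ic_def algebra_simps add_divide_distrib)
  then have "ser (\<lambda>n. real (Suc n) * ic n) x = ser vc x + ser ic x"
    using entire_lin(2)[OF entire_vc entire_ic, of 1 1 x] by simp
  then show "ser (\<lambda>n. real n * (real n * vc n)) x = x * (ser vc x + ser ic x)"
    using ser_split[OF e2, of x] by (simp add: s del: of_nat_Suc)
qed

text \<open>The inequality says that \<open>\<Sum>n. vc n * (real n - X)\<^sup>2 * X ^ (2 * n)\<close> is nonnegative.\<close>

lemma ser_ic_le:
  assumes X: "X > 0"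
  shows "(2 * X - 1) * ser ic (X\<^sup>2) \<le> 2 * ser vc (X\<^sup>2)"
proof -
  let ?q = "X\<^sup>2"
  note n2 = nat_mult_vc(1,2) and n3 = nat_mult_vc(3,4)
  have "(\<lambda>n. real n * (real n * vc n) * ?q ^ n + ((-2 * X) * (real n * vc n * ?q ^ n) + X\<^sup>2 * (vc n * ?q ^ n)))
     sums (?q * (ser vc ?q + ser ic ?q) + ((-2 * X) * (?q * ser ic ?q) + X\<^sup>2 * ser vc ?q))"
    using ser_sums[OF n3(2), of ?q] ser_sums[OF n2(2), of ?q] ser_sums[OF entire_vc, of ?q]
    unfolding n2(1) n3(1) by (intro sums_add sums_mult)
  moreover have "0 \<le> real n * (real n * vc n) * ?q ^ n + ((-2 * X) * (real n * vc n * ?q ^ n) + X\<^sup>2 * (vc n * ?q ^ n))" for n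
  proof -
    have "real n * (real n * vc n) * ?q ^ n + ((-2 * X) * (real n * vc n * ?q ^ n) + X\<^sup>2 * (vc n * ?q ^ n))
        = (real n - X)\<^sup>2 * (vc n * ?q ^ n)"
      by (simp add: power2_eq_square algebra_simps)
    then show ?thesis by (simp add: vc_def)
  qed
  ultimately have "0 \<le> ?q * (ser vc ?q + ser ic ?q) + ((-2 * X) * (?q * ser ic ?q) + X\<^sup>2 * ser vc ?q)"
    by (rule sums_le[OF _ sums_zero, rotated])
  also have "\<dots> = X\<^sup>2 * (2 * ser vc ?q - (2 * X - 1) * ser ic ?q)"
    by (simp add: algebra_simps)
  finally show ?thesis
    using X by (simp add: zero_le_mult_iff)
qed

text \<open>\<open>euler_mascheroni_bounds\<close> compares \<open>harm n\<close> with
  \<open>ln (n + 1)\<close>. Passing to \<open>ln n\<close> changes this by an amount between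
  \<open>1 / (n + 1)\<close> and \<open>1 / n\<close>; the former outweighs the correction
  \<open>1 / (2 n)\<close>, the latter is the loss in the upper bound.\<close>

lemma harm_ln_euler_bounds:
  assumes "n > 0"
  shows "ln (real n) + euler_mascheroni \<le> harm n" "harm n \<le> ln (real n) + euler_mascheroni + 1 / real n"
proof -
  have eb: "euler_mascheroni \<le> harm n - ln (real (Suc n)) + inverse (real (2 * n))"
      "harm n - ln (real (Suc n)) + inverse (real (2 * (n + 1))) \<le> euler_mascheroni"
    using euler_mascheroni_bounds[of n] assms by auto
  have n: "real n > 0" using assms by simp
  have l: "ln (real (Suc n)) - ln (real n) = ln (real (Suc n) / real n)"
    using n by (simp add: ln_div)
  have "ln (real (Suc n) / real n) \<le> real (Suc n) / real n - 1"
    using n by (intro ln_le_minus_one) auto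
  then have u: "ln (real (Suc n)) - ln (real n) \<le> 1 / real n"
    using n unfolding l by (simp add: field_simps)
  have "ln (real n / real (Suc n)) \<le> real n / real (Suc n) - 1"
    using n by (intro ln_le_minus_one) auto
  then have "ln (real n) - ln (real (Suc n)) \<le> - (1 / real (Suc n))"
    using n by (simp add: ln_div field_simps)
  moreover have "inverse (real (2 * n)) \<le> 1 / real (Suc n)"
    using assms by (simp add: field_simps)
  ultimately show "ln (real n) + euler_mascheroni \<le> harm n"
    using eb(1) by linarith
  have "0 \<le> inverse (real (2 * (n + 1)))" by simp
  then show "harm n \<le> ln (real n) + euler_mascheroni + 1 / real n"
    using eb(2) u by linarith
qed

text \<open>
  The logarithms cancel termwise: \<open>ln X - ln n\<close> lies between \<open>1 - n / X\<close> and \<open>X / n - 1\<close>, and the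
  moments \<open>\<Sum>n. n * ic n * X ^ (2 * n)\<close> and \<open>\<Sum>n. n\<^sup>2 * ic n * X ^ (2 * n)\<close> are controlled by \<open>ser_ic_le\<close>.
\<close>

lemma macG_abs_le:
  assumes X: "X > 0"
  shows "\<bar>macG (X\<^sup>2)\<bar> \<le> 2 * ser ic (X\<^sup>2)"
proof -
  let ?q = "X\<^sup>2"
  let ?L = "ln ?q + 2 * euler_mascheroni"
  have lnq: "ln ?q = 2 * ln X"
    using X by (simp add: ln_realpow)
  have G: "(\<lambda>n. ?L * (vc n * ?q ^ n) + rc n * ?q ^ n) sums macG ?q"
    unfolding macG_def using entire_vc entire_rc by (intro sums_add sums_mult ser_sums)
  have t: "?L * (vc n * ?q ^ n) + rc n * ?q ^ n = (1 + 2 * (real n * (ln X + euler_mascheroni - harm n))) * (ic n * ?q ^ n)" for n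
    unfolding lnq vc_def rc_def ic_def by (simp add: algebra_simps add_divide_distrib diff_divide_distrib)
  have up: "?L * (vc n * ?q ^ n) + rc n * ?q ^ n
      \<le> (1 + 2 * X) * (ic n * ?q ^ n) + (-2) * (vc n * ?q ^ n)" for n
  proof -
    have "real n * (ln X + euler_mascheroni - harm n) \<le> X - real n"
    proof (cases "n = 0")
      case False
      then have n: "real n > 0" by simp
      have "ln (X / real n) \<le> X / real n - 1"
        using n X by (intro ln_le_minus_one) auto
      then have "ln X + euler_mascheroni - harm n \<le> X / real n - 1"
        using harm_ln_euler_bounds(1)[of n] n X by (simp add: ln_div)
      then have "real n * (ln X + euler_mascheroni - harm n) \<le> real n * (X / real n - 1)"
        by (rule mult_left_mono) simp
      then show ?thesis using n by (simp add: algebra_simps)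
    qed (use X in simp)
    then have "(1 + 2 * (real n * (ln X + euler_mascheroni - harm n))) * (ic n * ?q ^ n) \<le> (1 + 2 * (X - real n)) * (ic n * ?q ^ n)"
      by (intro mult_right_mono) (auto simp: ic_def)
    also have "\<dots> = (1 + 2 * X) * (ic n * ?q ^ n) + (-2) * (vc n * ?q ^ n)"
      unfolding vc_ic by (simp add: algebra_simps)
    finally show ?thesis unfolding t .
  qed
  have lo: "(-1) * (ic n * ?q ^ n) + (2 * (vc n * ?q ^ n) + (-2 / X) * (real n * vc n * ?q ^ n))
     \<le> ?L * (vc n * ?q ^ n) + rc n * ?q ^ n" for n
  proof -
    have "-1 + real n - real n * real n / X \<le> real n * (ln X + euler_mascheroni - harm n)"
    proof (cases "n = 0")
      case False
      then have n: "real n > 0" by simp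
      have "ln (real n / X) \<le> real n / X - 1"
        using n X by (intro ln_le_minus_one) auto
      then have "1 - real n / X - 1 / real n \<le> ln X + euler_mascheroni - harm n"
        using harm_ln_euler_bounds(2)[of n] n X by (simp add: ln_div)
      then have "real n * (1 - real n / X - 1 / real n) \<le> real n * (ln X + euler_mascheroni - harm n)"
        by (rule mult_left_mono) simp
      then show ?thesis using n by (simp add: algebra_simps)
    qed simp
    then have "(1 + 2 * (-1 + real n - real n * real n / X)) * (ic n * ?q ^ n) \<le>
        (1 + 2 * (real n * (ln X + euler_mascheroni - harm n))) * (ic n * ?q ^ n)"
      by (intro mult_right_mono) (auto simp: ic_def)
    moreover have "(1 + 2 * (-1 + real n - real n * real n / X)) * (ic n * ?q ^ n)
       = (-1) * (ic n * ?q ^ n) + (2 * (vc n * ?q ^ n) + (-2 / X) * (real n * vc n * ?q ^ n))"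
      unfolding vc_ic by (simp add: algebra_simps)
    ultimately show ?thesis unfolding t by linarith
  qed
  have "macG ?q \<le> (1 + 2 * X) * ser ic ?q + (-2) * ser vc ?q"
    by (rule sums_le[OF up G], intro sums_add sums_mult ser_sums entire_ic entire_vc)
  \<comment> \<open>Here \<open>ser_ic_le\<close> cancels the large factor of \<open>ser ic\<close>:
    \<open>(1 + 2 X) - (2 X - 1) = 2\<close>. The lower bound below uses it in the same way.\<close>
  then have "macG ?q \<le> 2 * ser ic ?q"
    using ser_ic_le[OF X] by (simp add: algebra_simps)
  moreover have "(-1) * ser ic ?q + (2 * ser vc ?q + (-2 / X) * (?q * ser ic ?q)) \<le> macG ?q"
    by (rule sums_le[OF lo _ G], unfold nat_mult_vc(1)[symmetric], intro sums_add sums_mult ser_sums entire_ic entire_vc nat_mult_vc)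
  moreover have "(-2 / X) * (?q * ser ic ?q) = - (2 * X * ser ic ?q)"
    using X by (simp add: power2_eq_square)
  ultimately show ?thesis
    using ser_ic_le[OF X] by (simp add: algebra_simps abs_le_iff)
qed

text \<open>\<open>ser vc\<close> starts with the linear term, so the logarithm occurs only as
  \<open>q ln q\<close>, which vanishes at 0; what is left is \<open>rc 0 = 1\<close>.\<close>

lemma macG_tendsto_1: "(macG \<longlongrightarrow> 1) (at_right 0)"
proof -
  have c: "(ser c \<longlongrightarrow> c 0) (at_right 0)" if "entire c" for c
  proof -
    have "isCont (ser c) 0"
      using ser_deriv[OF that] by (rule DERIV_isCont)
    moreover have "ser c 0 = c 0"
      using ser_split[OF that, of 0] by simp
    ultimately show ?thesis
      using isContD[of 0 "ser c"] by (auto intro: tendsto_within_subset)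
  qed
  have l: "((\<lambda>q::real. (ln q + 2 * euler_mascheroni) * q) \<longlongrightarrow> 0) (at_right 0)"
    by real_asymp
  have "((\<lambda>q. ((ln q + 2 * euler_mascheroni) * q) * ser (\<lambda>n. vc (Suc n)) q + ser rc q) \<longlongrightarrow> 0 * vc (Suc 0) + rc 0) (at_right 0)"
    by (intro tendsto_add tendsto_mult l c entire_Suc entire_vc entire_rc)
  then show ?thesis
    unfolding macG_def[abs_def] by (simp add: ser_vc_split[symmetric] mult.assoc rc_def)
qed

section \<open>The Hankel function as a Macdonald function\<close>

text \<open>At a positive interior maximum \<open>c\<close> one has \<open>h' c = 0\<close>, while
  \<open>h'' = h / q\<close> is positive there; so \<open>h'\<close> is positive just to the right
  of \<open>c\<close>, and \<open>h\<close> would increase beyond its maximum.\<close>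

lemma ode_maximum_principle:
  fixes h h' :: "real \<Rightarrow> real"
  assumes d: "\<And>q. q > 0 \<Longrightarrow> (h has_real_derivative h' q) (at q)"
    and d': "\<And>q. q > 0 \<Longrightarrow> (h' has_real_derivative h q / q) (at q)"
    and l: "(h \<longlongrightarrow> 0) (at_right 0)" and u: "\<forall>\<^sub>F q in at_top. h q \<le> 0"
    and q: "q > 0"
  shows "h q \<le> 0"
proof (rule ccontr)
  assume "\<not> h q \<le> 0"
  then have hq: "h q > 0" by simp
  have "\<forall>\<^sub>F x in at_right 0. h x < h q"
    using l hq by (rule order_tendstoD)
  then obtain b0 where b0: "b0 > 0" "\<And>x. 0 < x \<Longrightarrow> x < b0 \<Longrightarrow> h x < h q"
    unfolding eventually_at_right_field by blast
  \<comment> \<open>The end points \<open>a\<close> and \<open>b\<close> are chosen so that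
    \<open>h\<close> lies below \<open>h q\<close> at both; the maximum over \<open>{a..b}\<close>
    is then interior.\<close>
  define a where "a = min b0 q / 2"
  have a: "0 < a" "a < q" "h a < h q"
    using b0 q by (auto simp: a_def min_def)
  obtain N where N: "\<And>x. x \<ge> N \<Longrightarrow> h x \<le> 0"
    using u unfolding eventually_at_top_linorder by blast
  define b where "b = max N (q + 1)"
  have b: "q < b" "h b < h q"
    using N[of b] hq by (auto simp: b_def)
  have cont: "continuous_on {a..b} h"
    using a DERIV_isCont[OF d] by (intro continuous_at_imp_continuous_on ballI) auto
  obtain c where c: "c \<in> {a..b}" "\<And>x. x \<in> {a..b} \<Longrightarrow> h x \<le> h c"
  proof -
    have "{a..b} \<noteq> {}" using a b by simp
    from continuous_attains_sup[OF compact_Icc this cont] show ?thesis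
      using that by blast
  qed
  have hc: "h c \<ge> h q"
    using c(2)[of q] a b by auto
  have ca: "a < c" "c < b"
    using hc a b c(1) by (auto simp: less_le)
  have "h' c = 0"
  proof (rule DERIV_local_max)
    show "(h has_real_derivative h' c) (at c)"
      using d a ca by simp
    show "0 < min (c - a) (b - c)" using ca by simp
    show "\<forall>y. \<bar>c - y\<bar> < min (c - a) (b - c) \<longrightarrow> h y \<le> h c"
      using c(2) by (auto simp: abs_less_iff)
  qed
  moreover have "0 < h c / c"
    using hc hq ca a by simp
  then obtain e where e: "e > 0" "\<And>t. 0 < t \<Longrightarrow> t < e \<Longrightarrow> h' c < h' (c + t)"
    using DERIV_pos_inc_right[OF d', of c] ca a by auto
  ultimately have pos: "0 < h' (c + t)" if "0 < t" "t < e" for t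
    using e(2)[OF that] by simp
  define x where "x = c + min (e / 2) ((b - c) / 2)"
  have "x - c \<le> e / 2" "x - c \<le> (b - c) / 2" "0 < x - c"
    unfolding x_def using e(1) ca min.cobounded1[of "e / 2" "(b - c) / 2"]
      min.cobounded2[of "e / 2" "(b - c) / 2"] by auto
  with e(1) ca have x: "c < x" "x < b" "x < c + e"
    by simp_all
  obtain z where z: "c < z" "z < x" "h x - h c = (x - c) * h' z"
  proof -
    have "\<exists>z>c. z < x \<and> h x - h c = (x - c) * h' z"
      using ca a by (intro MVT2 x d) auto
    then show ?thesis using that by blast
  qed
  have "0 < (x - c) * h' z"
    using z x pos[of "z - c"] by (intro mult_pos_pos) auto
  moreover have "h x \<le> h c"
    using x ca by (intro c(2)) simp
  ultimately show False
    using z(3) by linarith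
qed

text \<open>
  The maximum principle is applied to \<open>\<plusminus> y - e * ser vc\<close> for every \<open>e > 0\<close>.
\<close>

lemma ode_zero:
  fixes y y' :: "real \<Rightarrow> real"
  assumes d: "\<And>q. q > 0 \<Longrightarrow> (y has_real_derivative y' q) (at q)"
    and d': "\<And>q. q > 0 \<Longrightarrow> (y' has_real_derivative y q / q) (at q)"
    and l: "(y \<longlongrightarrow> 0) (at_right 0)"
    and u: "\<And>e. e > 0 \<Longrightarrow> \<forall>\<^sub>F q in at_top. \<bar>y q\<bar> \<le> e * ser vc q"
    and q: "q > 0"
  shows "y q = 0"
proof -
  have V0: "(ser vc \<longlongrightarrow> 0) (at_right 0)"
  proof -
    have "isCont (ser vc) 0" using ser_vc_deriv by (rule DERIV_isCont)
    moreover have "ser vc 0 = 0" using ser_vc_split[of 0] by simp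
    ultimately show ?thesis
      using isContD[of 0 "ser vc"] by (auto intro: tendsto_within_subset)
  qed
  have main: "s * y q \<le> e * ser vc q" if s: "\<bar>s\<bar> = 1" and e: "e > 0" for s e
  proof -
    have "s * y q - e * ser vc q \<le> 0"
    proof (rule ode_maximum_principle[where h = "\<lambda>q. s * y q - e * ser vc q" and h' = "\<lambda>q. s * y' q - e * ser ic q"])
      fix x :: real assume x: "x > 0"
      show "((\<lambda>q. s * y q - e * ser vc q) has_real_derivative s * y' x - e * ser ic x) (at x)"
        by (intro DERIV_diff DERIV_cmult d x ser_vc_deriv)
      have "((\<lambda>q. s * y' q - e * ser ic q) has_real_derivative s * (y x / x) - e * (ser vc x / x)) (at x)"
        using x by (intro DERIV_diff DERIV_cmult d' ser_ic_deriv) auto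
      then show "((\<lambda>q. s * y' q - e * ser ic q) has_real_derivative (s * y x - e * ser vc x) / x) (at x)"
        by (simp add: diff_divide_distrib)
    next
      have "((\<lambda>q. s * y q - e * ser vc q) \<longlongrightarrow> s * 0 - e * 0) (at_right 0)"
        by (intro tendsto_diff tendsto_mult_left l V0)
      then show "((\<lambda>q. s * y q - e * ser vc q) \<longlongrightarrow> 0) (at_right 0)" by simp
      show "\<forall>\<^sub>F q in at_top. s * y q - e * ser vc q \<le> 0"
        using u[OF e]
      proof eventually_elim
        case (elim q)
        have "s * y q \<le> \<bar>s\<bar> * \<bar>y q\<bar>"
          using abs_ge_self[of "s * y q"] by (simp add: abs_mult)
        with elim s show ?case by simp
      qed
    qed (rule q)
    then show ?thesis by simp
  qed
  have V: "ser vc q > 0" using ser_vc_ge[OF q] q by simp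
  have "s * y q \<le> 0" if "\<bar>s\<bar> = 1" for s
  proof (rule field_le_epsilon)
    fix e :: real assume "e > 0"
    then show "s * y q \<le> 0 + e"
      using main[OF that, of "e / ser vc q"] V by simp
  qed
  from this[of 1] this[of "-1"] show ?thesis by simp
qed

lemma macK_real_bounded: "\<exists>C>0. \<forall>x>0. norm (macK (of_real x)) \<le> C"
proof -
  obtain C where C: "C > 0" "\<And>w. w \<in> wedge \<Longrightarrow> norm (macK w) \<le> C * (exp (- Re w) * (1 + sqrt (norm w)))"
    using macK_bound by blast
  show ?thesis
  proof (intro exI[of _ "2 * C"] conjI allI impI)
    fix x :: real assume x: "x > 0"
    have "sqrt x \<le> 1 + x"
      using x by (intro real_le_lsqrt) (auto simp: power2_eq_square algebra_simps)
    then have "1 + sqrt x \<le> 2 * exp x"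
      using exp_ge_add_one_self[of x] x by linarith
    then have "exp (- x) * (1 + sqrt x) \<le> exp (- x) * (2 * exp x)"
      by (rule mult_left_mono) simp
    then have "exp (- x) * (1 + sqrt x) \<le> 2"
      by (simp add: exp_minus field_simps)
    then have "C * (exp (- x) * (1 + sqrt x)) \<le> C * 2"
      using C(1) by (intro mult_left_mono) auto
    then show "norm (macK (of_real x)) \<le> 2 * C"
      using C(2)[of "of_real x"] x by (simp add: wedge_def)
  qed (use C in simp)
qed

text \<open>\<open>ode_zero\<close> concerns real functions, so the difference is tested with a
  functional \<open>L\<close>, later the real and the imaginary part. Both functions tend to 1 at 0;
  at infinity \<open>macK\<close> is bounded and \<open>macG\<close> is at most
  \<open>4 / (2 sqrt q - 1)\<close> times \<open>ser vc\<close>, so each is eventually at most half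
  of \<open>e * ser vc q\<close>.\<close>

lemma macK_eq_macG_aux:
  fixes L :: "complex \<Rightarrow> real"
  assumes L: "bounded_linear L" and Lb: "\<And>z. \<bar>L z\<bar> \<le> norm z" and q: "q > 0"
  shows "L (macK (2 * csqrt (of_real q)) - of_real (macG q)) = 0"
proof (rule ode_zero[where y = "\<lambda>q. L (macK (2 * csqrt (of_real q)) - of_real (macG q))"
      and y' = "\<lambda>q. L (macK' (2 * csqrt (of_real q)) * (2 / (2 * csqrt (of_real q))) - of_real (macG' q))"])
  have pos: "complex_of_real x \<notin> \<real>\<^sub>\<le>\<^sub>0" "2 * csqrt (of_real x) \<in> wedge" if "x > 0" for x
    using that by (auto simp: complex_nonpos_Reals_iff wedge_def csqrt_of_real_nonneg)
  fix x :: real assume x: "x > 0"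
  have G: "((\<lambda>x. complex_of_real (macG x)) has_vector_derivative of_real (macG' x)) (at x)"
    using macG_deriv[OF x] by (intro has_vector_derivative_of_real) (simp add: has_real_derivative_iff_has_vector_derivative)
  have G': "((\<lambda>x. complex_of_real (macG' x)) has_vector_derivative of_real (macG x / x)) (at x)"
    using macG'_deriv[OF x] by (intro has_vector_derivative_of_real) (simp add: has_real_derivative_iff_has_vector_derivative)
  note K = has_vector_derivative_real_field[OF macK_csqrt_deriv[OF pos[OF x]]]
  note K' = has_vector_derivative_real_field[OF macK_csqrt_deriv2[OF pos[OF x]]]
  show "((\<lambda>q. L (macK (2 * csqrt (of_real q)) - of_real (macG q))) has_real_derivative
      L (macK' (2 * csqrt (of_real x)) * (2 / (2 * csqrt (of_real x))) - of_real (macG' x))) (at x)"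
    unfolding has_real_derivative_iff_has_vector_derivative
    by (intro bounded_linear.has_vector_derivative[OF L] has_vector_derivative_diff K G)
  have "((\<lambda>q. L (macK' (2 * csqrt (of_real q)) * (2 / (2 * csqrt (of_real q))) - of_real (macG' q))) has_vector_derivative
      L (2\<^sup>2 / (4 * of_real x) * macK (2 * csqrt (of_real x)) - of_real (macG x / x))) (at x)"
    by (intro bounded_linear.has_vector_derivative[OF L] has_vector_derivative_diff K' G')
  also have "2\<^sup>2 / (4 * of_real x) * macK (2 * csqrt (of_real x)) - of_real (macG x / x)
      = (1 / x) *\<^sub>R (macK (2 * csqrt (of_real x)) - of_real (macG x))"
    by (simp add: scaleR_conv_of_real algebra_simps)
  finally show "((\<lambda>q. L (macK' (2 * csqrt (of_real q)) * (2 / (2 * csqrt (of_real q))) - of_real (macG' q))) has_real_derivative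
      L (macK (2 * csqrt (of_real x)) - of_real (macG x)) / x) (at x)"
    unfolding has_real_derivative_iff_has_vector_derivative
    by (simp add: linear_scale[OF bounded_linear.linear[OF L]])
next
  have "filterlim (\<lambda>q. 2 * csqrt (complex_of_real q)) (at 0 within wedge) (at_right 0)"
    unfolding filterlim_at
  proof
    have "((\<lambda>q. 2 * complex_of_real (sqrt q)) \<longlongrightarrow> 2 * of_real (sqrt 0)) (at_right 0)"
      by (intro tendsto_intros)
    then show "((\<lambda>q. 2 * csqrt (complex_of_real q)) \<longlongrightarrow> 0) (at_right 0)"
      by (rule tendsto_eq_rhs[OF Lim_transform_eventually])
        (auto simp: eventually_at_right_field csqrt_of_real_nonneg intro: exI[of _ 1])
    show "\<forall>\<^sub>F q in at_right 0. 2 * csqrt (complex_of_real q) \<in> wedge \<and> 2 * csqrt (complex_of_real q) \<noteq> 0"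
      unfolding eventually_at_right_field
      by (auto simp: wedge_def csqrt_of_real_nonneg intro: exI[of _ 1])
  qed
  from filterlim_compose[OF macK_tendsto_1 this]
  have "((\<lambda>q. macK (2 * csqrt (complex_of_real q)) - of_real (macG q)) \<longlongrightarrow> 1 - of_real 1) (at_right 0)"
    by (intro tendsto_diff tendsto_of_real macG_tendsto_1)
  from bounded_linear.tendsto[OF L this]
  show "((\<lambda>q. L (macK (2 * csqrt (of_real q)) - of_real (macG q))) \<longlongrightarrow> 0) (at_right 0)"
    by (simp add: linear_0[OF bounded_linear.linear[OF L]])
next
  fix e :: real assume e: "e > 0"
  obtain C where C: "C > 0" "\<And>x. x > 0 \<Longrightarrow> norm (macK (of_real x)) \<le> C"
    using macK_real_bounded by blast
  have "\<forall>\<^sub>F q in at_top. 4 / (2 * sqrt q - 1) < e / 2"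
  proof (rule order_tendstoD)
    show "((\<lambda>q::real. 4 / (2 * sqrt q - 1)) \<longlongrightarrow> 0) at_top" by real_asymp
  qed (use e in simp)
  then show "\<forall>\<^sub>F q in at_top. \<bar>L (macK (2 * csqrt (of_real q)) - of_real (macG q))\<bar> \<le> e * ser vc q"
    using eventually_ge_at_top[of "2 * C / e"] eventually_gt_at_top[of 1]
  proof eventually_elim
    case (elim q)
    define X where "X = sqrt q"
    have X: "X > 1" "q = X\<^sup>2" using elim by (auto simp: X_def)
    have V: "ser vc q \<ge> q" using ser_vc_ge[of q] elim by simp
    have "2 * csqrt (of_real q) = complex_of_real (2 * X)"
      using elim by (simp add: X_def csqrt_of_real_nonneg)
    then have "norm (macK (2 * csqrt (of_real q))) \<le> C"
      using C(2)[of "2 * X"] X by simp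
    also have "C \<le> e / 2 * q"
      using elim e by (simp add: field_simps)
    also have "\<dots> \<le> e / 2 * ser vc q"
      using V e by (intro mult_left_mono) auto
    finally have 1: "norm (macK (2 * csqrt (of_real q))) \<le> e / 2 * ser vc q" .
    have "\<bar>macG q\<bar> \<le> 2 * ser ic q"
      using macG_abs_le[of X] X by simp
    moreover have "ser ic q \<le> 2 * ser vc q / (2 * X - 1)"
      using ser_ic_le[of X] X by (simp add: field_simps)
    ultimately have "\<bar>macG q\<bar> \<le> 2 * (2 * ser vc q / (2 * X - 1))"
      by linarith
    also have "\<dots> = 4 / (2 * X - 1) * ser vc q"
      by simp
    finally have "\<bar>macG q\<bar> \<le> 4 / (2 * X - 1) * ser vc q" .
    also have "\<dots> \<le> e / 2 * ser vc q"
    proof (rule mult_right_mono)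
      show "4 / (2 * X - 1) \<le> e / 2"
        using elim unfolding X_def by linarith
      show "0 \<le> ser vc q"
        using V elim by linarith
    qed
    finally have 2: "norm (complex_of_real (macG q)) \<le> e / 2 * ser vc q" by simp
    have "\<bar>L (macK (2 * csqrt (of_real q)) - of_real (macG q))\<bar> \<le> norm (macK (2 * csqrt (of_real q)) - of_real (macG q))"
      by (rule Lb)
    also have "\<dots> \<le> norm (macK (2 * csqrt (of_real q))) + norm (complex_of_real (macG q))"
      by (rule norm_triangle_ineq4)
    also have "\<dots> \<le> e * ser vc q"
      using 1 2 by simp
    finally show ?case .
  qed
qed (rule q)

lemma macK_eq_macG:
  assumes "x > 0" shows "macK (of_real x) = of_real (macG (x\<^sup>2 / 4))"
proof -
  let ?d = "macK (2 * csqrt (of_real (x\<^sup>2 / 4))) - of_real (macG (x\<^sup>2 / 4))"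
  have "Re ?d = 0" "Im ?d = 0"
    using assms by (intro macK_eq_macG_aux bounded_linear_Re bounded_linear_Im abs_Re_le_cmod abs_Im_le_cmod; simp)+
  then have "?d = 0"
    using complex_eqI[of ?d 0] by (simp only: zero_complex.sel)
  moreover have "2 * csqrt (of_real (x\<^sup>2 / 4)) = of_real x"
    using assms by (subst csqrt_of_real_nonneg) (auto simp: real_sqrt_divide)
  ultimately show ?thesis by simp
qed

section \<open>Complex power series and continuation to the wedge\<close>

definition cser :: "(nat \<Rightarrow> real) \<Rightarrow> complex \<Rightarrow> complex" where
  "cser c z = (\<Sum>n. of_real (c n) * z ^ n)"

lemma summable_cser: "entire c \<Longrightarrow> summable (\<lambda>n. complex_of_real (c n) * z ^ n)"
proof -
  assume "entire c"
  then have "summable (\<lambda>n. c n * (norm z + 1) ^ n)"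
    by (simp add: entire_def)
  then have "summable (\<lambda>n. norm (c n * (norm z) ^ n))"
    by (rule powser_insidea) simp
  then have "summable (\<lambda>n. norm (complex_of_real (c n) * z ^ n))"
    by (simp add: norm_mult norm_power abs_mult)
  then show ?thesis by (rule summable_norm_cancel)
qed

lemma cser_of_real: "entire c \<Longrightarrow> cser c (of_real x) = of_real (ser c x)"
  unfolding cser_def ser_def entire_def by (subst suminf_of_real) auto

lemma cser_holomorphic: "entire c \<Longrightarrow> cser c holomorphic_on A"
proof -
  assume c: "entire c"
  have "(cser c has_field_derivative (\<Sum>n. diffs (\<lambda>n. of_real (c n)) n * z ^ n)) (at z)" for z
    unfolding cser_def[abs_def] by (rule termdiffs_strong_converges_everywhere) (rule summable_cser[OF c])
  then show ?thesis
    unfolding holomorphic_on_def field_differentiable_def by (blast intro: has_field_derivative_at_within)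
qed

lemma cser_split: "entire c \<Longrightarrow> cser c z = of_real (c 0) + z * cser (\<lambda>n. c (Suc n)) z"
  unfolding cser_def by (subst powser_split_head(1)[OF summable_cser]) (auto simp: mult.commute)

lemma macK_eq_series:
  assumes "w \<in> wedge"
  shows "macK w = (2 * Ln (w / 2) + 2 * euler_mascheroni) * cser vc (w\<^sup>2 / 4) + cser rc (w\<^sup>2 / 4)"
proof -
  let ?f = "\<lambda>w. macK w - ((2 * Ln (w / 2) + 2 * euler_mascheroni) * cser vc (w\<^sup>2 / 4) + cser rc (w\<^sup>2 / 4))"
  let ?U = "complex_of_real ` {0<..}"
  have half: "z / 2 \<notin> \<real>\<^sub>\<le>\<^sub>0" if "z \<in> wedge" for z
    using that by (intro wedge_not_nonpos) (auto simp: wedge_def)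
  have c: "(\<lambda>z. cser c (z\<^sup>2 / 4)) holomorphic_on wedge" if "entire c" for c
  proof -
    have "(\<lambda>z::complex. z\<^sup>2 / 4) holomorphic_on wedge"
      by (intro holomorphic_intros) auto
    from holomorphic_on_compose[OF this cser_holomorphic[OF that]] show ?thesis
      by (simp add: comp_def)
  qed
  have "?f w = 0"
  proof (rule analytic_continuation[of ?f wedge ?U 1])
    show "?f holomorphic_on wedge"
      by (intro holomorphic_intros macK_holomorphic c entire_vc entire_rc) (use half in auto)
    show "connected wedge" by (rule convex_connected[OF convex_wedge])
    show "?U \<subseteq> wedge" by (auto simp: wedge_def)
    show "1 \<in> wedge" by (simp add: wedge_def)
    show "1 islimpt ?U"
      unfolding islimpt_approachable
    proof (intro allI impI)
      fix e :: real assume e: "e > 0"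
      then have "complex_of_real (1 + e / 2) \<in> ?U"
        by (intro imageI) simp
      moreover have "complex_of_real (1 + e / 2) \<noteq> 1"
        using e unfolding of_real_eq_1_iff by simp
      moreover have "dist (complex_of_real (1 + e / 2)) 1 < e"
        using e by (simp add: dist_norm)
      ultimately show "\<exists>x'\<in>?U. x' \<noteq> 1 \<and> dist x' 1 < e" by blast
    qed
    show "?f z = 0" if "z \<in> ?U" for z
    proof -
      obtain x where x: "z = of_real x" "x > 0" using \<open>z \<in> ?U\<close> by auto
      have V: "cser c (z\<^sup>2 / 4) = of_real (ser c (x\<^sup>2 / 4))" if "entire c" for c
        using cser_of_real[OF that, of "x\<^sup>2 / 4"] by (simp add: x)
      have L: "Ln (z / 2) = of_real (ln (x / 2))"
        using x Ln_of_real[of "x / 2"] by simp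
      have l: "ln (x\<^sup>2 / 4) = 2 * ln (x / 2)"
        using x ln_realpow[of "x / 2" 2] by (simp add: power_divide)
      have K: "macK z = of_real (macG (x\<^sup>2 / 4))"
        using macK_eq_macG[OF x(2)] by (simp only: x(1))
      show ?thesis
        unfolding K L V[OF entire_vc] V[OF entire_rc] macG_def l by simp
    qed
  qed (use assms open_wedge in auto)
  then show ?thesis by simp
qed

text \<open>The comparison of the two expansions with the series made abstract: \<open>A\<close>
  stands for the series of \<open>J_1\<close> in \<open>q\<close>, \<open>B\<close> for the
  non-logarithmic one, \<open>l\<close> for \<open>Ln (w / 2)\<close>, \<open>g\<close> for Euler's
  constant and \<open>P\<close> for pi. The shift \<open>\<i> * P / 2\<close> of the logarithm
  produces \<open>- z / 2 * A\<close>, which cancels the contribution of \<open>J_1\<close>.\<close>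

lemma hankel1_algebra:
  fixes A B P z l g :: complex
  assumes "P \<noteq> 0" "z \<noteq> 0"
  shows "z / 2 * A + \<i> * (2 / P * (l + \<i> * P / 2 + g) * (z / 2 * A) - 1 / P * (2 / z) + 1 / P * (z / 2 * B))
    = - (2 * \<i> / (P * z)) * ((2 * l + 2 * g) * (- (z / 2)\<^sup>2 * A) + (1 + - (z / 2)\<^sup>2 * B))"
proof -
  \<comment> \<open>Reciprocals and halves become variables with polynomial relations
    (\<open>p\<close> for \<open>1 / P\<close>, \<open>y\<close> for \<open>1 / z\<close>,
    \<open>h\<close> for \<open>z / 2\<close>), which makes the claim a question of ideal
    membership.\<close>
  have gen: "h * A + j * (2 * p * (l + t + g) * (h * A) - p * (2 * y) + p * (h * B))
     = - (2 * j * (p * y)) * ((2 * l + 2 * g) * (- (h * h) * A) + (1 + - (h * h) * B))"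
    if "p * P = 1" "y * z = 1" "2 * h = z" "2 * t = j * P" "j * j = - 1" for h j p y t :: complex
    using that by algebra
  have "1 / P * P = 1" "1 / z * z = 1" "2 * (z / 2) = z" "2 * (\<i> * P / 2) = \<i> * P"
    using assms by simp_all
  from gen[OF this(1-4) i_squared] show ?thesis
    by (simp add: power2_eq_square)
qed

text \<open>The connection formula \<open>H_1(z) = - (2 / pi) K_1(- \<i> z)\<close>. With
  \<open>q = w^2 / 4 = - (z / 2)^2\<close> the alternating signs of the Bessel series disappear, and
  \<open>rc (Suc p)\<close> gathers \<open>harm (1 + p) + harm p\<close>.\<close>

lemma hankel1_eq_macK:
  assumes z: "Re z > 0" "Im z \<ge> 0"
  shows "hankel1 1 z = - (2 * \<i> / (of_real pi * z)) * macK (- \<i> * z)"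
proof -
  define w where "w = - \<i> * z"
  define q where "q = w\<^sup>2 / 4"
  have w: "w \<in> wedge" and z0: "z \<noteq> 0"
    using z by (auto simp: w_def wedge_def)
  have zw: "z = \<i> * w" by (simp add: w_def)
  have q: "q = - (z / 2)\<^sup>2"
    by (simp add: q_def w_def power_mult_distrib power_divide)
  have pw: "(z / 2) ^ (1 + 2 * p) = (z / 2) * ((-1) ^ p * q ^ p)" for p
    by (simp add: q power_mult power_mult_distrib[symmetric])
  have vS: "complex_of_real (vc (Suc p)) = 1 / (fact p * fact (1 + p))" for p
    by (simp add: vc_def power2_eq_square divide_simps)
  have J: "bessel_J 1 z = (z / 2) * cser (\<lambda>n. vc (Suc n)) q"
  proof -
    have "(\<lambda>p. (-1) ^ p / (fact p * fact (1 + p)) * (z / 2) ^ (1 + 2 * p))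
        = (\<lambda>p. (z / 2) * (of_real (vc (Suc p)) * q ^ p))"
      unfolding pw vS by (rule ext) (simp flip: power_mult_distrib add: mult_ac)
    then show ?thesis
      unfolding bessel_J_def cser_def
      by (simp only: suminf_mult[OF summable_cser[OF entire_Suc[OF entire_vc]]])
  qed
  have rS: "complex_of_real (vc (Suc p)) * (harm (1 + p) + harm p) = - of_real (rc (Suc p))" for p
  proof -
    have "vc (Suc p) * (harm (1 + p) + harm p) = - rc (Suc p)"
    proof -
      define N where "N = real (Suc p)"
      have N: "N \<noteq> 0" by (simp add: N_def)
      have "vc (Suc p) * (harm (1 + p) + harm p) = (N * (harm p + inverse N + harm p)) / (fact (Suc p))\<^sup>2"
        unfolding vc_def N_def[symmetric] by (simp add: harm_Suc N_def)
      also have "N * (harm p + inverse N + harm p) = - (1 - 2 * N * (harm p + inverse N))"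
        using N by (simp add: algebra_simps)
      also have "\<dots> / (fact (Suc p))\<^sup>2 = - rc (Suc p)"
        unfolding rc_def harm_Suc N_def[symmetric] by (simp add: minus_divide_left)
      finally show ?thesis .
    qed
    then have "complex_of_real (vc (Suc p) * (harm (1 + p) + harm p)) = of_real (- rc (Suc p))"
      by (simp only:)
    then show ?thesis
      by (simp only: of_real_mult of_real_add of_real_harm of_real_minus)
  qed
  have T: "(\<Sum>p. (-1) ^ p / (fact p * fact (1 + p)) * (z / 2) ^ (1 + 2 * p) * (harm (1 + p) + harm p))
      = - (z / 2) * cser (\<lambda>n. rc (Suc n)) q"
  proof -
    have "(-1) ^ p / (fact p * fact (1 + p)) * (z / 2) ^ (1 + 2 * p) * (harm (1 + p) + harm p)
        = - (z / 2) * (of_real (rc (Suc p)) * q ^ p)" for p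
    proof -
      have "(-1) ^ p / (fact p * fact (1 + p)) * (z / 2) ^ (1 + 2 * p) * (harm (1 + p) + harm p)
        = (z / 2) * ((of_real (vc (Suc p)) * (harm (1 + p) + harm p)) * q ^ p)"
        unfolding pw vS by (simp flip: power_mult_distrib add: mult_ac)
      then show ?thesis unfolding rS by simp
    qed
    then show ?thesis
      unfolding cser_def
      by (simp only: suminf_mult[OF summable_cser[OF entire_Suc[OF entire_rc]]])
  qed
  have Y: "bessel_Y 1 z = 2 / of_real pi * (Ln (z / 2) + euler_mascheroni) * bessel_J 1 z
      - 1 / of_real pi * (2 / z) + 1 / of_real pi * ((z / 2) * cser (\<lambda>n. rc (Suc n)) q)"
    unfolding bessel_Y_def T by simp
  \<comment> \<open>Rotation by \<open>\<i>\<close> adds exactly \<open>pi / 2\<close> to the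
    argument: \<open>Re w = Im z \<ge> 0\<close> keeps the principal branch from jumping.\<close>
  have Ln: "Ln (z / 2) = Ln (w / 2) + \<i> * of_real pi / 2"
  proof -
    have "z / 2 = \<i> * (w / 2)" by (simp add: zw)
    moreover have "0 \<le> Re (w / 2)" using z by (simp add: w_def)
    ultimately show ?thesis
      using Ln_times_ii[of "w / 2"] wedge_nonzero[OF w] by simp
  qed
  have K: "macK w = (2 * Ln (w / 2) + 2 * euler_mascheroni) * (q * cser (\<lambda>n. vc (Suc n)) q)
      + (1 + q * cser (\<lambda>n. rc (Suc n)) q)"
  proof -
    have "vc 0 = 0" "rc 0 = 1" by (simp_all add: vc_def rc_def)
    then show ?thesis
      unfolding macK_eq_series[OF w] q_def[symmetric]
      using cser_split[OF entire_vc, of q] cser_split[OF entire_rc, of q] by simp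
  qed
  have p: "complex_of_real pi \<noteq> 0" by simp
  have "hankel1 1 z = - (2 * \<i> / (of_real pi * z)) * macK w"
    unfolding hankel1_def Y J Ln K using hankel1_algebra[OF p z0] unfolding q .
  then show ?thesis by (simp add: w_def)
qed

lemma kernel_H_eq_macK:
  assumes k: "Re k > 0" "Im k \<ge> 0" and r: "norm (x1, x2) > 0"
  shows "kernel_H k x1 x2 = of_real (x1 / (pi * (norm (x1, x2))\<^sup>2)) * macK (- \<i> * k * of_real (norm (x1, x2)))"
proof -
  define r where "r = norm (x1, x2)"
  have r0: "r > 0" using r by (simp add: r_def)
  have H: "hankel1 1 (k * of_real r) = - (2 * \<i> / (of_real pi * (k * of_real r))) * macK (- \<i> * (k * of_real r))"
    using k r0 by (intro hankel1_eq_macK) auto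
  have gen: "j * k * X / 2 * (- (2 * j / (P * (k * R))) * M / R) = - (j * j) * (X / (P * R\<^sup>2) * M)"
    if "P \<noteq> 0" "R \<noteq> 0" "k \<noteq> 0" for j X P R M :: complex
    using that by (simp add: power2_eq_square)
  have "k \<noteq> 0" using k by auto
  then show ?thesis
    unfolding kernel_H_def r_def[symmetric] H using r0
    by (subst gen) (simp_all add: mult.assoc)
qed

section \<open>Derivatives of the kernel\<close>

locale wave_number =
  fixes k :: complex
  assumes Re_k: "Re k > 0" and Im_k: "Im k \<ge> 0"
begin

text \<open>
  The kernel is \<open>x1 * \<Phi> (x1\<^sup>2 + x2\<^sup>2)\<close>; a profile that is holomorphic in the square of the
  distance makes every partial derivative a combination of the functions \<open>gen a b j\<close> below with \<open>b \<le> j\<close>.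
\<close>

definition \<Phi> :: "complex \<Rightarrow> complex" where
  "\<Phi> \<sigma> = macK (- \<i> * k * csqrt \<sigma>) / (of_real pi * \<sigma>)"

abbreviation "\<Phi>D j \<equiv> (deriv ^^ j) \<Phi>"

text \<open>\<open>Re \<sigma> > 0\<close> means that \<open>p = csqrt \<sigma>\<close> satisfies
  \<open>|Im p| < Re p\<close>, and for \<open>w = - \<i> k p\<close> one computes
  \<open>Re w - Im w = Re k (Re p + Im p) + Im k (Re p - Im p)\<close>. Thus the right half plane, a
  neighbourhood of all values of \<open>r^2\<close>, is admissible for every wave number.\<close>

lemma csqrt_in_wedge:
  assumes "Re \<sigma> > 0" shows "- \<i> * k * csqrt \<sigma> \<in> wedge"
proof -
  define p where "p = csqrt \<sigma>"
  have p2: "p\<^sup>2 = \<sigma>" by (simp add: p_def)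
  have "(Re p)\<^sup>2 - (Im p)\<^sup>2 = Re \<sigma>"
    unfolding p2[symmetric] by (simp add: power2_eq_square)
  then have "(Im p)\<^sup>2 < (Re p)\<^sup>2" using assms by simp
  moreover have "Re p \<ge> 0" using csqrt_principal[of \<sigma>] by (auto simp: p_def)
  ultimately have "\<bar>Im p\<bar> < Re p"
    using abs_le_square_iff[of "Re p" "Im p"] by simp
  then have "0 < Re k * (Re p + Im p)" "0 \<le> Im k * (Re p - Im p)"
    using Re_k Im_k by auto
  then show ?thesis
    unfolding p_def[symmetric] by (simp add: wedge_def algebra_simps)
qed

lemma not_nonpos_Re: "Re \<sigma> > 0 \<Longrightarrow> \<sigma> \<notin> \<real>\<^sub>\<le>\<^sub>0"
  by (auto simp: complex_nonpos_Reals_iff)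

lemma open_Re_pos: "open {\<sigma>. Re \<sigma> > 0}"
  by (intro open_Collect_less continuous_intros)

lemma \<Phi>_holomorphic: "\<Phi> holomorphic_on {\<sigma>. Re \<sigma> > 0}"
proof -
  have "(\<lambda>\<sigma>. macK (- \<i> * k * csqrt \<sigma>)) holomorphic_on {\<sigma>. Re \<sigma> > 0}"
    using macK_csqrt_deriv[OF not_nonpos_Re csqrt_in_wedge] open_Re_pos
    by (auto simp: holomorphic_on_open)
  then show ?thesis
    unfolding \<Phi>_def[abs_def] by (auto intro!: holomorphic_intros)
qed

lemma \<Phi>D_deriv:
  assumes "Re \<sigma> > 0"
  shows "(\<Phi>D j has_field_derivative \<Phi>D (Suc j) \<sigma>) (at \<sigma>)"
  using holomorphic_derivI[OF holomorphic_higher_deriv[OF \<Phi>_holomorphic open_Re_pos, of j] open_Re_pos, of \<sigma>] assms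
  by simp

text \<open>The identity \<open>macK (- \<i> k csqrt \<sigma>) = pi \<sigma>
  \<Phi>(\<sigma>)\<close> is differentiated twice in two ways: by the product rule, and by
  \<open>macK_csqrt_deriv2\<close> with \<open>c^2 = - k^2\<close>. The result is the Helmholtz
  equation of \<open>x1 \<Phi>(x1^2 + x2^2)\<close> in terms of the profile.\<close>

lemma \<Phi>_ode:
  assumes "Re \<sigma> > 0"
  shows "4 * \<sigma> * \<Phi>D 2 \<sigma> + 8 * \<Phi>D 1 \<sigma> + k\<^sup>2 * \<Phi>D 0 \<sigma> = 0"
proof -
  let ?c = "- \<i> * k"
  let ?S = "{\<sigma>. Re \<sigma> > 0}"
  let ?H1 = "\<lambda>\<sigma>. macK' (?c * csqrt \<sigma>) * (?c / (2 * csqrt \<sigma>))"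
  have H: "macK (?c * csqrt z) = of_real pi * (z * \<Phi>D 0 z)" if "Re z > 0" for z
    using that by (auto simp: \<Phi>_def)
  have H1: "?H1 z = of_real pi * (\<Phi>D 0 z + z * \<Phi>D 1 z)" if z: "Re z > 0" for z
  proof -
    have "((\<lambda>z. of_real pi * (z * \<Phi>D 0 z)) has_field_derivative of_real pi * (\<Phi>D 0 z + z * \<Phi>D 1 z)) (at z)"
      using DERIV_cmult[OF DERIV_mult[OF DERIV_ident \<Phi>D_deriv[OF z, of 0]], of "of_real pi"]
      by (simp add: mult.commute add.commute)
    moreover have "((\<lambda>z. of_real pi * (z * \<Phi>D 0 z)) has_field_derivative ?H1 z) (at z)"
      by (rule has_field_derivative_transform_within_open[OF macK_csqrt_deriv[OF not_nonpos_Re csqrt_in_wedge] open_Re_pos])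
        (use z H in auto)
    ultimately show ?thesis by (rule DERIV_unique[rotated])
  qed
  have "((\<lambda>z. of_real pi * (\<Phi>D 0 z + z * \<Phi>D 1 z)) has_field_derivative
      of_real pi * (\<Phi>D 1 \<sigma> + (\<Phi>D 1 \<sigma> + \<sigma> * \<Phi>D 2 \<sigma>))) (at \<sigma>)"
    using DERIV_cmult[OF DERIV_add[OF \<Phi>D_deriv[OF assms, of 0] DERIV_mult[OF DERIV_ident \<Phi>D_deriv[OF assms, of 1]]], of "of_real pi"]
    by (simp add: mult.commute add.commute numeral_2_eq_2)
  moreover have "((\<lambda>z. of_real pi * (\<Phi>D 0 z + z * \<Phi>D 1 z)) has_field_derivative
      ?c\<^sup>2 / (4 * \<sigma>) * macK (?c * csqrt \<sigma>)) (at \<sigma>)"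
    by (rule has_field_derivative_transform_within_open[OF macK_csqrt_deriv2[OF not_nonpos_Re csqrt_in_wedge] open_Re_pos])
      (use assms H1 in auto)
  ultimately have "of_real pi * (\<Phi>D 1 \<sigma> + (\<Phi>D 1 \<sigma> + \<sigma> * \<Phi>D 2 \<sigma>)) = ?c\<^sup>2 / (4 * \<sigma>) * macK (?c * csqrt \<sigma>)"
    by (rule DERIV_unique)
  also have "\<dots> = of_real pi * (- k\<^sup>2 / 4 * \<Phi>D 0 \<sigma>)"
  proof -
    have "\<sigma> \<noteq> 0" using assms by auto
    then show ?thesis unfolding H[OF assms] by (simp add: power_mult_distrib)
  qed
  finally have "\<Phi>D 1 \<sigma> + (\<Phi>D 1 \<sigma> + \<sigma> * \<Phi>D 2 \<sigma>) = - k\<^sup>2 / 4 * \<Phi>D 0 \<sigma>"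
    by (simp only: mult_cancel_left of_real_eq_0_iff) simp
  then have "4 * (\<Phi>D 1 \<sigma> + (\<Phi>D 1 \<sigma> + \<sigma> * \<Phi>D 2 \<sigma>)) = 4 * (- k\<^sup>2 / 4 * \<Phi>D 0 \<sigma>)"
    by (rule arg_cong)
  then show ?thesis by (simp add: algebra_simps)
qed

text \<open>Cauchy's inequality is used on a disc about \<open>r^2\<close> whose radius is
  proportional to \<open>r\<close> only: the square root then varies by at most
  \<open>al / 2\<close>, so \<open>exp (- Re w)\<close> stays bounded on the circle even for real
  \<open>k\<close>. A radius proportional to \<open>r^2\<close> would let it grow exponentially.
  Each derivative thus gains \<open>1 / r\<close>.\<close>

lemma \<Phi>D_bound:
  assumes al: "al > 0"
  obtains C where "C \<ge> 0" "\<And>r. r \<ge> al \<Longrightarrow> norm (\<Phi>D j (of_real (r\<^sup>2))) \<le> C / (r ^ j * (r * sqrt r))"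
proof -
  obtain C where C: "C > 0" "\<And>w. w \<in> wedge \<Longrightarrow> norm (macK w) \<le> C * (exp (- Re w) * (1 + sqrt (norm w)))"
    using macK_bound by blast
  \<comment> \<open>The factors come from the displacement of the square root in the exponential,
    from \<open>1 \<le> sqrt (r / al)\<close>, from \<open>norm w \<le> 2 * norm k * r\<close>, and
    the final 2 from \<open>norm x \<ge> r^2 / 2\<close>.\<close>
  define C1 where "C1 = C * exp (norm k * (al / 2)) * (1 / sqrt al + sqrt (2 * norm k)) * 2"
  have C1: "C1 \<ge> 0" using C(1) al by (auto simp: C1_def)
  show thesis
  proof
    show "0 \<le> fact j * C1 * (2 / al) ^ j" using C1 al by auto
    fix r assume r: "r \<ge> al"
    have r0: "r > 0" using r al by simp
    define \<rho> where "\<rho> = al * r / 2"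
    have \<rho>: "\<rho> > 0" "\<rho> \<le> r\<^sup>2 / 2"
      using r al r0 by (auto simp: \<rho>_def power2_eq_square)
    have r2: "0 < r\<^sup>2" using r0 by simp
    have Re: "Re x \<ge> r\<^sup>2 / 2" if "norm (of_real (r\<^sup>2) - x) \<le> \<rho>" for x
    proof -
      have "r\<^sup>2 - Re x \<le> \<rho>"
        using that abs_Re_le_cmod[of "of_real (r\<^sup>2) - x"] by simp
      then show ?thesis using \<rho>(2) by linarith
    qed
    have sub: "cball (of_real (r\<^sup>2)) \<rho> \<subseteq> {\<sigma>. Re \<sigma> > 0}"
    proof
      fix x assume "x \<in> cball (complex_of_real (r\<^sup>2)) \<rho>"
      then have "Re x \<ge> r\<^sup>2 / 2" by (intro Re) (simp add: dist_norm)
      with half_gt_zero[OF r2] show "x \<in> {\<sigma>. Re \<sigma> > 0}"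
        unfolding mem_Collect_eq by (rule less_le_trans)
    qed
    have "norm (\<Phi>D j (of_real (r\<^sup>2))) \<le> fact j * (C1 / (r * sqrt r)) / \<rho> ^ j"
    proof (rule Cauchy_inequality)
      show "\<Phi> holomorphic_on ball (of_real (r\<^sup>2)) \<rho>"
        using \<Phi>_holomorphic sub ball_subset_cball by (blast intro: holomorphic_on_subset)
      show "continuous_on (cball (of_real (r\<^sup>2)) \<rho>) \<Phi>"
        using \<Phi>_holomorphic sub by (blast intro: holomorphic_on_subset holomorphic_on_imp_continuous_on)
      show "0 < \<rho>" by (fact \<rho>)
      fix x :: complex assume x: "norm (of_real (r\<^sup>2) - x) = \<rho>"
      have Rx: "Re x \<ge> r\<^sup>2 / 2" using Re x by simp
      then have Rx0: "Re x > 0" using r2 by linarith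
      have nx: "norm x \<ge> r\<^sup>2 / 2" using Rx complex_Re_le_cmod[of x] by linarith
      have "norm x \<le> norm (complex_of_real (r\<^sup>2)) + norm (of_real (r\<^sup>2) - x)"
        using norm_triangle_ineq4[of "complex_of_real (r\<^sup>2)" "of_real (r\<^sup>2) - x"] by simp
      then have "norm x \<le> r\<^sup>2 + \<rho>"
        unfolding x norm_of_real by simp
      with \<rho>(2) r2 have "norm x \<le> 4 * r\<^sup>2" by linarith
      then have nx2: "norm x \<le> 2\<^sup>2 * r\<^sup>2" by simp
      define p where "p = csqrt x"
      have p: "Re p \<ge> 0" "p\<^sup>2 = x" using csqrt_principal[of x] by (auto simp: p_def)
      have np: "norm p \<le> 2 * r"
      proof -
        have "norm p = sqrt (norm x)" by (simp add: p_def)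
        also have "\<dots> \<le> sqrt (2\<^sup>2 * r\<^sup>2)" using nx2 by simp
        also have "\<dots> = 2 * r" using r0 by (simp add: real_sqrt_mult)
        finally show ?thesis .
      qed
      \<comment> \<open>\<open>p - r = (p^2 - r^2) / (p + r)\<close>, and
        \<open>Re p \<ge> 0\<close> bounds the modulus of the denominator below by
        \<open>r\<close>.\<close>
      have "(p - of_real r) * (p + of_real r) = x - of_real (r\<^sup>2)"
        using p(2) by (simp add: algebra_simps power2_eq_square)
      then have "norm (p - of_real r) * norm (p + of_real r) = \<rho>"
        using x by (metis norm_minus_commute norm_mult)
      moreover have "r \<le> norm (p + of_real r)"
        using complex_Re_le_cmod[of "p + of_real r"] p(1) by simp
      ultimately have "norm (p - of_real r) * r \<le> \<rho>"
        using mult_left_mono[of r "norm (p + of_real r)" "norm (p - of_real r)"] by simp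
      then have pr: "norm (p - of_real r) \<le> al / 2"
        using r0 by (simp add: \<rho>_def)
      define w where "w = - \<i> * k * p"
      have w: "w \<in> wedge" unfolding w_def p_def by (rule csqrt_in_wedge[OF Rx0])
      have "- Re w = - (Im k * r) - Im (k * (p - of_real r))"
        by (simp add: w_def algebra_simps)
      also have "\<dots> \<le> norm (k * (p - of_real r))"
        using abs_Im_le_cmod[of "k * (p - of_real r)"] mult_nonneg_nonneg[OF Im_k, of r] r0 by linarith
      also have "\<dots> \<le> norm k * (al / 2)"
        unfolding norm_mult using pr by (rule mult_left_mono) simp
      finally have e: "exp (- Re w) \<le> exp (norm k * (al / 2))" by simp
      have "1 + sqrt (norm w) \<le> sqrt r * (1 / sqrt al + sqrt (2 * norm k))"
      proof -
        have "norm w \<le> (2 * norm k) * r"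
          using mult_left_mono[OF np, of "norm k"] by (simp add: w_def norm_mult)
        then have "sqrt (norm w) \<le> sqrt r * sqrt (2 * norm k)"
          by (metis real_sqrt_le_mono real_sqrt_mult mult.commute)
        moreover have "1 \<le> sqrt r * (1 / sqrt al)"
          using r al by simp
        ultimately show ?thesis unfolding distrib_left by linarith
      qed
      with e have "exp (- Re w) * (1 + sqrt (norm w)) \<le>
          exp (norm k * (al / 2)) * (sqrt r * (1 / sqrt al + sqrt (2 * norm k)))"
        by (intro mult_mono) auto
      then have "C * (exp (- Re w) * (1 + sqrt (norm w))) \<le>
          C * (exp (norm k * (al / 2)) * (sqrt r * (1 / sqrt al + sqrt (2 * norm k))))"
        using C(1) by (intro mult_left_mono) auto
      with C(2)[OF w] have M: "norm (macK w) \<le> C1 / 2 * sqrt r"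
        by (simp add: C1_def mult_ac)
      have "norm (\<Phi> x) = norm (macK w) / (pi * norm x)"
        by (simp add: \<Phi>_def w_def p_def norm_divide norm_mult)
      also have "\<dots> \<le> (C1 / 2 * sqrt r) / (1 * (r\<^sup>2 / 2))"
        using M nx pi_gt3 r2 C1 r0 by (intro frac_le mult_mono mult_nonneg_nonneg mult_pos_pos) auto
      also have "\<dots> = C1 / (r * sqrt r)"
      proof -
        have "sqrt r * sqrt r = r" using r0 by simp
        then have "C1 * sqrt r * (r * sqrt r) = C1 * r\<^sup>2"
          by (simp add: power2_eq_square)
        then show ?thesis using r0 by (simp add: frac_eq_eq)
      qed
      finally show "norm (\<Phi> x) \<le> C1 / (r * sqrt r)" .
    qed
    also have "\<dots> = fact j * C1 * (2 / al) ^ j / (r ^ j * (r * sqrt r))"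
      using al r0 by (simp add: \<rho>_def power_mult_distrib power_divide field_simps)
    finally show "norm (\<Phi>D j (of_real (r\<^sup>2))) \<le> fact j * C1 * (2 / al) ^ j / (r ^ j * (r * sqrt r))" .
  qed
qed

definition gen :: "nat \<Rightarrow> nat \<Rightarrow> nat \<Rightarrow> real \<times> real \<Rightarrow> complex" where
  "gen a b j x = of_real (fst x ^ a * snd x ^ b) * \<Phi>D j (of_real ((fst x)\<^sup>2 + (snd x)\<^sup>2))"

text \<open>Each power of \<open>x2\<close> has to be paid for by a factor \<open>1 / r\<close> from
  a derivative of the profile, hence \<open>b \<le> j\<close>. A derivative in \<open>x2\<close>
  lowers \<open>b\<close> or raises \<open>b\<close> and \<open>j\<close> together, so the condition
  persists; powers of \<open>x1\<close> are harmless as long as \<open>x1\<close> is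
  bounded.\<close>

inductive_set kclass :: "(real \<times> real \<Rightarrow> complex) set" where
  gen: "b \<le> j \<Longrightarrow> gen a b j \<in> kclass"
| lin: "M \<in> kclass \<Longrightarrow> N \<in> kclass \<Longrightarrow> (\<lambda>x. c * M x + d * N x) \<in> kclass"

lemma gen_derivative:
  assumes "x \<in> half_plane"
  shows "(gen a b j has_derivative (\<lambda>h.
      of_real (fst h) * (of_nat a * gen (a - 1) b j x + 2 * gen (a + 1) b (j + 1) x)
    + of_real (snd h) * (of_nat b * gen a (b - 1) j x + 2 * gen a (b + 1) (j + 1) x))) (at x)"
proof -
  have x1: "fst x > 0" using assms by (auto simp: half_plane_def)
  let ?s = "\<lambda>x::real \<times> real. (fst x)\<^sup>2 + (snd x)\<^sup>2"
  have "?s x > 0" using x1 by (simp add: add_pos_nonneg)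
  then have R: "Re (of_real (?s x)) > 0" by simp
  have s: "((\<lambda>x. complex_of_real (?s x)) has_derivative (\<lambda>h. of_real (2 * fst x * fst h + 2 * snd x * snd h))) (at x)"
    by (rule has_derivative_of_real) (auto intro!: derivative_eq_intros)
  have 1: "((\<lambda>x. \<Phi>D j (of_real (?s x))) has_derivative
      (\<lambda>h. \<Phi>D (Suc j) (of_real (?s x)) * of_real (2 * fst x * fst h + 2 * snd x * snd h))) (at x)"
    using has_derivative_compose[OF s \<Phi>D_deriv[OF R, of j, unfolded has_field_derivative_def]]
    by simp
  have 2: "((\<lambda>x::real \<times> real. complex_of_real (fst x ^ a * snd x ^ b)) has_derivative
      (\<lambda>h. of_real (real a * fst x ^ (a - 1) * fst h * snd x ^ b + fst x ^ a * (real b * snd x ^ (b - 1) * snd h)))) (at x)"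
    by (rule has_derivative_of_real) (auto intro!: derivative_eq_intros simp: mult_ac)
  show ?thesis
    unfolding gen_def[abs_def]
    by (rule has_derivative_eq_rhs[OF has_derivative_mult[OF 2 1]])
      (auto simp: fun_eq_iff algebra_simps)
qed

lemma kclass_derivative:
  assumes "N \<in> kclass"
  shows "\<exists>N1\<in>kclass. \<exists>N2\<in>kclass. \<forall>x\<in>half_plane.
     (N has_derivative (\<lambda>h. of_real (fst h) * N1 x + of_real (snd h) * N2 x)) (at x)"
  using assms
proof induction
  case (gen b j a)
  show ?case
  proof (intro bexI ballI)
    show "(gen a b j has_derivative (\<lambda>h.
      of_real (fst h) * (of_nat a * gen (a - 1) b j x + 2 * gen (a + 1) b (j + 1) x)
    + of_real (snd h) * (of_nat b * gen a (b - 1) j x + 2 * gen a (b + 1) (j + 1) x))) (at x)"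
      if "x \<in> half_plane" for x
      by (rule gen_derivative[OF that])
  qed (use gen in \<open>auto intro!: kclass.intros\<close>)
next
  case (lin M N c d)
  then obtain M1 M2 N1 N2 where *: "M1 \<in> kclass" "M2 \<in> kclass" "N1 \<in> kclass" "N2 \<in> kclass"
    "\<And>x. x \<in> half_plane \<Longrightarrow> (M has_derivative (\<lambda>h. of_real (fst h) * M1 x + of_real (snd h) * M2 x)) (at x)"
    "\<And>x. x \<in> half_plane \<Longrightarrow> (N has_derivative (\<lambda>h. of_real (fst h) * N1 x + of_real (snd h) * N2 x)) (at x)"
    by blast
  show ?case
  proof (intro bexI ballI)
    fix x :: "real \<times> real" assume x: "x \<in> half_plane"
    show "((\<lambda>x. c * M x + d * N x) has_derivative
       (\<lambda>h. of_real (fst h) * (c * M1 x + d * N1 x) + of_real (snd h) * (c * M2 x + d * N2 x))) (at x)"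
      by (rule has_derivative_eq_rhs[OF has_derivative_add[OF
            has_derivative_mult_right[OF *(5)[OF x]] has_derivative_mult_right[OF *(6)[OF x]]]])
        (auto simp: fun_eq_iff algebra_simps)
  qed (use * in \<open>auto intro!: kclass.lin\<close>)
qed

end

text \<open>This is \<open>r^(-3/2)\<close> in disguise: \<open>1 / r^2\<close> from the Poisson
  kernel times the \<open>sqrt r\<close> growth allowed to \<open>macK\<close> when \<open>k\<close>
  is real. The 1 stands, up to a constant, for a positive lower bound on \<open>x1\<close>.\<close>

definition weight :: "real \<Rightarrow> real" where
  "weight t = (1 + t\<^sup>2) powr (-3/4)"

lemma weight_pos: "weight t > 0"
proof -
  have "1 + t\<^sup>2 > 0" by (simp add: add_pos_nonneg)
  then show ?thesis unfolding weight_def by simp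
qed

lemma inverse_rsqrt_le_weight:
  assumes c: "c > 0" and r: "r > 0" "r\<^sup>2 \<ge> c * (1 + t\<^sup>2)"
  shows "1 / (r * sqrt r) \<le> c powr (-3/4) * weight t"
proof -
  have "r * sqrt r = r powr 1 * r powr (1/2)"
    using r by (simp add: powr_half_sqrt)
  also have "\<dots> = (r powr 2) powr (3/4)"
    unfolding powr_add[symmetric] powr_powr by simp
  also have "r powr 2 = r\<^sup>2" using r by simp
  finally have "1 / (r * sqrt r) = (r\<^sup>2) powr (-3/4)"
    using powr_minus_divide[of "r\<^sup>2" "3/4"] by simp
  also have "\<dots> \<le> (c * (1 + t\<^sup>2)) powr (-3/4)"
    using r c by (intro powr_mono2') (auto intro!: mult_pos_pos add_pos_nonneg)
  also have "\<dots> = c powr (-3/4) * weight t"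
    unfolding weight_def by (rule powr_mult)
  finally show ?thesis .
qed

text \<open>Moves the centre from \<open>y\<close> to the origin at the price of a constant
  depending only on \<open>M\<close>, so that one majorant serves all points near a given
  one.\<close>

lemma weight_shift:
  assumes "\<bar>y\<bar> \<le> M"
  shows "weight (y - t) \<le> (2 + 2 * M\<^sup>2) powr (3/4) * weight t"
proof -
  have "t\<^sup>2 \<le> 2 * (y - t)\<^sup>2 + 2 * y\<^sup>2"
    using zero_le_power2[of "2 * y - t"] by (simp add: power2_eq_square algebra_simps)
  moreover have "y\<^sup>2 \<le> M\<^sup>2"
    using assms by (metis abs_ge_zero power2_abs power_mono)
  moreover have "0 \<le> M\<^sup>2 * (y - t)\<^sup>2" by simp
  ultimately have le: "1 + t\<^sup>2 \<le> (2 + 2 * M\<^sup>2) * (1 + (y - t)\<^sup>2)"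
    unfolding distrib_left distrib_right by linarith
  have p: "2 + 2 * M\<^sup>2 > 0" "1 + (y - t)\<^sup>2 > 0" "1 + t\<^sup>2 > 0"
    by (auto intro: add_pos_nonneg)
  have "weight (y - t) = (2 + 2 * M\<^sup>2) powr (3/4) * ((2 + 2 * M\<^sup>2) powr (-3/4) * (1 + (y - t)\<^sup>2) powr (-3/4))"
    unfolding weight_def mult.assoc[symmetric] powr_add[symmetric] using p by simp
  also have "(2 + 2 * M\<^sup>2) powr (-3/4) * (1 + (y - t)\<^sup>2) powr (-3/4) = ((2 + 2 * M\<^sup>2) * (1 + (y - t)\<^sup>2)) powr (-3/4)"
    by (rule powr_mult[symmetric])
  also have "\<dots> \<le> weight t"
    unfolding weight_def using le p by (intro powr_mono2') auto
  finally show ?thesis by (simp add: mult_left_mono)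
qed

context wave_number
begin

lemma gen_bound:
  assumes "b \<le> j" and al: "al > 0"
  shows "\<exists>C\<ge>0. \<forall>x1 x2. al \<le> x1 \<longrightarrow> x1 \<le> be \<longrightarrow> norm (gen a b j (x1, x2)) \<le> C * weight x2"
proof -
  obtain C where C: "C \<ge> 0" "\<And>r. r \<ge> al \<Longrightarrow> norm (\<Phi>D j (of_real (r\<^sup>2))) \<le> C / (r ^ j * (r * sqrt r))"
    using \<Phi>D_bound[OF al] by blast
  \<comment> \<open>Chosen so that \<open>c * (1 + x2^2) \<le> x1^2 + x2^2\<close> whenever
    \<open>x1 \<ge> al\<close>.\<close>
  define c where "c = min 1 (al\<^sup>2)"
  have c: "c > 0" "c \<le> 1" "c \<le> al\<^sup>2" using al by (auto simp: c_def)
  define K where "K = \<bar>be\<bar> ^ a * ((1 / al) ^ (j - b) * (C * c powr (-3/4)))"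
  show ?thesis
  proof (intro exI[of _ K] conjI allI impI)
    show "K \<ge> 0" using C al by (auto simp: K_def)
    fix x1 x2 assume x1: "al \<le> x1" "x1 \<le> be"
    define r where "r = sqrt (x1\<^sup>2 + x2\<^sup>2)"
    have r2: "r\<^sup>2 = x1\<^sup>2 + x2\<^sup>2" by (simp add: r_def)
    have "x1 \<le> r"
      unfolding r_def by (rule real_le_rsqrt) simp
    then have r: "al \<le> r" "r > 0" using x1 al by auto
    have x2: "\<bar>x2\<bar> \<le> r"
      unfolding r_def by (rule real_le_rsqrt) simp
    have "c * (1 + x2\<^sup>2) \<le> r\<^sup>2"
    proof -
      have "al\<^sup>2 \<le> x1\<^sup>2" using x1 al by (intro power_mono) auto
      moreover have "c * x2\<^sup>2 \<le> 1 * x2\<^sup>2" using c by (intro mult_right_mono) auto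
      ultimately show ?thesis unfolding r2 distrib_left using c by simp
    qed
    from inverse_rsqrt_le_weight[OF c(1) r(2) this]
    have W: "1 / (r * sqrt r) \<le> c powr (-3/4) * weight x2" .
    have rb: "r ^ b / r ^ j \<le> (1 / al) ^ (j - b)"
    proof -
      have "r ^ b / r ^ j = (1 / r) ^ (j - b)"
        using assms(1) r(2) by (simp add: power_diff power_divide)
      also have "\<dots> \<le> (1 / al) ^ (j - b)"
        using r al by (intro power_mono frac_le) auto
      finally show ?thesis .
    qed
    have "norm (gen a b j (x1, x2)) = \<bar>x1\<bar> ^ a * (\<bar>x2\<bar> ^ b * norm (\<Phi>D j (of_real (r\<^sup>2))))"
      unfolding gen_def r2 by (simp add: norm_mult norm_power)
    also have "\<dots> \<le> \<bar>be\<bar> ^ a * (r ^ b * (C / (r ^ j * (r * sqrt r))))"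
      using x1 al x2 C r by (intro mult_mono power_mono mult_nonneg_nonneg) auto
    also have "r ^ b * (C / (r ^ j * (r * sqrt r))) = (r ^ b / r ^ j) * (C * (1 / (r * sqrt r)))"
      by simp
    also have "\<dots> \<le> (1 / al) ^ (j - b) * (C * (c powr (-3/4) * weight x2))"
      using rb W C(1) r al by (intro mult_mono mult_nonneg_nonneg) auto
    finally show "norm (gen a b j (x1, x2)) \<le> K * weight x2"
      by (simp add: K_def mult.assoc mult_left_mono)
  qed
qed

lemma kclass_bound:
  assumes "N \<in> kclass" and al: "al > 0"
  shows "\<exists>C\<ge>0. \<forall>x1 x2. al \<le> x1 \<longrightarrow> x1 \<le> be \<longrightarrow> norm (N (x1, x2)) \<le> C * weight x2"
  using assms(1)
proof induction
  case (gen b j a)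
  show ?case by (rule gen_bound[OF gen al])
next
  case (lin M N c d)
  then obtain A B where A: "A \<ge> 0" "\<forall>x1 x2. al \<le> x1 \<longrightarrow> x1 \<le> be \<longrightarrow> norm (M (x1, x2)) \<le> A * weight x2"
    and B: "B \<ge> 0" "\<forall>x1 x2. al \<le> x1 \<longrightarrow> x1 \<le> be \<longrightarrow> norm (N (x1, x2)) \<le> B * weight x2"
    by blast
  show ?case
  proof (intro exI[of _ "norm c * A + norm d * B"] conjI allI impI)
    fix x1 x2 assume x: "al \<le> x1" "x1 \<le> be"
    have "norm (c * M (x1, x2) + d * N (x1, x2)) \<le> norm c * norm (M (x1, x2)) + norm d * norm (N (x1, x2))"
      using norm_triangle_ineq[of "c * M (x1, x2)" "d * N (x1, x2)"] by (simp add: norm_mult)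
    also have "\<dots> \<le> norm c * (A * weight x2) + norm d * (B * weight x2)"
      using A B x by (intro add_mono mult_left_mono) auto
    finally show "norm (c * M (x1, x2) + d * N (x1, x2)) \<le> (norm c * A + norm d * B) * weight x2"
      by (simp add: algebra_simps)
  qed (use A B in auto)
qed

lemma kclass_shift_bound:
  assumes "N \<in> kclass" and al: "al > 0"
  shows "\<exists>C\<ge>0. \<forall>x1 x2 t. al \<le> x1 \<longrightarrow> x1 \<le> be \<longrightarrow> \<bar>x2\<bar> \<le> M \<longrightarrow> norm (N (x1, x2 - t)) \<le> C * weight t"
proof -
  obtain C where C: "C \<ge> 0" "\<And>x1 x2. al \<le> x1 \<Longrightarrow> x1 \<le> be \<Longrightarrow> norm (N (x1, x2)) \<le> C * weight x2"
    using kclass_bound[OF assms] by blast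
  show ?thesis
  proof (intro exI[of _ "C * (2 + 2 * M\<^sup>2) powr (3/4)"] conjI allI impI)
    fix x1 x2 t assume x: "al \<le> x1" "x1 \<le> be" "\<bar>x2\<bar> \<le> M"
    have "norm (N (x1, x2 - t)) \<le> C * weight (x2 - t)"
      using C(2) x by blast
    also have "\<dots> \<le> C * ((2 + 2 * M\<^sup>2) powr (3/4) * weight t)"
      using weight_shift[OF x(3)] C(1) by (intro mult_left_mono)
    finally show "norm (N (x1, x2 - t)) \<le> C * (2 + 2 * M\<^sup>2) powr (3/4) * weight t"
      by (simp add: mult.assoc)
  qed (use C in auto)
qed

end

section \<open>Smoothness and the Helmholtz equation\<close>

lemma open_half_plane: "open half_plane"
  unfolding half_plane_def by (intro open_Times) auto

text \<open>Lets the potential be exchanged for \<open>pot (gen 1 0 0)\<close>, with which it agrees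
  on the open half plane.\<close>

lemma C_k_on_cong:
  assumes "open S" "\<And>x. x \<in> S \<Longrightarrow> f x = g x"
  shows "C_k_on n f S \<longleftrightarrow> C_k_on n g S"
  using assms(2)
proof (induction n arbitrary: f g)
  case 0
  then show ?case by (simp cong: continuous_on_cong)
next
  case (Suc n)
  have d: "(f has_derivative D) (at x) \<longleftrightarrow> (g has_derivative D) (at x)" if "x \<in> S" for D x
    using has_derivative_transform_within_open[OF _ assms(1) that, of f D UNIV g]
      has_derivative_transform_within_open[OF _ assms(1) that, of g D UNIV f] Suc.prems by auto
  then have "frechet_derivative f (at x) = frechet_derivative g (at x)" if "x \<in> S" for x
    using that by (simp add: frechet_derivative_def)
  then have "C_k_on n (\<lambda>x. frechet_derivative f (at x) v) S \<longleftrightarrow> C_k_on n (\<lambda>x. frechet_derivative g (at x) v) S" for v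
    by (intro Suc.IH) simp
  then show ?case
    using d by (simp add: differentiable_def)
qed

text \<open>Weighted integrability is the form in which membership in \<open>L2_plus_Linf\<close>
  enters smoothness, the equation and the boundary values.\<close>

locale weighted_density = wave_number +
  fixes \<phi> :: "real \<Rightarrow> complex"
  assumes \<phi>_measurable: "\<phi> \<in> borel_measurable lebesgue"
    and \<phi>_integrable: "integrable lebesgue (\<lambda>t. weight t * norm (\<phi> t))"
begin

text \<open>The kernel is a parameter so that derivatives of potentials are again potentials, with
  another kernel of the class.\<close>

definition pot :: "(real \<times> real \<Rightarrow> complex) \<Rightarrow> real \<times> real \<Rightarrow> complex" where
  "pot N x = (LINT t|lebesgue. N (fst x, snd x - t) * \<phi> t)"

lemma kclass_continuous_on:
  assumes "N \<in> kclass" shows "continuous_on half_plane N"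
  using kclass_derivative[OF assms] has_derivative_continuous
  by (blast intro: continuous_at_imp_continuous_on)

lemma kclass_measurable:
  assumes "N \<in> kclass" "x \<in> half_plane"
  shows "(\<lambda>t. N (fst x, snd x - t) * \<phi> t) \<in> borel_measurable lebesgue"
proof -
  have "continuous_on UNIV (\<lambda>t. N (fst x, snd x - t))"
    by (rule continuous_on_compose2[OF kclass_continuous_on[OF assms(1)]])
      (use assms(2) in \<open>auto intro!: continuous_intros simp: half_plane_def\<close>)
  then have "(\<lambda>t. N (fst x, snd x - t)) \<in> borel_measurable lebesgue"
    by (intro measurable_completion) (simp add: borel_measurable_continuous_onI)
  then show ?thesis
    using \<phi>_measurable by (rule borel_measurable_times)
qed

lemma pot_integrable:
  assumes N: "N \<in> kclass" and x: "x \<in> half_plane"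
  shows "integrable lebesgue (\<lambda>t. N (fst x, snd x - t) * \<phi> t)"
proof -
  have "fst x > 0" using x by (auto simp: half_plane_def)
  then obtain C where C: "C \<ge> 0"
    "\<forall>x1 x2 t. fst x \<le> x1 \<longrightarrow> x1 \<le> fst x \<longrightarrow> \<bar>x2\<bar> \<le> \<bar>snd x\<bar> \<longrightarrow> norm (N (x1, x2 - t)) \<le> C * weight t"
    using kclass_shift_bound[OF N, of "fst x" "fst x" "\<bar>snd x\<bar>"] by blast
  show ?thesis
  proof (rule Bochner_Integration.integrable_bound[OF _ kclass_measurable[OF assms]])
    show "integrable lebesgue (\<lambda>t. C * (weight t * norm (\<phi> t)))"
      using \<phi>_integrable by simp
    have "norm (N (fst x, snd x - t) * \<phi> t) \<le> (C * weight t) * norm (\<phi> t)" for t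
      unfolding norm_mult using C by (intro mult_right_mono) auto
    then show "AE t in lebesgue. norm (N (fst x, snd x - t) * \<phi> t) \<le> norm (C * (weight t * norm (\<phi> t)))"
      by (intro AE_I2) (simp add: mult.assoc order_trans[OF _ abs_ge_self])
  qed
qed

lemma pot_lin:
  assumes "M \<in> kclass" "N \<in> kclass" "x \<in> half_plane"
  shows "pot (\<lambda>x. c * M x + d * N x) x = c * pot M x + d * pot N x"
proof -
  have "pot (\<lambda>x. c * M x + d * N x) x
     = (LINT t|lebesgue. c * (M (fst x, snd x - t) * \<phi> t) + d * (N (fst x, snd x - t) * \<phi> t))"
    unfolding pot_def by (intro Bochner_Integration.integral_cong) (auto simp: algebra_simps)
  also have "\<dots> = c * pot M x + d * pot N x"
    unfolding pot_def using pot_integrable[OF assms(1,3)] pot_integrable[OF assms(2,3)]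
    by (subst Bochner_Integration.integral_add) auto
  finally show ?thesis .
qed

lemma pot_derivative:
  assumes N: "N \<in> kclass" "N1 \<in> kclass" "N2 \<in> kclass"
    and der: "\<And>x. x \<in> half_plane \<Longrightarrow> (N has_derivative (\<lambda>h. of_real (fst h) * N1 x + of_real (snd h) * N2 x)) (at x)"
    and x: "x \<in> half_plane"
  shows "(pot N has_derivative (\<lambda>h. of_real (fst h) * pot N1 x + of_real (snd h) * pot N2 x)) (at x)"
proof -
  \<comment> \<open>The box around \<open>x\<close> keeps \<open>x1\<close> above half its value and
    both coordinates bounded, as \<open>kclass_shift_bound\<close> requires.\<close>
  define al where "al = fst x / 2"
  define be where "be = fst x + 1"
  define M where "M = \<bar>snd x\<bar> + 1"
  have x1: "fst x > 0" using x by (auto simp: half_plane_def)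
  have al: "al > 0" "al < fst x" using x1 by (auto simp: al_def)
  obtain C1 where C1: "C1 \<ge> 0"
    "\<And>x1 x2 t. al \<le> x1 \<Longrightarrow> x1 \<le> be \<Longrightarrow> \<bar>x2\<bar> \<le> M \<Longrightarrow> norm (N1 (x1, x2 - t)) \<le> C1 * weight t"
    using kclass_shift_bound[OF N(2) al(1), of be M] by blast
  obtain C2 where C2: "C2 \<ge> 0"
    "\<And>x1 x2 t. al \<le> x1 \<Longrightarrow> x1 \<le> be \<Longrightarrow> \<bar>x2\<bar> \<le> M \<Longrightarrow> norm (N2 (x1, x2 - t)) \<le> C2 * weight t"
    using kclass_shift_bound[OF N(3) al(1), of be M] by blast
  let ?U = "{al<..<be} \<times> {-M<..<M}"
  let ?D = "\<lambda>x t h. of_real (fst h) * (N1 (fst x, snd x - t) * \<phi> t) + of_real (snd h) * (N2 (fst x, snd x - t) * \<phi> t)"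
  have UH: "y \<in> half_plane" if "y \<in> ?U" for y
    using that al by (auto simp: half_plane_def)
  have "((\<lambda>x. LINT t|lebesgue. N (fst x, snd x - t) * \<phi> t) has_derivative (\<lambda>h. LINT t|lebesgue. ?D x t h)) (at x)"
  proof (rule has_derivative_integral_dominated[where U = ?U and f' = ?D and B = "\<lambda>t. (C1 + C2) * (weight t * norm (\<phi> t))"])
    show "open ?U" by (intro open_Times) auto
    show "convex ?U" by (intro convex_Times) auto
    have "snd x \<in> {-M<..<M}" by (auto simp: M_def abs_less_iff)
    then show "x \<in> ?U" using al by (auto simp: be_def mem_Times_iff)
    show "((\<lambda>x. N (fst x, snd x - t) * \<phi> t) has_derivative ?D y t) (at y)" if "y \<in> ?U" for y t
    proof -
      have "(fst y, snd y - t) \<in> half_plane" using UH[OF that] by (auto simp: half_plane_def)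
      from der[OF this]
      have d: "(N has_derivative (\<lambda>h. of_real (fst h) * N1 (fst y, snd y - t) + of_real (snd h) * N2 (fst y, snd y - t)))
           (at (fst y, snd y - t))" .
      have s: "((\<lambda>x. (fst x, snd x - t)) has_derivative (\<lambda>h. (fst h, snd h))) (at y)"
        by (auto intro!: derivative_eq_intros)
      show ?thesis
        by (rule has_derivative_eq_rhs[OF has_derivative_mult_left[OF has_derivative_compose[OF s d]]])
          (auto simp: fun_eq_iff algebra_simps)
    qed
    show "integrable lebesgue (\<lambda>t. N (fst y, snd y - t) * \<phi> t)" if "y \<in> ?U" for y
      by (rule pot_integrable[OF N(1) UH[OF that]])
    show "(\<lambda>t. ?D x t h) \<in> borel_measurable lebesgue" for h
      using kclass_measurable[OF N(2) x] kclass_measurable[OF N(3) x]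
      by (intro borel_measurable_add borel_measurable_times[OF borel_measurable_const])
    show "norm (?D y t h) \<le> (C1 + C2) * (weight t * norm (\<phi> t)) * norm h" if "y \<in> ?U" for y t h
    proof -
      have b: "al \<le> fst y" "fst y \<le> be" "\<bar>snd y\<bar> \<le> M" using that by auto
      have n: "\<bar>fst h\<bar> \<le> norm h" "\<bar>snd h\<bar> \<le> norm h"
        using norm_fst_le[of "fst h" "snd h"] norm_snd_le[of "snd h" "fst h"] by auto
      have "norm (?D y t h) \<le> \<bar>fst h\<bar> * (norm (N1 (fst y, snd y - t)) * norm (\<phi> t))
          + \<bar>snd h\<bar> * (norm (N2 (fst y, snd y - t)) * norm (\<phi> t))"
        by (rule order_trans[OF norm_triangle_ineq]) (simp add: norm_mult)
      also have "\<dots> \<le> norm h * ((C1 * weight t) * norm (\<phi> t)) + norm h * ((C2 * weight t) * norm (\<phi> t))"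
        using n C1(2)[OF b] C2(2)[OF b] C1(1) C2(1) less_imp_le[OF weight_pos]
        by (intro add_mono mult_mono mult_nonneg_nonneg) auto
      finally show ?thesis by (simp add: algebra_simps)
    qed
    show "integrable lebesgue (\<lambda>t. (C1 + C2) * (weight t * norm (\<phi> t)))"
      using \<phi>_integrable by simp
    show "0 \<le> (C1 + C2) * (weight t * norm (\<phi> t))" for t
      using C1 C2 weight_pos[of t] by simp
  qed
  also have "(\<lambda>h. LINT t|lebesgue. ?D x t h) = (\<lambda>h. of_real (fst h) * pot N1 x + of_real (snd h) * pot N2 x)"
  proof
    fix h :: "real \<times> real"
    show "(LINT t|lebesgue. ?D x t h) = of_real (fst h) * pot N1 x + of_real (snd h) * pot N2 x"
      unfolding pot_def using pot_integrable[OF N(2) x] pot_integrable[OF N(3) x]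
      by (subst Bochner_Integration.integral_add) auto
  qed
  finally show ?thesis unfolding pot_def[abs_def] .
qed

lemma pot_frechet:
  assumes "N \<in> kclass" "N1 \<in> kclass" "N2 \<in> kclass"
    and "\<And>x. x \<in> half_plane \<Longrightarrow> (N has_derivative (\<lambda>h. of_real (fst h) * N1 x + of_real (snd h) * N2 x)) (at x)"
    and "x \<in> half_plane"
  shows "frechet_derivative (pot N) (at x) h = of_real (fst h) * pot N1 x + of_real (snd h) * pot N2 x"
  using frechet_derivative_at[OF pot_derivative[OF assms], symmetric] by simp

text \<open>The induction generalises over the kernel: a directional derivative of
  \<open>pot N\<close> agrees on the half plane with \<open>pot\<close> of another member of the
  class.\<close>

lemma pot_C_k: "N \<in> kclass \<Longrightarrow> C_k_on n (pot N) half_plane"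
proof (induction n arbitrary: N)
  case 0
  obtain N1 N2 where "N1 \<in> kclass" "N2 \<in> kclass"
     "\<And>x. x \<in> half_plane \<Longrightarrow> (N has_derivative (\<lambda>h. of_real (fst h) * N1 x + of_real (snd h) * N2 x)) (at x)"
    using kclass_derivative[OF 0] by blast
  from pot_derivative[OF 0 this] have "\<forall>x\<in>half_plane. isCont (pot N) x"
    using has_derivative_continuous by blast
  then show ?case
    by (simp add: continuous_at_imp_continuous_on)
next
  case (Suc n)
  obtain N1 N2 where N: "N1 \<in> kclass" "N2 \<in> kclass"
     "\<And>x. x \<in> half_plane \<Longrightarrow> (N has_derivative (\<lambda>h. of_real (fst h) * N1 x + of_real (snd h) * N2 x)) (at x)"
    using kclass_derivative[OF Suc.prems] by blast
  have "C_k_on n (\<lambda>x. frechet_derivative (pot N) (at x) v) half_plane" for v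
  proof -
    let ?P = "\<lambda>x. of_real (fst v) * N1 x + of_real (snd v) * N2 x"
    have "C_k_on n (pot ?P) half_plane"
      using N by (intro Suc.IH kclass.lin)
    moreover have "pot ?P x = frechet_derivative (pot N) (at x) v" if "x \<in> half_plane" for x
      using pot_lin[OF N(1,2) that] pot_frechet[OF Suc.prems N that] by simp
    ultimately show ?thesis
      by (subst C_k_on_cong[OF open_half_plane]) auto
  qed
  moreover have "\<forall>x\<in>half_plane. pot N differentiable at x"
    using pot_derivative[OF Suc.prems N] by (auto simp: differentiable_def)
  ultimately show ?case by simp
qed

lemma kernel_H_eq_gen:
  assumes "x1 > 0" shows "kernel_H k x1 x2 = gen 1 0 0 (x1, x2)"
proof -
  define r where "r = norm (x1, x2)"
  have r: "r = sqrt (x1\<^sup>2 + x2\<^sup>2)" "r > 0"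
    using assms by (auto simp: r_def norm_Pair add_pos_nonneg)
  then have r2: "x1\<^sup>2 + x2\<^sup>2 = r\<^sup>2" by simp
  have c: "csqrt (of_real (r\<^sup>2)) = of_real r"
    using r(2) by (subst csqrt_of_real_nonneg) auto
  have "kernel_H k x1 x2 = of_real (x1 / (pi * r\<^sup>2)) * macK (- \<i> * k * of_real r)"
    using kernel_H_eq_macK[OF Re_k Im_k, of x1 x2, folded r_def, OF r(2)] .
  also have "\<dots> = gen 1 0 0 (x1, x2)"
    unfolding gen_def fst_conv snd_conv r2 by (simp add: \<Phi>_def c del: of_real_power)
  finally show ?thesis .
qed

lemma potential_integrand_eq:
  "x \<in> half_plane \<Longrightarrow> potential_integrand k \<phi> x = (\<lambda>t. gen 1 0 0 (fst x, snd x - t) * \<phi> t)"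
  by (auto simp: potential_integrand_def fun_eq_iff kernel_H_eq_gen half_plane_def)

lemma potential_eq_pot: "x \<in> half_plane \<Longrightarrow> potential k \<phi> x = pot (gen 1 0 0) x"
  by (simp add: potential_def pot_def potential_integrand_eq)

lemma potential_integrable: "x \<in> half_plane \<Longrightarrow> integrable lebesgue (potential_integrand k \<phi> x)"
  using pot_integrable[OF kclass.gen] by (simp add: potential_integrand_eq)

lemma potential_smooth: "C_infinity_on (potential k \<phi>) half_plane"
  unfolding C_infinity_on_def
proof
  fix n
  have "C_k_on n (pot (gen 1 0 0)) half_plane"
    by (intro pot_C_k kclass.gen) simp
  then show "C_k_on n (potential k \<phi>) half_plane"
    by (subst C_k_on_cong[OF open_half_plane]) (auto simp: potential_eq_pot)
qed

lemma potential_helmholtz: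
  assumes x: "x \<in> half_plane"
  shows "laplacian (potential k \<phi>) x + k\<^sup>2 * potential k \<phi> x = 0"
proof -
  let ?G = "gen 1 0 0"
  \<comment> \<open>\<open>?N1\<close> and \<open>?N2\<close> are the first partial derivatives of
    \<open>?G\<close>; \<open>?A\<close>, \<open>?B\<close>, \<open>?E\<close> are the second ones,
    pure in \<open>x1\<close>, mixed and pure in \<open>x2\<close>. The null term in
    \<open>?N2\<close> gives it the two-term shape of \<open>kclass.lin\<close>.\<close>
  let ?N1 = "\<lambda>x. of_nat 1 * gen 0 0 0 x + 2 * gen 2 0 1 x"
  let ?N2 = "\<lambda>x. 2 * gen 1 1 1 x + 0 * gen 1 1 1 x"
  let ?A = "\<lambda>x. 6 * gen 1 0 1 x + 4 * gen 3 0 2 x"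
  let ?B = "\<lambda>x. 2 * gen 0 1 1 x + 4 * gen 2 1 2 x"
  let ?E = "\<lambda>x. 2 * gen 1 0 1 x + 4 * gen 1 2 2 x"
  have k1: "?N1 \<in> kclass" "?N2 \<in> kclass" "?A \<in> kclass" "?B \<in> kclass" "?E \<in> kclass" "?G \<in> kclass"
    by (intro kclass.intros; simp)+
  have d0: "(?G has_derivative (\<lambda>h. of_real (fst h) * ?N1 x + of_real (snd h) * ?N2 x)) (at x)"
    if "x \<in> half_plane" for x
    using gen_derivative[OF that, of 1 0 0] by (simp add: numeral_2_eq_2)
  have d1: "(?N1 has_derivative (\<lambda>h. of_real (fst h) * ?A x + of_real (snd h) * ?B x)) (at x)"
    if "x \<in> half_plane" for x
    by (rule has_derivative_eq_rhs[OF has_derivative_add[OF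
         has_derivative_mult_right[OF gen_derivative[OF that, of 0 0 0]]
         has_derivative_mult_right[OF gen_derivative[OF that, of 2 0 1]]]])
      (auto simp: fun_eq_iff algebra_simps numeral_eq_Suc)
  have d2: "(?N2 has_derivative (\<lambda>h. of_real (fst h) * ?B x + of_real (snd h) * ?E x)) (at x)"
    if "x \<in> half_plane" for x
    by (rule has_derivative_eq_rhs[OF has_derivative_add[OF
         has_derivative_mult_right[OF gen_derivative[OF that, of 1 1 1]]
         has_derivative_mult_right[OF gen_derivative[OF that, of 1 1 1]]]])
      (auto simp: fun_eq_iff algebra_simps numeral_eq_Suc)
  have f0: "frechet_derivative (potential k \<phi>) (at y) h = of_real (fst h) * pot ?N1 y + of_real (snd h) * pot ?N2 y"
    if "y \<in> half_plane" for y h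
  proof -
    have "(potential k \<phi> has_derivative (\<lambda>h. of_real (fst h) * pot ?N1 y + of_real (snd h) * pot ?N2 y)) (at y)"
      by (rule has_derivative_transform_within_open[OF pot_derivative[OF k1(6,1,2) d0 that] open_half_plane that])
        (auto simp: potential_eq_pot)
    from frechet_derivative_at[OF this, symmetric] show ?thesis by simp
  qed
  have fr: "frechet_derivative (\<lambda>y. frechet_derivative (potential k \<phi>) (at y) b) (at x) b = Q"
    if "(pot N has_derivative D) (at x)" "D b = Q" "\<And>y. y \<in> half_plane \<Longrightarrow> frechet_derivative (potential k \<phi>) (at y) b = pot N y"
    for b N D Q
  proof -
    have "((\<lambda>y. frechet_derivative (potential k \<phi>) (at y) b) has_derivative D) (at x)"
      by (rule has_derivative_transform_within_open[OF that(1) open_half_plane x]) (simp add: that(3))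
    from frechet_derivative_at[OF this, symmetric] show ?thesis using that(2) by simp
  qed
  have "frechet_derivative (\<lambda>y. frechet_derivative (potential k \<phi>) (at y) (1, 0)) (at x) (1, 0) = pot ?A x"
    by (rule fr[OF pot_derivative[OF k1(1,3,4) d1 x]]) (simp_all add: f0)
  moreover have "frechet_derivative (\<lambda>y. frechet_derivative (potential k \<phi>) (at y) (0, 1)) (at x) (0, 1) = pot ?E x"
    by (rule fr[OF pot_derivative[OF k1(2,4,5) d2 x]]) (simp_all add: f0)
  moreover have "laplacian (potential k \<phi>) x
     = frechet_derivative (\<lambda>y. frechet_derivative (potential k \<phi>) (at y) (1, 0)) (at x) (1, 0)
     + frechet_derivative (\<lambda>y. frechet_derivative (potential k \<phi>) (at y) (0, 1)) (at x) (0, 1)"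
  proof -
    have B: "(Basis :: (real \<times> real) set) = {(1, 0), (0, 1)}"
      by (auto simp: Basis_prod_def)
    show ?thesis unfolding laplacian_def B by simp
  qed
  ultimately have "laplacian (potential k \<phi>) x + k\<^sup>2 * potential k \<phi> x
      = 1 * (1 * pot ?A x + 1 * pot ?E x) + k\<^sup>2 * pot ?G x"
    by (simp add: potential_eq_pot[OF x])
  also have "\<dots> = pot (\<lambda>x. 1 * (1 * ?A x + 1 * ?E x) + k\<^sup>2 * ?G x) x"
    using k1 x by (simp only: pot_lin kclass.lin)
  also have "\<dots> = (LINT t|(lebesgue :: real measure). 0)"
    unfolding pot_def
  proof (rule Bochner_Integration.integral_cong[OF refl])
    fix t :: real
    define a where "a = fst x" define b where "b = snd x - t"
    have a: "a > 0" using x by (auto simp: a_def half_plane_def)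
    let ?s = "complex_of_real (a\<^sup>2 + b\<^sup>2)"
    have "Re ?s > 0" using a by (simp add: add_pos_nonneg)
    \<comment> \<open>Multiplied by \<open>a\<close>, the equation of the profile becomes the
      Helmholtz equation of the kernel: the coefficient 8 is \<open>6 + 2\<close>, and
      \<open>4 * (a^2 + b^2)\<close> joins the two second order terms.\<close>
    from \<Phi>_ode[OF this]
    have "of_real a * (4 * ?s * \<Phi>D 2 ?s + 8 * \<Phi>D 1 ?s + k\<^sup>2 * \<Phi>D 0 ?s) = 0" by simp
    also have "of_real a * (4 * ?s * \<Phi>D 2 ?s + 8 * \<Phi>D 1 ?s + k\<^sup>2 * \<Phi>D 0 ?s)
       = 1 * (1 * ?A (a, b) + 1 * ?E (a, b)) + k\<^sup>2 * ?G (a, b)"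
      unfolding gen_def fst_conv snd_conv
      by (simp add: algebra_simps power2_eq_square power3_eq_cube)
    finally show "(1 * (1 * ?A (fst x, snd x - t) + 1 * ?E (fst x, snd x - t)) + k\<^sup>2 * ?G (fst x, snd x - t)) * \<phi> t = 0"
      by (simp add: a_def b_def)
  qed
  finally show ?thesis by simp
qed

end

section \<open>Boundary values\<close>

definition pois :: "real \<Rightarrow> real \<Rightarrow> real" where
  "pois x1 t = x1 / (pi * (x1\<^sup>2 + t\<^sup>2))"

lemma pois_nonneg: "x1 > 0 \<Longrightarrow> pois x1 t \<ge> 0"
  by (simp add: pois_def add_nonneg_nonneg)

lemma pois_integral:
  assumes x: "x1 > 0"
  shows "integrable lborel (pois x1)" "(\<integral>t. pois x1 t \<partial>lborel) = 1"
proof -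
  let ?F = "\<lambda>t. arctan (t / x1) / pi"
  have pos: "x1\<^sup>2 + t\<^sup>2 > 0" for t using x by (simp add: add_pos_nonneg)
  have d: "(?F has_real_derivative pois x1 t) (at t)" for t
  proof -
    have "(?F has_real_derivative inverse (1 + (t / x1)\<^sup>2) * (1 / x1) / pi) (at t)"
      using x by (auto intro!: derivative_eq_intros)
    moreover have "inverse (1 + (t / x1)\<^sup>2) * (1 / x1) / pi = pois x1 t"
    proof -
      have "1 + (t / x1)\<^sup>2 = (x1\<^sup>2 + t\<^sup>2) / x1\<^sup>2"
        using x by (simp add: power_divide add_divide_distrib)
      then show ?thesis using x pos[of t] by (simp add: pois_def power2_eq_square)
    qed
    ultimately show ?thesis by simp
  qed
  have c: "isCont (pois x1) t" for t
    unfolding pois_def[abs_def] using pos[of t] by (intro continuous_intros) auto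
  have lt: "(?F \<longlongrightarrow> (pi / 2) / pi) at_top"
  proof -
    have "filterlim (\<lambda>t. t / x1) at_top at_top"
      using x by real_asymp
    from filterlim_compose[OF tendsto_arctan_at_top this] show ?thesis
      by (intro tendsto_divide tendsto_const) auto
  qed
  have lb: "(?F \<longlongrightarrow> (- (pi / 2)) / pi) at_bot"
  proof -
    have "filterlim (\<lambda>t. t / x1) at_bot at_bot"
      using x by real_asymp
    from filterlim_compose[OF tendsto_arctan_at_bot this] show ?thesis
      by (intro tendsto_divide tendsto_const) auto
  qed
  have "set_integrable lborel (einterval (-\<infinity>) \<infinity>) (pois x1)"
    and "(LBINT t=-\<infinity>..\<infinity>. pois x1 t) = (pi / 2) / pi - (- (pi / 2)) / pi"
    by (rule interval_integral_FTC_nonneg[where F = ?F];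
        use d c lt lb pois_nonneg[OF x] in \<open>auto simp: ereal_tendsto_simps\<close>)+
  then show "integrable lborel (pois x1)" "(\<integral>t. pois x1 t \<partial>lborel) = 1"
    by (simp_all add: set_integrable_def interval_lebesgue_integral_def set_lebesgue_integral_def)
qed

section \<open>Integrability of the weight and of weighted densities\<close>

lemma weight_integrable: "integrable lborel weight"
proof -
  let ?h = "\<lambda>t::real. (1 + \<bar>t\<bar>) powr (-3/2)"
  let ?g = "\<lambda>t::real. (1 + t) powr (-3/2)"
  have "(\<integral>\<^sup>+t. ennreal (?g t) * indicator {0..} t \<partial>lborel) = ennreal (0 - (- 2 * (1 + 0) powr (-1/2)))"
  proof (rule nn_integral_FTC_atLeast)
    show "?g \<in> borel_measurable borel" by measurable
    show "((\<lambda>t. - 2 * (1 + t) powr (-1/2)) has_real_derivative ?g t) (at t)" if "0 \<le> t" for t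
      using that by (auto intro!: derivative_eq_intros)
    show "((\<lambda>t::real. - 2 * (1 + t) powr (-1/2)) \<longlongrightarrow> 0) at_top" by real_asymp
  qed auto
  also have "(\<lambda>t. ennreal (?g t) * indicator {0..} t) = (\<lambda>t. ennreal (indicator {0..} t *\<^sub>R ?h t))"
    by (auto simp: fun_eq_iff split: split_indicator)
  finally have "(\<integral>\<^sup>+t. ennreal (indicator {0..} t *\<^sub>R ?h t) \<partial>lborel) < \<infinity>"
    by simp
  then have "integrable lborel (\<lambda>t. indicator {0..} t *\<^sub>R ?h t)"
    by (intro integrableI_nonneg) auto
  then have "has_bochner_integral lborel (\<lambda>t. indicator {0..} t *\<^sub>R ?h t) (\<integral>t. indicator {0..} t *\<^sub>R ?h t \<partial>lborel)"
    by (rule has_bochner_integral_integrable)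
  from has_bochner_integral_even_function[OF this]
  have "integrable lborel ?h" by (auto dest: integrable.intros)
  then have "integrable lborel (\<lambda>t. (1/2) powr (-3/4) * ?h t)" by simp
  then show ?thesis
  proof (rule Bochner_Integration.integrable_bound)
    show "weight \<in> borel_measurable lborel"
      unfolding weight_def[abs_def] by measurable
    show "AE t in lborel. norm (weight t) \<le> norm ((1/2) powr (-3/4) * ?h t)"
    proof (rule AE_I2)
      fix t :: real
      \<comment> \<open>This inequality compares the weight with
        \<open>(1 + |t|) powr (-3/2)\<close>, whose primitive is explicit.\<close>
      have "(1/2) * (1 + \<bar>t\<bar>)\<^sup>2 \<le> 1 + t\<^sup>2"
        using zero_le_power2[of "1 - \<bar>t\<bar>"] by (simp add: power2_eq_square algebra_simps abs_mult_self_eq)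
      then have "weight t \<le> ((1/2) * (1 + \<bar>t\<bar>)\<^sup>2) powr (-3/4)"
        unfolding weight_def by (intro powr_mono2') auto
      also have "\<dots> = (1/2) powr (-3/4) * ((1 + \<bar>t\<bar>)\<^sup>2) powr (-3/4)"
        by (rule powr_mult)
      also have "((1 + \<bar>t\<bar>)\<^sup>2) powr (-3/4) = ?h t"
      proof -
        have "(1 + \<bar>t\<bar>)\<^sup>2 = (1 + \<bar>t\<bar>) powr 2" by simp
        then show ?thesis by (simp only: powr_powr) simp
      qed
      finally show "norm (weight t) \<le> norm ((1/2) powr (-3/4) * ?h t)"
        using weight_pos[of t] by simp
    qed
  qed
qed

lemma weight_integral_nonneg: "0 \<le> (LINT t|lborel. weight t)"
  using weight_pos by (intro integral_nonneg_AE AE_I2 less_imp_le)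

lemma weight_le_1: "weight t \<le> 1"
proof -
  have "weight t \<le> 1 powr (-3/4)"
    unfolding weight_def by (intro powr_mono2') auto
  then show ?thesis by simp
qed

lemma inverse_square_le_weight: "1 / (1 + t\<^sup>2) \<le> weight t"
proof -
  have "1 / (1 + t\<^sup>2) = (1 + t\<^sup>2) powr (-1)"
    by (simp add: powr_minus_divide add_nonneg_nonneg)
  also have "\<dots> \<le> (1 + t\<^sup>2) powr (-3/4)"
    by (intro powr_mono) auto
  finally show ?thesis by (simp add: weight_def)
qed

lemma weight_lebesgue: "integrable lebesgue weight" "weight \<in> borel_measurable lebesgue"
proof -
  have m: "weight \<in> borel_measurable lborel"
    unfolding weight_def[abs_def] by measurable
  then show "weight \<in> borel_measurable lebesgue" by (rule measurable_completion)
  show "integrable lebesgue weight"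
    using weight_integrable m by (simp add: integrable_completion)
qed

lemma weight_L2_plus_Linf:
  assumes "\<phi> \<in> L2_plus_Linf (lebesgue :: real measure)"
  shows "\<phi> \<in> borel_measurable lebesgue" "integrable lebesgue (\<lambda>t. weight t * norm (\<phi> t))"
proof -
  obtain f g B where f: "f \<in> borel_measurable lebesgue" "integrable lebesgue (\<lambda>x. (norm (f x))\<^sup>2)"
    and g: "g \<in> borel_measurable lebesgue" "AE x in lebesgue. norm (g x) \<le> B"
    and \<phi>: "\<phi> = (\<lambda>x. f x + g x)"
    using assms by (auto simp: L2_plus_Linf_def L2_space_def Linf_space_def)
  show m: "\<phi> \<in> borel_measurable lebesgue"
    unfolding \<phi> using f g by (intro borel_measurable_add)
  show "integrable lebesgue (\<lambda>t. weight t * norm (\<phi> t))"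
  proof (rule Bochner_Integration.integrable_bound)
    show "integrable lebesgue (\<lambda>t. (weight t + (norm (f t))\<^sup>2) + \<bar>B\<bar> * weight t)"
      using f weight_lebesgue by simp
    show "(\<lambda>t. weight t * norm (\<phi> t)) \<in> borel_measurable lebesgue"
      using m weight_lebesgue(2) by measurable
    show "AE t in lebesgue. norm (weight t * norm (\<phi> t)) \<le> norm ((weight t + (norm (f t))\<^sup>2) + \<bar>B\<bar> * weight t)"
      using g(2)
    proof eventually_elim
      case (elim t)
      note w = weight_pos[of t] weight_le_1[of t]
      have "norm (\<phi> t) \<le> norm (f t) + \<bar>B\<bar>"
        unfolding \<phi> using norm_triangle_ineq[of "f t" "g t"] elim by linarith
      then have "weight t * norm (\<phi> t) \<le> weight t * norm (f t) + \<bar>B\<bar> * weight t"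
        using mult_left_mono[of "norm (\<phi> t)" "norm (f t) + \<bar>B\<bar>" "weight t"] w by (simp add: algebra_simps)
      \<comment> \<open>A pointwise stand-in for Cauchy-Schwarz: where
        \<open>norm (f t) \<le> 1\<close> the product is at most \<open>weight t\<close>, elsewhere
        it is at most \<open>(norm (f t))^2\<close>.\<close>
      moreover have "weight t * norm (f t) \<le> weight t + (norm (f t))\<^sup>2"
      proof (cases "norm (f t) \<le> 1")
        case True
        then have "weight t * norm (f t) \<le> weight t * 1" using w by (intro mult_left_mono) auto
        then show ?thesis using zero_le_power2[of "norm (f t)"] by linarith
      next
        case False
        then have "1 * norm (f t) \<le> norm (f t) * norm (f t)" by (intro mult_right_mono) auto
        moreover have "weight t * norm (f t) \<le> 1 * norm (f t)" using w by (intro mult_right_mono) auto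
        ultimately show ?thesis using w by (simp add: power2_eq_square)
      qed
      ultimately show ?case
        using w by (simp add: abs_mult)
    qed
  qed
qed

context wave_number
begin

text \<open>The factor by which the kernel differs from the Poisson kernel.\<close>

definition \<mu> :: "real \<Rightarrow> complex" where
  "\<mu> r = macK (- \<i> * k * of_real r)"

lemma wedge_real: "r > 0 \<Longrightarrow> - \<i> * k * of_real r \<in> wedge"
  using csqrt_in_wedge[of "of_real (r\<^sup>2)"] by (simp add: csqrt_of_real_nonneg del: of_real_power)

lemma gen_eq_pois:
  assumes "x1 > 0"
  shows "gen 1 0 0 (x1, x2) = of_real (pois x1 x2) * \<mu> (sqrt (x1\<^sup>2 + x2\<^sup>2))"
proof -
  define r where "r = sqrt (x1\<^sup>2 + x2\<^sup>2)"
  have r: "r > 0"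
    unfolding r_def using assms by (simp add: add_pos_nonneg)
  have r2: "x1\<^sup>2 + x2\<^sup>2 = r\<^sup>2" by (simp add: r_def)
  have c: "csqrt (of_real (r\<^sup>2)) = of_real r"
    using r by (subst csqrt_of_real_nonneg) auto
  show ?thesis
    unfolding r_def[symmetric] gen_def fst_conv snd_conv r2
    using abs_of_pos[OF r] by (simp add: \<Phi>_def c \<mu>_def pois_def r2 del: of_real_power)
qed

lemma \<mu>_tendsto: "(\<mu> \<longlongrightarrow> 1) (at_right 0)"
proof -
  have "filterlim (\<lambda>r. - \<i> * k * complex_of_real r) (at 0 within wedge) (at_right 0)"
    unfolding filterlim_at
  proof
    have "((\<lambda>r. - \<i> * k * complex_of_real r) \<longlongrightarrow> - \<i> * k * of_real 0) (at_right 0)"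
      by (intro tendsto_intros)
    then show "((\<lambda>r. - \<i> * k * complex_of_real r) \<longlongrightarrow> 0) (at_right 0)" by simp
    show "\<forall>\<^sub>F r in at_right 0. - \<i> * k * complex_of_real r \<in> wedge \<and> - \<i> * k * complex_of_real r \<noteq> 0"
      unfolding eventually_at_right_field
      using wedge_real wedge_nonzero[OF wedge_real] by (intro exI[of _ 1]) auto
  qed
  from filterlim_compose[OF macK_tendsto_1 this] show ?thesis
    by (simp add: \<mu>_def[abs_def])
qed

lemma \<mu>_bound: "\<exists>C>0. \<forall>r>0. norm (\<mu> r) \<le> C * (exp (- Im k * r) * (1 + sqrt r))"
proof -
  obtain C where C: "C > 0" "\<And>w. w \<in> wedge \<Longrightarrow> norm (macK w) \<le> C * (exp (- Re w) * (1 + sqrt (norm w)))"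
    using macK_bound by blast
  show ?thesis
  proof (intro exI[of _ "C * (1 + sqrt (norm k))"] conjI allI impI)
    show "0 < C * (1 + sqrt (norm k))" using C(1) by (intro mult_pos_pos add_pos_nonneg) auto
    fix r :: real assume r: "r > 0"
    have "norm (\<mu> r) \<le> C * (exp (- (Im k * r)) * (1 + sqrt (norm k * r)))"
      using C(2)[OF wedge_real[OF r]] r by (simp add: \<mu>_def norm_mult)
    also have "1 + sqrt (norm k * r) \<le> (1 + sqrt (norm k)) * (1 + sqrt r)"
      using r by (simp add: real_sqrt_mult algebra_simps)
    then have "C * (exp (- (Im k * r)) * (1 + sqrt (norm k * r)))
        \<le> C * (exp (- (Im k * r)) * ((1 + sqrt (norm k)) * (1 + sqrt r)))"
      using C(1) by (intro mult_left_mono) auto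
    finally show "norm (\<mu> r) \<le> C * (1 + sqrt (norm k)) * (exp (- Im k * r) * (1 + sqrt r))"
      by (simp add: mult_ac)
  qed
qed

text \<open>For \<open>r \<le> 1\<close> the factor \<open>1 + sqrt r\<close> is at most 2; for
  \<open>r > 1\<close> the product is of order \<open>x1 r^(-3/2)\<close>, hence controlled by
  \<open>x1 * weight x2\<close>. Keeping the Poisson part separate makes the integral over each line
  stay bounded as \<open>x1\<close> tends to 0.\<close>

lemma kernel_bound:
  "\<exists>C>0. \<forall>x1>0. \<forall>x2. norm (gen 1 0 0 (x1, x2)) \<le> C * (exp (- Im k * x1) * (pois x1 x2 + x1 * weight x2))"
proof -
  obtain C where C: "C > 0" "\<And>r. r > 0 \<Longrightarrow> norm (\<mu> r) \<le> C * (exp (- Im k * r) * (1 + sqrt r))"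
    using \<mu>_bound by blast
  \<comment> \<open>The 2 serves the case \<open>r \<le> 1\<close>; the other summand is twice the
    constant of \<open>inverse_rsqrt_le_weight\<close> for \<open>c = 1/2\<close>.\<close>
  define K :: real where "K = 2 + 2 * (1/2) powr (-3/4)"
  have K: "K > 0" by (simp add: K_def add_pos_nonneg)
  show ?thesis
  proof (intro exI[of _ "C * K"] conjI allI impI)
    show "C * K > 0" using C K by simp
    fix x1 x2 :: real assume x1: "x1 > 0"
    define r where "r = sqrt (x1\<^sup>2 + x2\<^sup>2)"
    have r2: "r\<^sup>2 = x1\<^sup>2 + x2\<^sup>2" by (simp add: r_def)
    have xr: "x1 \<le> r" unfolding r_def by (rule real_le_rsqrt) simp
    then have r: "r > 0" using x1 by simp
    have p: "pois x1 x2 = x1 / (pi * r\<^sup>2)" by (simp add: pois_def r2)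
    have p0: "pois x1 x2 \<ge> 0" by (rule pois_nonneg[OF x1])
    have w0: "0 \<le> x1 * weight x2" using x1 weight_pos[of x2] by simp
    have q0: "0 \<le> (1/2::real) powr (-3/4)" by simp
    have main: "pois x1 x2 * (1 + sqrt r) \<le> K * (pois x1 x2 + x1 * weight x2)"
    proof (cases "r \<le> 1")
      case True
      then have "pois x1 x2 * (1 + sqrt r) \<le> pois x1 x2 * 2"
        using p0 by (intro mult_left_mono) auto
      also have "\<dots> \<le> K * (pois x1 x2 + x1 * weight x2)"
        unfolding K_def distrib_left distrib_right using p0 w0 q0
          mult_nonneg_nonneg[OF q0 p0] mult_nonneg_nonneg[OF q0 w0] by linarith
      finally show ?thesis .
    next
      case False
      then have "1 + sqrt r \<le> 2 * sqrt r" by simp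
      then have "pois x1 x2 * (1 + sqrt r) \<le> pois x1 x2 * (2 * sqrt r)"
        using p0 by (rule mult_left_mono)
      also have "\<dots> = (1 / pi) * (2 * (x1 * (1 / (r * sqrt r))))"
      proof -
        have e: "1 / (r * sqrt r) = sqrt r / r\<^sup>2"
        proof -
          have "sqrt r * (r * sqrt r) = r\<^sup>2"
            using r by (simp add: power2_eq_square mult.left_commute)
          then show ?thesis using r by (simp add: frac_eq_eq)
        qed
        show ?thesis unfolding p e by simp
      qed
      also have "\<dots> \<le> 1 * (2 * (x1 * ((1/2) powr (-3/4) * weight x2)))"
      proof -
        have "1 \<le> r\<^sup>2" using False by (simp add: one_le_power)
        moreover have "x2\<^sup>2 \<le> r\<^sup>2" unfolding r2 by simp
        ultimately have "1/2 * (1 + x2\<^sup>2) \<le> r\<^sup>2" by simp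
        then have "1 / (r * sqrt r) \<le> (1/2) powr (-3/4) * weight x2"
          using r by (intro inverse_rsqrt_le_weight) auto
        then show ?thesis
          using x1 r pi_gt3 by (intro mult_mono mult_left_mono mult_nonneg_nonneg) auto
      qed
      also have "\<dots> \<le> K * (pois x1 x2 + x1 * weight x2)"
        unfolding K_def using p0 w0 mult_nonneg_nonneg[OF q0 p0] mult_nonneg_nonneg[OF q0 w0]
        by (simp add: algebra_simps)
      finally show ?thesis .
    qed
    have "norm (gen 1 0 0 (x1, x2)) = pois x1 x2 * norm (\<mu> r)"
      using gen_eq_pois[OF x1, of x2] p0 by (simp add: r_def norm_mult)
    also have "\<dots> \<le> pois x1 x2 * (C * (exp (- Im k * r) * (1 + sqrt r)))"
      using C(2)[OF r] p0 by (rule mult_left_mono)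
    also have "\<dots> = C * (exp (- Im k * r) * (pois x1 x2 * (1 + sqrt r)))" by (simp add: mult_ac)
    also have "\<dots> \<le> C * (exp (- Im k * x1) * (K * (pois x1 x2 + x1 * weight x2)))"
    proof -
      have "Im k * x1 \<le> Im k * r" using xr Im_k by (rule mult_left_mono)
      then have "exp (- Im k * r) \<le> exp (- Im k * x1)" by simp
      then show ?thesis
        using main C(1) p0 r by (intro mult_left_mono[OF mult_mono[OF _ main]] mult_nonneg_nonneg) auto
    qed
    finally show "norm (gen 1 0 0 (x1, x2)) \<le> C * K * (exp (- Im k * x1) * (pois x1 x2 + x1 * weight x2))"
      by (simp add: mult_ac)
  qed
qed

end

context weighted_density
begin

text \<open>
  Since the Poisson kernel has unit mass, the error is the integral of its product with
  \<open>\<mu> r * \<phi> t - \<phi> t0\<close>: small near \<open>t0\<close>, while far from \<open>t0\<close> the kernel is \<open>O(x1)\<close> times the weight.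
\<close>

lemma pot_boundary_limit:
  assumes I: "open I" "t0 \<in> I" "continuous_on I \<phi>"
  shows "(pot (gen 1 0 0) \<longlongrightarrow> \<phi> t0) (at (0, t0) within half_plane)"
proof (rule tendstoI)
  fix \<epsilon> :: real assume \<epsilon>: "\<epsilon> > 0"
  let ?N = "gen 1 0 0"
  \<comment> \<open>Near \<open>t0\<close> the error factor is at most
    \<open>\<eta> * (2 + norm (\<phi> t0))\<close>, where \<open>\<eta> \<le> 1\<close> ensures
    \<open>norm (\<mu> r) \<le> 2\<close>; the definition makes this at most
    \<open>\<epsilon> / 2\<close>.\<close>
  define \<eta> where "\<eta> = min 1 (\<epsilon> / (2 * (2 + norm (\<phi> t0))))"
  have den: "2 * (2 + norm (\<phi> t0)) > 0" by (simp add: add_pos_nonneg)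
  have \<eta>: "\<eta> > 0" "\<eta> \<le> 1" "\<eta> * (2 + norm (\<phi> t0)) \<le> \<epsilon> / 2"
  proof -
    show "\<eta> > 0" "\<eta> \<le> 1" using \<epsilon> den by (auto simp: \<eta>_def)
    have "\<eta> \<le> \<epsilon> / (2 * (2 + norm (\<phi> t0)))" by (simp add: \<eta>_def)
    then have "\<eta> * (2 * (2 + norm (\<phi> t0))) \<le> \<epsilon>" using den by (simp only: le_divide_eq if_True)
    then show "\<eta> * (2 + norm (\<phi> t0)) \<le> \<epsilon> / 2" by (simp add: algebra_simps)
  qed
  have "\<forall>\<^sub>F r in at_right 0. dist (\<mu> r) 1 < \<eta>"
    using \<mu>_tendsto \<eta>(1) by (rule tendstoD)
  then obtain d0 where d0: "d0 > 0" "\<And>r. 0 < r \<Longrightarrow> r < d0 \<Longrightarrow> norm (\<mu> r - 1) < \<eta>"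
    unfolding eventually_at_right_field dist_norm by blast
  have "isCont \<phi> t0" using I by (simp add: continuous_on_eq_continuous_at)
  then obtain d1 where d1: "d1 > 0" "\<And>t. norm (t - t0) < d1 \<Longrightarrow> norm (\<phi> t - \<phi> t0) < \<eta>"
    using \<eta>(1) unfolding continuous_at_eps_delta dist_norm by metis
  \<comment> \<open>With both coordinates of \<open>x\<close> within \<open>\<delta> / 2\<close> of
    the boundary point and \<open>t\<close> within \<open>\<delta>\<close> of \<open>t0\<close>, the
    distance \<open>r\<close> is below \<open>2 * \<delta> \<le> d0\<close>. The bound
    \<open>\<delta> \<le> 1\<close> keeps \<open>\<bar>x2\<bar>\<close> below
    \<open>M\<close>.\<close>
  define \<delta> where "\<delta> = min (min d1 (d0 / 2)) 1"
  have \<delta>: "\<delta> > 0" "\<delta> \<le> d1" "2 * \<delta> \<le> d0" "\<delta> \<le> 1" using d0 d1 by (auto simp: \<delta>_def)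
  obtain C where C: "C > 0" "\<And>x1 x2. x1 > 0 \<Longrightarrow> norm (?N (x1, x2)) \<le> C * (exp (- Im k * x1) * (pois x1 x2 + x1 * weight x2))"
    using kernel_bound by blast
  define M where "M = \<bar>t0\<bar> + 1"
  define W where "W = (2 + 2 * M\<^sup>2) powr (3/4)"
  \<comment> \<open>Far from \<open>t0\<close> one has
    \<open>(x2 - t)^2 \<ge> \<delta>^2 / 4\<close>, so
    \<open>c * (1 + (x2 - t)^2) \<le> 2 * (x2 - t)^2\<close>; hence the Poisson kernel is at most
    \<open>x1\<close> times \<open>Q = 2 / c\<close> times the weight.\<close>
  define c where "c = min 1 (\<delta>\<^sup>2 / 4)"
  have c: "c > 0" "c \<le> 1" "2 * c \<le> \<delta>\<^sup>2 / 2" using \<delta> by (auto simp: c_def)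
  define Q where "Q = 2 / c"
  have Q: "Q > 0" using c by (simp add: Q_def)
  define D where "D = (C * (Q + 1) + Q) * W"
  have W: "W \<ge> 0" by (simp add: W_def)
  have D: "D \<ge> 0" using C Q W by (simp add: D_def)
  let ?R = "\<lambda>t. weight t * norm (\<phi> t) + weight t * norm (\<phi> t0)"
  have Rint: "integrable lebesgue ?R"
    using \<phi>_integrable weight_lebesgue(1) by simp
  define A where "A = (LINT t|lebesgue. ?R t)"
  have A: "A \<ge> 0" unfolding A_def
    by (rule integral_nonneg_AE) (auto intro!: AE_I2 add_nonneg_nonneg mult_nonneg_nonneg simp: less_imp_le[OF weight_pos])
  \<comment> \<open>The second entry makes the far contribution \<open>x1 * (D * A)\<close> at most
    \<open>\<epsilon> / 4\<close>; the added 1 keeps the denominator positive.\<close>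
  define \<delta>' where "\<delta>' = min (\<delta> / 2) (\<epsilon> / (4 * (D * A + 1)))"
  have DA: "D * A + 1 > 0" using D A by (simp add: add_nonneg_pos)
  have \<delta>': "\<delta>' > 0" using \<delta>(1) \<epsilon> DA by (simp add: \<delta>'_def)
  have main: "dist (pot ?N x) (\<phi> t0) < \<epsilon>" if x: "x \<in> half_plane" "dist x (0, t0) < \<delta>'" for x
  proof -
    define x1 where "x1 = fst x"
    define x2 where "x2 = snd x"
    have x1: "x1 > 0" using x(1) by (auto simp: x1_def half_plane_def)
    have ds: "\<bar>x1\<bar> < \<delta>'" "\<bar>x2 - t0\<bar> < \<delta>'"
      using x(2) dist_fst_le[of x "(0, t0)"] dist_snd_le[of x "(0, t0)"]
      by (auto simp: x1_def x2_def dist_real_def)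
    have x1b: "x1 < \<delta> / 2" "\<bar>x2 - t0\<bar> < \<delta> / 2" "x1 < \<epsilon> / (4 * (D * A + 1))"
      using ds x1 by (auto simp: \<delta>'_def)
    have x2M: "\<bar>x2\<bar> \<le> M" using x1b(2) \<delta>(4) abs_triangle_ineq[of t0 "x2 - t0"] by (simp add: M_def)
    let ?p = "\<lambda>t. pois x1 (x2 - t)"
    have pint: "integrable lborel ?p" "(\<integral>t. ?p t \<partial>lborel) = 1"
    proof -
      show "integrable lborel ?p"
        using lborel_integrable_real_affine[OF pois_integral(1)[OF x1], of "-1" x2] by simp
      show "(\<integral>t. ?p t \<partial>lborel) = 1"
        using lborel_integral_real_affine[of "-1" "pois x1" x2] pois_integral(2)[OF x1] by simp
    qed
    have pm: "?p \<in> borel_measurable lborel" by (rule borel_measurable_integrable[OF pint(1)])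
    have pl: "integrable lebesgue ?p" "(LINT t|lebesgue. ?p t) = 1"
      using pint pm by (simp_all add: integrable_completion integral_completion)
    have pw: "norm (?N (x1, x2 - t) * \<phi> t - of_real (?p t) * \<phi> t0) \<le> \<epsilon> / 2 * ?p t + x1 * (D * ?R t)" for t
    proof -
      have p0: "?p t \<ge> 0" by (rule pois_nonneg[OF x1])
      have R0: "?R t \<ge> 0" using weight_pos[of t] by (intro add_nonneg_nonneg mult_nonneg_nonneg) auto
      show ?thesis
      proof (cases "\<bar>t - t0\<bar> < \<delta>")
        case True
        define r where "r = sqrt (x1\<^sup>2 + (x2 - t)\<^sup>2)"
        have "x1\<^sup>2 + (x2 - t)\<^sup>2 > 0" using x1 by (simp add: add_pos_nonneg)
        then have r0: "r > 0" by (simp add: r_def)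
        have "r \<le> \<bar>x1\<bar> + \<bar>x2 - t\<bar>" unfolding r_def by (rule sqrt_sum_squares_le_sum_abs)
        also have "\<dots> < 2 * \<delta>"
        proof -
          have "\<bar>x2 - t\<bar> \<le> \<bar>x2 - t0\<bar> + \<bar>t - t0\<bar>" by linarith
          then show ?thesis using x1b(1,2) True x1 by linarith
        qed
        finally have rd: "norm (\<mu> r - 1) < \<eta>" using \<delta>(3) r0 by (intro d0) auto
        have fd: "norm (\<phi> t - \<phi> t0) < \<eta>" using True \<delta>(2) by (intro d1) auto
        have "norm (\<mu> r) \<le> 2"
          using norm_triangle_sub[of "\<mu> r" 1] rd \<eta>(2) by simp
        then have "norm (\<mu> r * (\<phi> t - \<phi> t0) + (\<mu> r - 1) * \<phi> t0) \<le> 2 * \<eta> + \<eta> * norm (\<phi> t0)"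
          using rd fd \<eta>(1) by (intro order_trans[OF norm_triangle_ineq] add_mono)
            (auto simp: norm_mult intro!: mult_mono)
        also have "\<dots> \<le> \<epsilon> / 2" using \<eta>(3) by (simp add: algebra_simps)
        finally have n: "norm (\<mu> r * (\<phi> t - \<phi> t0) + (\<mu> r - 1) * \<phi> t0) \<le> \<epsilon> / 2" .
        have "?N (x1, x2 - t) * \<phi> t - of_real (?p t) * \<phi> t0 = of_real (?p t) * (\<mu> r * (\<phi> t - \<phi> t0) + (\<mu> r - 1) * \<phi> t0)"
          unfolding gen_eq_pois[OF x1] r_def by (simp add: algebra_simps)
        then have "norm (?N (x1, x2 - t) * \<phi> t - of_real (?p t) * \<phi> t0) \<le> ?p t * (\<epsilon> / 2)"
          using mult_left_mono[OF n p0] p0 by (simp only: norm_mult norm_of_real abs_of_nonneg)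
        moreover have "0 \<le> x1 * (D * ?R t)" using x1 D R0 by (intro mult_nonneg_nonneg) auto
        ultimately show ?thesis by (simp add: mult.commute)
      next
        case False
        have "\<bar>t - t0\<bar> \<le> \<bar>x2 - t\<bar> + \<bar>x2 - t0\<bar>" by linarith
        with False x1b(2) have far: "\<bar>x2 - t\<bar> \<ge> \<delta> / 2" by linarith
        have "(\<delta> / 2)\<^sup>2 \<le> (x2 - t)\<^sup>2"
          using power_mono[OF far, of 2] \<delta>(1) by simp
        then have far2: "\<delta>\<^sup>2 / 4 \<le> (x2 - t)\<^sup>2" by (simp add: power_divide)
        have "c * 1 \<le> (x2 - t)\<^sup>2" using far2 by (simp add: c_def)
        moreover have "c * (x2 - t)\<^sup>2 \<le> 1 * (x2 - t)\<^sup>2" using c by (intro mult_right_mono) auto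
        ultimately have "c * (1 + (x2 - t)\<^sup>2) \<le> 2 * (x2 - t)\<^sup>2" by (simp add: distrib_left)
        then have "c * (1 + (x2 - t)\<^sup>2) \<le> 2 * (x1\<^sup>2 + (x2 - t)\<^sup>2)"
          by (rule order_trans) simp
        then have ge: "c / 2 * (1 + (x2 - t)\<^sup>2) \<le> x1\<^sup>2 + (x2 - t)\<^sup>2" by simp
        have wl: "weight (x2 - t) \<le> W * weight t"
          unfolding W_def by (rule weight_shift[OF x2M])
        have pQ: "?p t \<le> x1 * (Q * weight (x2 - t))"
        proof -
          have "?p t \<le> x1 / (1 * (c / 2 * (1 + (x2 - t)\<^sup>2)))"
            unfolding pois_def using x1 ge c pi_gt3
            by (intro divide_left_mono mult_mono mult_pos_pos) (auto intro!: add_pos_nonneg)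
          also have "\<dots> = x1 * (Q * (1 / (1 + (x2 - t)\<^sup>2)))" by (simp add: Q_def)
          also have "\<dots> \<le> x1 * (Q * weight (x2 - t))"
            using x1 Q inverse_square_le_weight[of "x2 - t"] by (intro mult_left_mono) auto
          finally show ?thesis .
        qed
        also have "\<dots> \<le> x1 * (Q * (W * weight t))"
          using x1 Q wl by (intro mult_left_mono) auto
        finally have pQ': "?p t \<le> x1 * (Q * (W * weight t))" .
        have e1: "exp (- Im k * x1) \<le> 1" using Im_k x1 by simp
        have "norm (?N (x1, x2 - t)) \<le> C * (exp (- Im k * x1) * (?p t + x1 * weight (x2 - t)))"
          by (rule C(2)[OF x1])
        also have "\<dots> \<le> C * (1 * (x1 * (Q * (W * weight t)) + x1 * (W * weight t)))"
          using C(1) e1 pQ' wl x1 p0 weight_pos[of "x2 - t"]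
          by (intro mult_left_mono mult_mono add_mono add_nonneg_nonneg) auto
        also have "\<dots> = x1 * (C * (Q + 1) * W * weight t)" by (simp add: algebra_simps)
        finally have nN: "norm (?N (x1, x2 - t)) \<le> x1 * (C * (Q + 1) * W * weight t)" .
        have "norm (?N (x1, x2 - t) * \<phi> t - of_real (?p t) * \<phi> t0)
            \<le> norm (?N (x1, x2 - t)) * norm (\<phi> t) + ?p t * norm (\<phi> t0)"
          using p0 by (intro order_trans[OF norm_triangle_ineq4]) (simp add: norm_mult)
        also have "\<dots> \<le> x1 * (C * (Q + 1) * W * weight t) * norm (\<phi> t) + x1 * (Q * (W * weight t)) * norm (\<phi> t0)"
          using nN pQ' by (intro add_mono mult_right_mono) auto
        also have "\<dots> \<le> x1 * (D * weight t) * norm (\<phi> t) + x1 * (D * weight t) * norm (\<phi> t0)"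
        proof -
          have "C * (Q + 1) * W \<le> D" "Q * W \<le> D" using C Q W by (auto simp: D_def algebra_simps)
          then have ab: "C * (Q + 1) * W * weight t \<le> D * weight t" "Q * (W * weight t) \<le> D * weight t"
            unfolding mult.assoc[of Q W, symmetric] using weight_pos[of t] by (simp_all add: mult_right_mono)
          then show ?thesis
            using x1 by (intro add_mono mult_right_mono[OF mult_left_mono[OF ab(1)]]
                mult_right_mono[OF mult_left_mono[OF ab(2)]]) auto
        qed
        also have "\<dots> = x1 * (D * ?R t)" by (simp add: algebra_simps)
        also have "\<dots> \<le> \<epsilon> / 2 * ?p t + x1 * (D * ?R t)"
          using p0 \<epsilon> by simp
        finally show ?thesis .
      qed
    qed
    have i1: "integrable lebesgue (\<lambda>t. ?N (x1, x2 - t) * \<phi> t)"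
      using pot_integrable[OF kclass.gen x(1), of 0 0 1] by (simp add: x1_def x2_def)
    have i2: "integrable lebesgue (\<lambda>t. of_real (?p t) * \<phi> t0)"
      using pl(1) by simp
    have pot_x: "pot ?N x = (LINT t|lebesgue. ?N (x1, x2 - t) * \<phi> t)"
      by (simp add: pot_def x1_def x2_def)
    have "\<phi> t0 = of_real (LINT t|lebesgue. ?p t) * \<phi> t0"
      unfolding pl(2) by simp
    also have "\<dots> = (LINT t|lebesgue. of_real (?p t) * \<phi> t0)"
      by simp
    finally have "pot ?N x - \<phi> t0 = (LINT t|lebesgue. ?N (x1, x2 - t) * \<phi> t) - (LINT t|lebesgue. of_real (?p t) * \<phi> t0)"
      unfolding pot_x by (rule arg_cong)
    also have "\<dots> = (LINT t|lebesgue. ?N (x1, x2 - t) * \<phi> t - of_real (?p t) * \<phi> t0)"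
      by (rule Bochner_Integration.integral_diff[OF i1 i2, symmetric])
    also have "norm \<dots> \<le> (LINT t|lebesgue. norm (?N (x1, x2 - t) * \<phi> t - of_real (?p t) * \<phi> t0))"
      by (rule integral_norm_bound)
    also have "\<dots> \<le> (LINT t|lebesgue. \<epsilon> / 2 * ?p t + x1 * (D * ?R t))"
      by (rule integral_mono[OF integrable_norm[OF Bochner_Integration.integrable_diff[OF i1 i2]] _ pw])
        (intro Bochner_Integration.integrable_add integrable_mult_right pl(1) Rint)
    also have "\<dots> = \<epsilon> / 2 * (LINT t|lebesgue. ?p t) + x1 * (D * (LINT t|lebesgue. ?R t))"
    proof -
      have "integrable lebesgue (\<lambda>t. \<epsilon> / 2 * ?p t)" "integrable lebesgue (\<lambda>t. x1 * (D * ?R t))"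
        by (intro integrable_mult_right pl(1) Rint)+
      then show ?thesis
        by (subst Bochner_Integration.integral_add) (simp_all only: integral_mult_right_zero)
    qed
    also have "\<dots> = \<epsilon> / 2 * 1 + x1 * (D * A)"
      by (simp only: pl(2) A_def)
    also have "\<dots> < \<epsilon>"
    proof -
      have "x1 * (D * A) \<le> \<epsilon> / (4 * (D * A + 1)) * (D * A + 1)"
        using x1b(3) x1 D A DA by (intro mult_mono) auto
      also have "\<epsilon> / (4 * y) * y = \<epsilon> / 4" if "y > 0" for y :: real
        using that by simp
      note this[OF DA]
      finally show ?thesis using \<epsilon> by simp
    qed
    finally show ?thesis by (simp add: dist_norm)
  qed
  show "\<forall>\<^sub>F x in at (0, t0) within half_plane. dist (pot ?N x) (\<phi> t0) < \<epsilon>"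
    unfolding eventually_at using \<delta>' main by (intro exI[of _ \<delta>']) auto
qed

text \<open>A boundary point can be approached from the half plane or along the boundary. The former
  limit is \<open>pot_boundary_limit\<close>, the latter the continuity of \<open>\<phi>\<close>,
  and \<open>Lim_Un\<close> joins them.\<close>

lemma potential_boundary:
  assumes I: "open I" "continuous_on I \<phi>"
  shows "continuous_on (half_plane \<union> {0} \<times> I) (\<lambda>x. if x \<in> half_plane then potential k \<phi> x else \<phi> (snd x))"
    (is "continuous_on _ ?u")
proof -
  have "(?u \<longlongrightarrow> ?u x) (at x within half_plane \<union> {0} \<times> I)" if x: "x \<in> half_plane \<union> {0} \<times> I" for x
  proof (cases "x \<in> half_plane")
    case True
    have "C_k_on 0 (potential k \<phi>) half_plane"
      using potential_smooth by (simp add: C_infinity_on_def del: C_k_on.simps)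
    then have "continuous_on half_plane ?u"
      by (simp cong: continuous_on_cong)
    then have "isCont ?u x"
      using True continuous_on_eq_continuous_at[OF open_half_plane] by blast
    then show ?thesis
      unfolding isCont_def by (rule tendsto_within_subset) simp
  next
    case False
    then obtain t0 where t0: "x = (0, t0)" "t0 \<in> I" using x by auto
    have ux: "?u x = \<phi> t0" using False t0 by simp
    have "(?u \<longlongrightarrow> \<phi> t0) (at (0, t0) within half_plane)"
    proof (rule Lim_transform_eventually[OF pot_boundary_limit[OF I(1) t0(2) I(2)]])
      show "\<forall>\<^sub>F x in at (0, t0) within half_plane. pot (gen 1 0 0) x = ?u x"
        unfolding eventually_at by (intro exI[of _ 1]) (auto simp: potential_eq_pot)
    qed
    moreover have "(?u \<longlongrightarrow> \<phi> t0) (at (0, t0) within {0} \<times> I)"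
    proof (rule Lim_transform_eventually)
      have c: "continuous_on ({0} \<times> I) (\<lambda>x::real \<times> real. \<phi> (snd x))"
        by (rule continuous_on_compose2[OF I(2)]) (auto intro!: continuous_intros)
      show "((\<lambda>x. \<phi> (snd x)) \<longlongrightarrow> \<phi> t0) (at (0 :: real, t0) within {0} \<times> I)"
        using c[unfolded continuous_on_def, rule_format, of "(0, t0)"] t0(2) by simp
      show "\<forall>\<^sub>F x in at (0, t0) within {0} \<times> I. \<phi> (snd x) = ?u x"
        unfolding eventually_at by (intro exI[of _ 1]) (auto simp: half_plane_def)
    qed
    ultimately have "(?u \<longlongrightarrow> \<phi> t0) (at x within half_plane \<union> {0} \<times> I)"
      unfolding t0(1) by (rule Lim_Un)
    then show ?thesis unfolding ux .
  qed
  then show ?thesis by (simp add: continuous_on_def)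
qed

end

section \<open>Square integrability\<close>

lemma nn_integral_real_reflect:
  fixes f :: "real \<Rightarrow> ennreal"
  assumes "f \<in> borel_measurable borel"
  shows "(\<integral>\<^sup>+t. f (x - t) \<partial>lborel) = (\<integral>\<^sup>+t. f t \<partial>lborel)"
    and "(\<integral>\<^sup>+x. f (x - t) \<partial>lborel) = (\<integral>\<^sup>+x. f x \<partial>lborel)"
  using nn_integral_real_affine[OF assms, of "-1" x] nn_integral_real_affine[OF assms, of 1 "-t"]
  by (simp_all add: ac_simps)

text \<open>Stated for extended integrals, so that no integrability has to be known beforehand.
  After splitting \<open>b\<close> as \<open>sqrt b * sqrt b\<close>, Cauchy-Schwarz yields one
  factor \<open>A\<close>, and Tonelli with translation invariance yields the other.\<close>

lemma nn_integral_young_L2: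
  fixes b f :: "real \<Rightarrow> real"
  assumes b[measurable]: "b \<in> borel_measurable borel" and f[measurable]: "f \<in> borel_measurable borel"
    and nn: "\<And>t. 0 \<le> b t"
  shows "(\<integral>\<^sup>+x. (\<integral>\<^sup>+t. ennreal (b (x - t)) * ennreal (f t) \<partial>lborel)\<^sup>2 \<partial>lborel)
     \<le> (\<integral>\<^sup>+t. ennreal (b t) \<partial>lborel)\<^sup>2 * (\<integral>\<^sup>+t. (ennreal (f t))\<^sup>2 \<partial>lborel)"
proof -
  define A where "A = (\<integral>\<^sup>+t. ennreal (b t) \<partial>lborel)"
  have A: "(\<integral>\<^sup>+t. ennreal (b (x - t)) \<partial>lborel) = A" "(\<integral>\<^sup>+x. ennreal (b (x - t)) \<partial>lborel) = A" for x t
    unfolding A_def using nn_integral_real_reflect[of "\<lambda>t. ennreal (b t)"] by auto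
  have sq: "(ennreal (sqrt (b u)))\<^sup>2 = ennreal (b u)" for u
    using nn[of u] by (simp add: ennreal_power)
  have "(\<integral>\<^sup>+x. (\<integral>\<^sup>+t. ennreal (b (x - t)) * ennreal (f t) \<partial>lborel)\<^sup>2 \<partial>lborel)
     \<le> (\<integral>\<^sup>+x. A * (\<integral>\<^sup>+t. ennreal (b (x - t)) * (ennreal (f t))\<^sup>2 \<partial>lborel) \<partial>lborel)"
  proof (rule nn_integral_mono)
    fix x :: real
    have "(\<integral>\<^sup>+t. ennreal (b (x - t)) * ennreal (f t) \<partial>lborel)
       = (\<integral>\<^sup>+t. ennreal (sqrt (b (x - t))) * (ennreal (sqrt (b (x - t))) * ennreal (f t)) \<partial>lborel)"
      by (intro nn_integral_cong) (simp add: sq[symmetric] power2_eq_square mult.assoc)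
    also have "\<dots>\<^sup>2 \<le> (\<integral>\<^sup>+t. (ennreal (sqrt (b (x - t))))\<^sup>2 \<partial>lborel)
        * (\<integral>\<^sup>+t. (ennreal (sqrt (b (x - t))) * ennreal (f t))\<^sup>2 \<partial>lborel)"
      by (rule Cauchy_Schwarz_nn_integral) measurable
    also have "\<dots> = A * (\<integral>\<^sup>+t. ennreal (b (x - t)) * (ennreal (f t))\<^sup>2 \<partial>lborel)"
      unfolding power_mult_distrib sq A ..
    finally show "(\<integral>\<^sup>+t. ennreal (b (x - t)) * ennreal (f t) \<partial>lborel)\<^sup>2
       \<le> A * (\<integral>\<^sup>+t. ennreal (b (x - t)) * (ennreal (f t))\<^sup>2 \<partial>lborel)" .
  qed
  also have "\<dots> = A * (\<integral>\<^sup>+x. (\<integral>\<^sup>+t. ennreal (b (x - t)) * (ennreal (f t))\<^sup>2 \<partial>lborel) \<partial>lborel)"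
    by (rule nn_integral_cmult) measurable
  also have "(\<integral>\<^sup>+x. (\<integral>\<^sup>+t. ennreal (b (x - t)) * (ennreal (f t))\<^sup>2 \<partial>lborel) \<partial>lborel)
     = (\<integral>\<^sup>+t. (\<integral>\<^sup>+x. ennreal (b (x - t)) * (ennreal (f t))\<^sup>2 \<partial>lborel) \<partial>lborel)"
    by (rule lborel_pair.Fubini'[symmetric]) measurable
  also have "\<dots> = (\<integral>\<^sup>+t. A * (ennreal (f t))\<^sup>2 \<partial>lborel)"
    by (intro nn_integral_cong) (subst nn_integral_multc; simp add: A)
  also have "\<dots> = A * (\<integral>\<^sup>+t. (ennreal (f t))\<^sup>2 \<partial>lborel)"
    by (rule nn_integral_cmult) measurable
  finally show ?thesis
    by (simp add: A_def power2_eq_square mult.assoc)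
qed

text \<open>The bridge from extended integrals to \<open>L2_norm\<close>. The added 1 makes the
  constant strictly positive also for \<open>K = 0\<close>, as the estimates of the theorem
  demand.\<close>

lemma L2_bound_of_nn_integral:
  assumes u: "u \<in> borel_measurable M" and f: "f \<in> L2_space N" and K: "K \<ge> 0"
    and le: "(\<integral>\<^sup>+x. ennreal ((cmod (u x))\<^sup>2) \<partial>M) \<le> ennreal K * (\<integral>\<^sup>+x. ennreal ((cmod (f x))\<^sup>2) \<partial>N)"
  shows "u \<in> L2_space M" "L2_norm M u \<le> (sqrt K + 1) * L2_norm N f"
proof -
  have fi: "integrable N (\<lambda>x. (cmod (f x))\<^sup>2)" using f by (simp add: L2_space_def)
  define F where "F = (LINT x|N. (cmod (f x))\<^sup>2)"
  have F: "(\<integral>\<^sup>+x. ennreal ((cmod (f x))\<^sup>2) \<partial>N) = ennreal F" "F \<ge> 0"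
    unfolding F_def by (auto intro!: nn_integral_eq_integral fi)
  have le': "(\<integral>\<^sup>+x. ennreal ((cmod (u x))\<^sup>2) \<partial>M) \<le> ennreal (K * F)"
    using le K F by (simp add: ennreal_mult)
  have ui: "integrable M (\<lambda>x. (cmod (u x))\<^sup>2)"
  proof (rule integrableI_nonneg)
    show "(\<lambda>x. (cmod (u x))\<^sup>2) \<in> borel_measurable M" using u by measurable
    show "(\<integral>\<^sup>+x. ennreal ((cmod (u x))\<^sup>2) \<partial>M) < \<infinity>"
      using le' by (simp add: le_less_trans)
  qed simp
  then show "u \<in> L2_space M" using u by (simp add: L2_space_def)
  have "ennreal (LINT x|M. (cmod (u x))\<^sup>2) \<le> ennreal (K * F)"
    using le' ui by (subst (asm) nn_integral_eq_integral) auto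
  then have "(LINT x|M. (cmod (u x))\<^sup>2) \<le> K * F"
    using K F by (simp add: ennreal_le_iff)
  then have "L2_norm M u \<le> sqrt K * sqrt F"
    by (simp add: L2_norm_def real_sqrt_mult[symmetric])
  also have "\<dots> \<le> (sqrt K + 1) * sqrt F"
    using F by (intro mult_right_mono) auto
  finally show "L2_norm M u \<le> (sqrt K + 1) * L2_norm N f"
    by (simp add: L2_norm_def F_def)
qed

lemma L2_space_subset: "\<phi> \<in> L2_space M \<Longrightarrow> \<phi> \<in> L2_plus_Linf M"
  unfolding L2_plus_Linf_def Linf_space_def
  by (intro CollectI exI[of _ \<phi>] exI[of _ "\<lambda>_. 0"]) (auto intro!: exI[of _ 0])

context wave_number
begin

lemma weighted_densityI: "\<phi> \<in> L2_plus_Linf (lebesgue :: real measure) \<Longrightarrow> weighted_density k \<phi>"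
  using weight_L2_plus_Linf by unfold_locales auto

text \<open>Up to a constant, this bounds the \<open>L\<^sup>1\<close> norm of the kernel on the line at distance \<open>x1\<close> from the boundary.\<close>

definition slice_norm :: "real \<Rightarrow> real" where
  "slice_norm x1 = exp (- Im k * x1) * (1 + x1 * (LINT t|lborel. weight t))"

text \<open>Both square integrability claims are instances, with \<open>J\<close> the half line or a
  bounded interval; only the integral of the squared \<open>slice_norm\<close> differs. The constant
  is built from \<open>C\<close> and \<open>K\<close>, both fixed before the density.\<close>

lemma potential_L2_bound:
  assumes J: "J \<in> sets borel" "J \<subseteq> {0<..}" and K: "K \<ge> 0"
    and JK: "(\<integral>\<^sup>+x1. ennreal ((slice_norm x1)\<^sup>2) * indicator J x1 \<partial>lborel) \<le> ennreal K"
  shows "\<exists>C>0. \<forall>\<phi> \<in> L2_space (lebesgue :: real measure).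
     potential k \<phi> \<in> L2_space (lebesgue_on (J \<times> UNIV)) \<and>
     L2_norm (lebesgue_on (J \<times> UNIV)) (potential k \<phi>) \<le> C * L2_norm lebesgue \<phi>"
proof -
  obtain C where C: "C > 0" "\<And>x1 x2. x1 > 0 \<Longrightarrow> norm (gen 1 0 0 (x1, x2)) \<le> C * (exp (- Im k * x1) * (pois x1 x2 + x1 * weight x2))"
    using kernel_bound by blast
  show ?thesis
  proof (rule exI[of _ "sqrt (C\<^sup>2 * K) + 1"], rule conjI[rotated], rule ballI)
    fix \<phi> assume \<phi>: "\<phi> \<in> L2_space (lebesgue :: real measure)"
    interpret weighted_density k \<phi>
      by (rule weighted_densityI[OF L2_space_subset[OF \<phi>]])
    let ?u = "potential k \<phi>"
    let ?\<Omega> = "J \<times> (UNIV :: real set)"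
    have \<Omega>: "?\<Omega> \<in> sets borel" "?\<Omega> \<subseteq> half_plane"
      using J by (auto simp: half_plane_def borel_prod[symmetric])
    have cont: "continuous_on half_plane ?u"
      using potential_smooth C_k_on.simps(1) unfolding C_infinity_on_def by blast
    \<comment> \<open>Extension by zero turns the potential, which is controlled only on the half
      plane, into a Borel function on the whole plane, to which Tonelli applies.\<close>
    have um: "(\<lambda>x. indicator ?\<Omega> x *\<^sub>R ?u x) \<in> borel_measurable borel"
      by (rule borel_measurable_continuous_on_indicator[OF \<Omega>(1) continuous_on_subset[OF cont \<Omega>(2)]])
    \<comment> \<open>The density is only Lebesgue measurable; a Borel function equal to its modulus
      almost everywhere takes its place in \<open>nn_integral_young_L2\<close>.\<close>
    obtain \<psi> where \<psi>[measurable]: "\<psi> \<in> borel_measurable lborel" and \<psi>_eq: "AE t in lborel. norm (\<phi> t) = \<psi> t"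
      using completion_ex_borel_measurable_real[of "\<lambda>t. norm (\<phi> t)" lborel] \<phi>_measurable by auto
    have \<psi>b[measurable]: "\<psi> \<in> borel_measurable borel" using \<psi> by simp
    define F where "F = (\<integral>\<^sup>+t. ennreal ((norm (\<phi> t))\<^sup>2) \<partial>lebesgue)"
    have F: "(\<integral>\<^sup>+t. (ennreal (\<psi> t))\<^sup>2 \<partial>lborel) = F"
      unfolding F_def nn_integral_completion
    proof (rule nn_integral_cong_AE)
      show "AE t in lborel. (ennreal (\<psi> t))\<^sup>2 = ennreal ((norm (\<phi> t))\<^sup>2)"
        using \<psi>_eq by eventually_elim (metis ennreal_power norm_ge_zero)
    qed
    have slice: "(\<integral>\<^sup>+x2. ennreal ((norm (?u (x1, x2)))\<^sup>2) \<partial>lborel) \<le> ennreal (C\<^sup>2 * (slice_norm x1)\<^sup>2) * F"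
      if x1: "x1 > 0" for x1
    proof -
      \<comment> \<open>\<open>b\<close> majorizes the kernel on the line; since the Poisson kernel
        has unit mass, its integral is \<open>C * slice_norm x1\<close>.\<close>
      define b where "b = (\<lambda>t. C * (exp (- Im k * x1) * (pois x1 t + x1 * weight t)))"
      have b0: "b t \<ge> 0" for t
        using C(1) pois_nonneg[OF x1] weight_pos[of t] x1 by (auto simp: b_def intro!: mult_nonneg_nonneg add_nonneg_nonneg less_imp_le)
      have bi: "integrable lborel b"
        unfolding b_def using pois_integral(1)[OF x1] weight_integrable by simp
      have bb: "b \<in> borel_measurable borel"
        using borel_measurable_integrable[OF bi] by simp
      have bI: "(\<integral>\<^sup>+t. ennreal (b t) \<partial>lborel) = ennreal (C * slice_norm x1)"
      proof -
        have "(LINT t|lborel. b t) = C * slice_norm x1"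
          unfolding b_def slice_norm_def using pois_integral[OF x1] weight_integrable by simp
        then show ?thesis using bi b0 by (simp add: nn_integral_eq_integral)
      qed
      have pw: "ennreal (norm (?u (x1, x2))) \<le> (\<integral>\<^sup>+t. ennreal (b (x2 - t)) * ennreal (\<psi> t) \<partial>lborel)" for x2
      proof -
        have x: "(x1, x2) \<in> half_plane" using x1 by (simp add: half_plane_def)
        have "ennreal (norm (?u (x1, x2))) \<le> (\<integral>\<^sup>+t. ennreal (norm (gen 1 0 0 (x1, x2 - t) * \<phi> t)) \<partial>lebesgue)"
          unfolding potential_eq_pot[OF x] pot_def fst_conv snd_conv
          using pot_integrable[OF kclass.gen x, of 0 0 1] by (intro integral_norm_bound_ennreal) simp
        also have "\<dots> \<le> (\<integral>\<^sup>+t. ennreal (b (x2 - t)) * ennreal (norm (\<phi> t)) \<partial>lebesgue)"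
        proof (rule nn_integral_mono)
          fix t
          have "norm (gen 1 0 0 (x1, x2 - t)) * norm (\<phi> t) \<le> b (x2 - t) * norm (\<phi> t)"
            unfolding b_def by (rule mult_right_mono[OF C(2)[OF x1]]) simp
          then show "ennreal (norm (gen 1 0 0 (x1, x2 - t) * \<phi> t)) \<le> ennreal (b (x2 - t)) * ennreal (norm (\<phi> t))"
            unfolding norm_mult ennreal_mult[OF b0 norm_ge_zero, symmetric] by (rule ennreal_leI)
        qed
        also have "\<dots> = (\<integral>\<^sup>+t. ennreal (b (x2 - t)) * ennreal (\<psi> t) \<partial>lborel)"
          unfolding nn_integral_completion
          by (rule nn_integral_cong_AE) (use \<psi>_eq in eventually_elim, simp)
        finally show ?thesis .
      qed
      have "(\<integral>\<^sup>+x2. ennreal ((norm (?u (x1, x2)))\<^sup>2) \<partial>lborel)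
         \<le> (\<integral>\<^sup>+x2. (\<integral>\<^sup>+t. ennreal (b (x2 - t)) * ennreal (\<psi> t) \<partial>lborel)\<^sup>2 \<partial>lborel)"
        by (intro nn_integral_mono) (simp add: ennreal_power[symmetric] power_mono[OF pw])
      also have "\<dots> \<le> (\<integral>\<^sup>+t. ennreal (b t) \<partial>lborel)\<^sup>2 * (\<integral>\<^sup>+t. (ennreal (\<psi> t))\<^sup>2 \<partial>lborel)"
        by (rule nn_integral_young_L2[OF bb \<psi>b b0])
      also have "\<dots> = ennreal (C\<^sup>2 * (slice_norm x1)\<^sup>2) * F"
      proof -
        have "0 \<le> C * slice_norm x1"
          using C(1) x1 weight_integral_nonneg by (simp add: slice_norm_def)
        then show ?thesis
          unfolding bI F by (simp add: ennreal_power power_mult_distrib)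
      qed
      finally show ?thesis .
    qed
    have total: "(\<integral>\<^sup>+x. ennreal ((norm (?u x))\<^sup>2) \<partial>lebesgue_on ?\<Omega>) \<le> ennreal (C\<^sup>2 * K) * F"
    proof -
      have [measurable]: "(\<lambda>x. ennreal ((norm (indicator ?\<Omega> x *\<^sub>R ?u x))\<^sup>2)) \<in> borel_measurable (lborel \<Otimes>\<^sub>M lborel)"
        using um unfolding lborel_prod by measurable
      have "(\<integral>\<^sup>+x. ennreal ((norm (?u x))\<^sup>2) \<partial>lebesgue_on ?\<Omega>) = (\<integral>\<^sup>+x. ennreal ((norm (?u x))\<^sup>2) * indicator ?\<Omega> x \<partial>lebesgue)"
        using \<Omega>(1) by (intro nn_integral_restrict_space) (auto intro: sets_completionI_sets)
      also have "\<dots> = (\<integral>\<^sup>+x. ennreal ((norm (indicator ?\<Omega> x *\<^sub>R ?u x))\<^sup>2) \<partial>(lborel \<Otimes>\<^sub>M lborel))"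
        unfolding nn_integral_completion lborel_prod
        by (intro nn_integral_cong) (auto split: split_indicator)
      also have "\<dots> = (\<integral>\<^sup>+x1. \<integral>\<^sup>+x2. ennreal ((norm (indicator ?\<Omega> (x1, x2) *\<^sub>R ?u (x1, x2)))\<^sup>2) \<partial>lborel \<partial>lborel)"
        by (rule lborel.nn_integral_fst[symmetric]) measurable
      also have "\<dots> \<le> (\<integral>\<^sup>+x1. (ennreal (C\<^sup>2) * F) * (ennreal ((slice_norm x1)\<^sup>2) * indicator J x1) \<partial>lborel)"
      proof (rule nn_integral_mono)
        fix x1 :: real
        show "(\<integral>\<^sup>+x2. ennreal ((norm (indicator ?\<Omega> (x1, x2) *\<^sub>R ?u (x1, x2)))\<^sup>2) \<partial>lborel)
           \<le> (ennreal (C\<^sup>2) * F) * (ennreal ((slice_norm x1)\<^sup>2) * indicator J x1)"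
        proof (cases "x1 \<in> J")
          case True
          then have "x1 > 0" using J by auto
          from slice[OF this] True show ?thesis by (simp add: ennreal_mult mult_ac)
        qed simp
      qed
      also have "\<dots> = (ennreal (C\<^sup>2) * F) * (\<integral>\<^sup>+x1. ennreal ((slice_norm x1)\<^sup>2) * indicator J x1 \<partial>lborel)"
        using J by (intro nn_integral_cmult) (auto simp: slice_norm_def[abs_def])
      also have "\<dots> \<le> (ennreal (C\<^sup>2) * F) * ennreal K"
        using JK by (rule mult_left_mono) simp
      finally show ?thesis using K by (simp add: ennreal_mult mult_ac)
    qed
    have um': "?u \<in> borel_measurable (lebesgue_on ?\<Omega>)"
    proof -
      have "(\<lambda>x. indicator ?\<Omega> x *\<^sub>R ?u x) \<in> borel_measurable lebesgue"
        using um by (intro measurable_completion) simp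
      then show ?thesis
        using \<Omega>(1) by (subst borel_measurable_restrict_space_iff) (auto intro: sets_completionI_sets)
    qed
    show "?u \<in> L2_space (lebesgue_on ?\<Omega>) \<and> L2_norm (lebesgue_on ?\<Omega>) ?u \<le> (sqrt (C\<^sup>2 * K) + 1) * L2_norm lebesgue \<phi>"
      using L2_bound_of_nn_integral[OF um' \<phi> _ total[unfolded F_def]] K by simp
  qed (use K in \<open>simp add: add_nonneg_pos\<close>)
qed

lemma potential_L2_half_plane:
  assumes "Im k > 0"
  shows "\<exists>C>0. \<forall>\<phi> \<in> L2_space (lebesgue :: real measure).
           potential k \<phi> \<in> L2_space (lebesgue_on half_plane) \<and>
           L2_norm (lebesgue_on half_plane) (potential k \<phi>) \<le> C * L2_norm lebesgue \<phi>"
proof -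
  define w where "w = (LINT t|lborel. weight t)"
  have w: "w \<ge> 0" unfolding w_def by (rule weight_integral_nonneg)
  \<comment> \<open>Half of the exponential decay is spent on the linear factor, through
    \<open>x \<le> (2 / Im k) exp (Im k x / 2)\<close>. After squaring,
    \<open>exp (- Im k x)\<close> is left, whose integral is \<open>1 / Im k\<close>.\<close>
  define M where "M = 1 + 2 * w / Im k"
  define K where "K = M\<^sup>2 / Im k"
  have M: "M \<ge> 0" and K: "K \<ge> 0" using w assms by (simp_all add: M_def K_def)
  have sl: "(slice_norm x)\<^sup>2 \<le> M\<^sup>2 * exp (- Im k * x)" if x: "x > 0" for x
  proof -
    have "Im k * x / 2 \<le> exp (Im k * x / 2)"
      using exp_ge_add_one_self[of "Im k * x / 2"] by linarith
    then have "x \<le> 2 / Im k * exp (Im k * x / 2)"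
      using assms by (simp add: field_simps)
    then have "x * w \<le> 2 / Im k * exp (Im k * x / 2) * w"
      using w by (rule mult_right_mono)
    moreover have "1 \<le> exp (Im k * x / 2)" using assms x by simp
    moreover have "M * exp (Im k * x / 2) = exp (Im k * x / 2) + 2 / Im k * exp (Im k * x / 2) * w"
      by (simp add: M_def distrib_right)
    ultimately have "1 + x * w \<le> M * exp (Im k * x / 2)"
      by linarith
    then have "exp (- Im k * x) * (1 + x * w) \<le> exp (- Im k * x) * (M * exp (Im k * x / 2))"
      by (rule mult_left_mono) simp
    also have "\<dots> = M * exp (- (Im k * x / 2))"
    proof -
      have "exp (- Im k * x) * exp (Im k * x / 2) = exp (- (Im k * x / 2))"
        unfolding exp_add[symmetric] by simp
      then show ?thesis by (simp add: mult.left_commute)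
    qed
    finally have "slice_norm x \<le> M * exp (- (Im k * x / 2))"
      by (simp add: slice_norm_def w_def)
    then have "(slice_norm x)\<^sup>2 \<le> (M * exp (- (Im k * x / 2)))\<^sup>2"
      using x w by (intro power_mono) (auto simp: slice_norm_def w_def)
    also have "\<dots> = M\<^sup>2 * exp (- Im k * x)"
      by (simp add: power_mult_distrib exp_double[symmetric])
    finally show ?thesis .
  qed
  have ex: "(\<integral>\<^sup>+x. ennreal (exp (- Im k * x)) * indicator {0..} x \<partial>lborel) = ennreal (0 - (- exp (- Im k * 0) / Im k))"
  proof (rule nn_integral_FTC_atLeast)
    show "((\<lambda>x. - exp (- Im k * x) / Im k) has_real_derivative exp (- Im k * x)) (at x)" for x
      using assms by (auto intro!: derivative_eq_intros)
    show "((\<lambda>x. - exp (- Im k * x) / Im k) \<longlongrightarrow> 0) at_top" using assms by real_asymp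
  qed auto
  have "(\<integral>\<^sup>+x. ennreal ((slice_norm x)\<^sup>2) * indicator {0<..} x \<partial>lborel)
     \<le> (\<integral>\<^sup>+x. ennreal (M\<^sup>2) * (ennreal (exp (- Im k * x)) * indicator {0..} x) \<partial>lborel)"
    by (intro nn_integral_mono) (auto simp: ennreal_mult[symmetric] intro!: ennreal_leI sl[unfolded mult_minus_left] split: split_indicator)
  also have "\<dots> = ennreal (M\<^sup>2) * ennreal (1 / Im k)"
    using ex by (subst nn_integral_cmult) auto
  also have "\<dots> = ennreal K"
    using assms by (simp add: K_def ennreal_mult[symmetric])
  finally have le: "(\<integral>\<^sup>+x. ennreal ((slice_norm x)\<^sup>2) * indicator {0<..} x \<partial>lborel) \<le> ennreal K" .
  have "half_plane = {0<..} \<times> UNIV"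
    by (simp add: half_plane_def)
  then show ?thesis
    using potential_L2_bound[OF _ _ K le] by simp
qed

lemma potential_L2_strip:
  assumes "L > 0"
  shows "\<exists>C>0. \<forall>\<phi> \<in> L2_space (lebesgue :: real measure).
           potential k \<phi> \<in> L2_space (lebesgue_on (strip L)) \<and>
           L2_norm (lebesgue_on (strip L)) (potential k \<phi>) \<le> C * L2_norm lebesgue \<phi>"
proof -
  define w where "w = (LINT t|lborel. weight t)"
  have w: "w \<ge> 0" unfolding w_def by (rule weight_integral_nonneg)
  \<comment> \<open>On the strip the exponential is at most 1 and \<open>x < L\<close>, so the
    squared slice norm is at most \<open>(1 + L * w)^2\<close>; the last factor is the
    width.\<close>
  define K where "K = (1 + L * w)\<^sup>2 * L"
  have K: "K \<ge> 0" using assms by (simp add: K_def)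
  have sl: "(slice_norm x)\<^sup>2 \<le> (1 + L * w)\<^sup>2" if x: "0 < x" "x < L" for x
  proof -
    have "exp (- Im k * x) * (1 + x * w) \<le> 1 * (1 + L * w)"
      using x w Im_k by (intro mult_mono add_left_mono mult_right_mono) auto
    then show ?thesis
      using x w by (intro power_mono) (auto simp: slice_norm_def w_def)
  qed
  have "(\<integral>\<^sup>+x. ennreal ((slice_norm x)\<^sup>2) * indicator {0<..<L} x \<partial>lborel)
     \<le> (\<integral>\<^sup>+x. ennreal ((1 + L * w)\<^sup>2) * indicator {0<..<L} x \<partial>lborel)"
    by (intro nn_integral_mono) (auto intro!: ennreal_leI sl split: split_indicator)
  also have "\<dots> = ennreal ((1 + L * w)\<^sup>2) * ennreal L"
    using assms by (subst nn_integral_cmult_indicator) auto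
  also have "\<dots> = ennreal K"
    using assms by (simp add: K_def ennreal_mult[symmetric])
  finally have le: "(\<integral>\<^sup>+x. ennreal ((slice_norm x)\<^sup>2) * indicator {0<..<L} x \<partial>lborel) \<le> ennreal K" .
  have "strip L = {0<..<L} \<times> UNIV"
    by (auto simp: strip_def half_plane_def)
  moreover have "{0<..<L} \<subseteq> {0<..}" by auto
  ultimately show ?thesis
    using potential_L2_bound[OF _ _ K le] by simp
qed

end

theorem lemma2p3:
  fixes k :: complex
  assumes "Im k \<ge> 0" and "Re k > 0"
  shows
    "(\<forall>\<phi> \<in> L2_plus_Linf (lebesgue :: real measure).
        (\<forall>x \<in> half_plane. integrable lebesgue (potential_integrand k \<phi> x)) \<and>
        C_infinity_on (potential k \<phi>) half_plane \<and>
        (\<forall>x \<in> half_plane. laplacian (potential k \<phi>) x + k\<^sup>2 * potential k \<phi> x = 0) \<and>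
        (\<forall>I. open I \<and> is_interval I \<and> continuous_on I \<phi> \<longrightarrow>
           continuous_on (half_plane \<union> {0} \<times> I)
             (\<lambda>x. if x \<in> half_plane then potential k \<phi> x else \<phi> (snd x))))
     \<and>
     (Im k > 0 \<longrightarrow>
        (\<exists>C > 0. \<forall>\<phi> \<in> L2_space (lebesgue :: real measure).
           potential k \<phi> \<in> L2_space (lebesgue_on half_plane) \<and>
           L2_norm (lebesgue_on half_plane) (potential k \<phi>) \<le> C * L2_norm lebesgue \<phi>))
     \<and>
     (Im k = 0 \<longrightarrow>
        (\<forall>L > 0. \<exists>C > 0. \<forall>\<phi> \<in> L2_space (lebesgue :: real measure).
           potential k \<phi> \<in> L2_space (lebesgue_on (strip L)) \<and>
           L2_norm (lebesgue_on (strip L)) (potential k \<phi>) \<le> C * L2_norm lebesgue \<phi>))"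
proof -
  interpret wave_number k
    using assms by unfold_locales
  show ?thesis
  proof (intro conjI ballI impI allI)
    fix \<phi> assume "\<phi> \<in> L2_plus_Linf (lebesgue :: real measure)"
    then interpret weighted_density k \<phi> by (rule weighted_densityI)
    show "integrable lebesgue (potential_integrand k \<phi> x)" if "x \<in> half_plane" for x
      using that by (rule potential_integrable)
    show "C_infinity_on (potential k \<phi>) half_plane"
      by (rule potential_smooth)
    show "laplacian (potential k \<phi>) x + k\<^sup>2 * potential k \<phi> x = 0" if "x \<in> half_plane" for x
      using that by (rule potential_helmholtz)
    show "continuous_on (half_plane \<union> {0} \<times> I) (\<lambda>x. if x \<in> half_plane then potential k \<phi> x else \<phi> (snd x))"
      if "open I \<and> is_interval I \<and> continuous_on I \<phi>" for I
      using that by (intro potential_boundary) auto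
  qed (rule potential_L2_half_plane potential_L2_strip, assumption)+
qed

end
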